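(* Let $L^{w}_\infty$ be the white triangular labyrinth fractal generated by an $m$-triangular labyrinth patterns system, and $\mathbf E^w_1,\mathbf E^w_2,\mathbf E^w_3$ its exits. There exists a point $\mathbf C^w\in L^{w}_\infty$ such that $$\{\mathbf C^w\}=a^w_{\{1,2\}}\cap a^w_{\{2,3\}}\cap a^w_{\{1,3\}}.$$ Similarly, for the yellow triangular labyrinth fractal there exists a point $\mathbf C^y\in L^{y}_\infty$ such that $\{\mathbf C^y\}=a^y_{\{1,2\}}\cap a^y_{\{2,3\}}\cap a^y_{\{1,3\}}$.
   Context: **Triangles.** Let $H=\{(\alpha_1,\alpha_2,\alpha_3)\in[0,1]^3:\alpha_1+\alpha_2+\alpha_3=1\}$, $\mathbb N=\{0,1,2,\dots\}$, $\mathbf P_1=(0,0)$, $\mathbf P_2=(1,0)$, $\mathbf P_3=(1/2,\sqrt3/2)$. $\Delta(\mathbf A_1,\mathbf A_2,\mathbf A_3)$ denotes the full closed triangle with (ordered) vertices $\mathbf A_1,\mathbf A_2,\mathbf A_3$, and $T_1=\Delta(\mathbf P_1,\mathbf P_2,\mathbf P_3)$. For $\Delta=\Delta(\mathbf A_1,\mathbf A_2,\mathbf A_3)\subset T_1$ let $P_\Delta:T_1\to T_1$, $\sum\alpha_i\mathbf P_i\mapsto\sum\alpha_i\mathbf A_i$ for $(\alpha_1,\alpha_2,\alpha_3)\in H$. For $m\ge2$ and $(k_1,k_2,k_3)\in\mathbb Z^3$, $T_m(k_1,k_2,k_3)$ is the triangle with ordered vertices $\mathbf A_i=\frac1m\big(k_1\mathbf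 P_1+k_2\mathbf P_2+k_3\mathbf P_3+\mathbf P_i\big)$ and $T'_m(k_1,k_2,k_3)$ is the triangle with ordered vertices $\mathbf A_i=\frac1m\big(k_1\mathbf P_1+k_2\mathbf P_2+k_3\mathbf P_3+\mathbf P_1+\mathbf P_2+\mathbf P_3-\mathbf P_i\big)$, $i=1,2,3$. Put $\mathcal T_m=\{T_m(k_1,k_2,k_3):k_i\in\mathbb N,\ k_1+k_2+k_3=m-1\}$ and $\mathcal T'_m=\{T'_m(k_1,k_2,k_3):k_i\in\mathbb N,\ k_1+k_2+k_3=m-2\}$. $T_m(k_1,k_2,k_3)$ and $T'_m(k'_1,k'_2,k'_3)$ are $j$-neighbours if $k_j=k'_j+1$ and $k_i=k'_i$ for $i\ne j$ (they then share a side). **Patterns systems.** An $m$-triangular patterns system is a pair $(\mathcal W\cup\mathcal W',\mathcal Y\cup\mathcal Y')$ with $\mathcal W,\mathcal Y\subset\mathcal T_m$ and $\mathcal W',\mathcal Y'\subset\mathcal T'_m$. Put $\mathcal W_1=\mathcal W$, $\mathcal W'_1=\mathcal W'$, $\mathcal Y_1=\mathcal Y$, $\mathcal Y'_1=\mathcal Y'$, and for $n\ge2$ $\mathcal W_n=\{P_{U}(V):U\in\mathcal W_{n-1},V\in\mathcal W_1\}\cup\{P_{U}(V):U\in\mathcal W'_{n-1},V\in\mathcal Y'_1\}$, $\mathcal W'_n=\{P_{U}(V):U\in\mathcal W_{n-1},V\in\mathcal W'_1\}\cup\{P_{U}(V):U\in\mathcal W'_{n-1},V\in\mathcal Y_1\}$,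 $\mathcal Y_n=\{P_{U}(V):U\in\mathcal Y_{n-1},V\in\mathcal Y_1\}\cup\{P_{U}(V):U\in\mathcal Y'_{n-1},V\in\mathcal W'_1\}$, $\mathcal Y'_n=\{P_{U}(V):U\in\mathcal Y_{n-1},V\in\mathcal Y'_1\}\cup\{P_{U}(V):U\in\mathcal Y'_{n-1},V\in\mathcal W_1\}$. Then $\mathcal W_n,\mathcal Y_n\subset\mathcal T_{m^n}$, $\mathcal W'_n,\mathcal Y'_n\subset\mathcal T'_{m^n}$. $\mathcal G(\mathcal W_n\cup\mathcal W'_n)$ is the undirected graph with vertex set $\mathcal W_n\cup\mathcal W'_n$ in which two vertices are joined by an edge labelled $j$ iff they are $j$-neighbours; $\mathcal G(\mathcal Y_n\cup\mathcal Y'_n)$ is defined analogously. **Labyrinth patterns systems.** The system is an $m$-triangular labyrinth patterns system if: (1) (tree property) $\mathcal G(\mathcal W\cup\mathcal W')$ and $\mathcal G(\mathcal Y\cup\mathcal Y')$ are trees; (2) (exits property) there is exactly one triple $(k_1,k_2,k_3)$ of integers in $\{0,\dots,m-1\}$ with $T_m(0,k_1,m-1-k_1)\in\mathcal W$, $T_m(0,m-1-k_1,k_1)\in\mathcal Y$, $T_m(k_2,0,m-1-k_2)\in\mathcal W$, $T_m(m-1-k_2,0,k_2)\in\mathcal Y$, $T_m(k_3,m-1-k_3,0)\in\mathcal W$, $T_m(m-1-k_3,k_3,0)\in\mathcal Y$; (3) (corners property) the sets $\mathcal C(\mathcal W)$, $\mathcal C(\mathcal Y)$ of elements of $\mathcal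 W$, resp. $\mathcal Y$, that contain one of $\mathbf P_1,\mathbf P_2,\mathbf P_3$ are disjoint and each has at most one element. The exits of the patterns are $e^w_1=T_m(0,k_1,m-1-k_1)$, $e^w_2=T_m(k_2,0,m-1-k_2)$, $e^w_3=T_m(k_3,m-1-k_3,0)$ and $e^y_1=T_m(0,m-1-k_1,k_1)$, $e^y_2=T_m(m-1-k_2,0,k_2)$, $e^y_3=T_m(m-1-k_3,k_3,0)$. For each $n\ge1$ the pair $(\mathcal W_n\cup\mathcal W'_n,\mathcal Y_n\cup\mathcal Y'_n)$ is an $m^n$-triangular labyrinth patterns system; its exits are denoted $e^w_i(n)$, $e^y_i(n)$. **Fractals and arcs.** $L^{w}_n$ (resp. $L^{y}_n$) is the union of all triangles in $\mathcal W_n\cup\mathcal W'_n$ (resp. $\mathcal Y_n\cup\mathcal Y'_n$); $L^{w}_\infty=\bigcap_{n\ge1}L^{w}_n$ and $L^{y}_\infty=\bigcap_{n\ge1}L^{y}_n$ are the white and yellow triangular labyrinth fractals. They are dendrites, so any two distinct points are joined by a unique arc inside the fractal. The exits of the fractals are the points $\mathbf E^w_i,\mathbf E^y_i$ with $\{\mathbf E^w_i\}=\bigcap_{n\ge1}e^w_i(n)$, $\{\mathbf E^y_i\}=\bigcap_{n\ge1}e^y_i(n)$, $i=1,2,3$. For distinct $i,j\in\{1,2,3\}$, $a^w_{\{i,j\}}$ is the arc in $L^w_\infty$ connecting $\mathbf E^w_i$ and $\mathbf E^w_j$, and $a^y_{\{i,j\}}$ is the arc in $L^y_\infty$ connecting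 $\mathbf E^y_i$ and $\mathbf E^y_j$. *)

theory Defs
  imports "HOL-Analysis.Analysis"
begin

section \<open>Triangles\<close>

type_synonym point = "real \<times> real"

text \<open>A triangle is the triple of its ordered vertices; \<open>region\<close> is the closed point set.\<close>

type_synonym triangle = "point \<times> point \<times> point"

definition P1 :: point where "P1 = (0, 0)"
definition P2 :: point where "P2 = (1, 0)"
definition P3 :: point where "P3 = (1/2, sqrt 3 / 2)"

fun region :: "triangle \<Rightarrow> point set" where
  "region (A1, A2, A3) = convex hull {A1, A2, A3}"

definition H :: "(real \<times> real \<times> real) set" where
  "H = {(a1, a2, a3). a1 \<in> {0..1} \<and> a2 \<in> {0..1} \<and> a3 \<in> {0..1} \<and> a1 + a2 + a3 = 1}"

text \<open>The map \<open>P\<^sub>\<Delta>\<close>; it is meaningful only on \<open>region (P1, P2, P3)\<close>, where barycentric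
  coordinates exist and are unique (see \<open>tri_map_barycentric\<close>).\<close>

fun tri_map :: "triangle \<Rightarrow> point \<Rightarrow> point" where
  "tri_map (A1, A2, A3) x =
     (THE y. \<exists>(a1, a2, a3) \<in> H. x = a1 *\<^sub>R P1 + a2 *\<^sub>R P2 + a3 *\<^sub>R P3
                             \<and> y = a1 *\<^sub>R A1 + a2 *\<^sub>R A2 + a3 *\<^sub>R A3)"

lemma tri_map_barycentric:
  assumes "(a1, a2, a3) \<in> H"
  shows "tri_map (A1, A2, A3) (a1 *\<^sub>R P1 + a2 *\<^sub>R P2 + a3 *\<^sub>R P3)
           = a1 *\<^sub>R A1 + a2 *\<^sub>R A2 + a3 *\<^sub>R A3"
proof -
  have uniq: "b1 = a1 \<and> b2 = a2 \<and> b3 = a3"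
    if "(b1, b2, b3) \<in> H"
      and eq: "a1 *\<^sub>R P1 + a2 *\<^sub>R P2 + a3 *\<^sub>R P3 = b1 *\<^sub>R P1 + b2 *\<^sub>R P2 + b3 *\<^sub>R P3"
    for b1 b2 b3
  proof -
    have "a3 = b3" and "a2 + a3 / 2 = b2 + b3 / 2"
      using eq by (simp_all add: P1_def P2_def P3_def)
    then show ?thesis using assms that(1) by (auto simp: H_def)
  qed
  show ?thesis
    unfolding tri_map.simps
  proof (rule the_equality)
    show "\<exists>(b1, b2, b3) \<in> H.
        a1 *\<^sub>R P1 + a2 *\<^sub>R P2 + a3 *\<^sub>R P3 = b1 *\<^sub>R P1 + b2 *\<^sub>R P2 + b3 *\<^sub>R P3
      \<and> a1 *\<^sub>R A1 + a2 *\<^sub>R A2 + a3 *\<^sub>R A3 = b1 *\<^sub>R A1 + b2 *\<^sub>R A2 + b3 *\<^sub>R A3"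
      by (rule bexI[OF _ assms]) simp
  next
    fix y
    assume "\<exists>(b1, b2, b3) \<in> H.
        a1 *\<^sub>R P1 + a2 *\<^sub>R P2 + a3 *\<^sub>R P3 = b1 *\<^sub>R P1 + b2 *\<^sub>R P2 + b3 *\<^sub>R P3
      \<and> y = b1 *\<^sub>R A1 + b2 *\<^sub>R A2 + b3 *\<^sub>R A3"
    then obtain b1 b2 b3 where "(b1, b2, b3) \<in> H"
      and "a1 *\<^sub>R P1 + a2 *\<^sub>R P2 + a3 *\<^sub>R P3 = b1 *\<^sub>R P1 + b2 *\<^sub>R P2 + b3 *\<^sub>R P3"
      and y: "y = b1 *\<^sub>R A1 + b2 *\<^sub>R A2 + b3 *\<^sub>R A3"
      by (elim bexE) (simp split: prod.splits)
    with uniq show "y = a1 *\<^sub>R A1 + a2 *\<^sub>R A2 + a3 *\<^sub>R A3"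
      by metis
  qed
qed

text \<open>The triangle \<open>P\<^sub>U(V)\<close>, with the vertex order inherited from \<open>V\<close>.\<close>

fun tri_image :: "triangle \<Rightarrow> triangle \<Rightarrow> triangle" where
  "tri_image U (B1, B2, B3) = (tri_map U B1, tri_map U B2, tri_map U B3)"

definition tri_T :: "nat \<Rightarrow> int \<Rightarrow> int \<Rightarrow> int \<Rightarrow> triangle" where
  "tri_T m k1 k2 k3 =
     (let K = of_int k1 *\<^sub>R P1 + of_int k2 *\<^sub>R P2 + of_int k3 *\<^sub>R P3
      in ((1 / real m) *\<^sub>R (K + P1),
          (1 / real m) *\<^sub>R (K + P2),
          (1 / real m) *\<^sub>R (K + P3)))"

definition tri_T' :: "nat \<Rightarrow> int \<Rightarrow> int \<Rightarrow> int \<Rightarrow> triangle" where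
  "tri_T' m k1 k2 k3 =
     (let K = of_int k1 *\<^sub>R P1 + of_int k2 *\<^sub>R P2 + of_int k3 *\<^sub>R P3
      in ((1 / real m) *\<^sub>R (K + P1 + P2 + P3 - P1),
          (1 / real m) *\<^sub>R (K + P1 + P2 + P3 - P2),
          (1 / real m) *\<^sub>R (K + P1 + P2 + P3 - P3)))"

definition tris :: "nat \<Rightarrow> triangle set" where
  "tris m = {tri_T m (int k1) (int k2) (int k3) | k1 k2 k3. k1 + k2 + k3 = m - 1}"

definition tris' :: "nat \<Rightarrow> triangle set" where
  "tris' m = {tri_T' m (int k1) (int k2) (int k3) | k1 k2 k3. k1 + k2 + k3 = m - 2}"

text \<open>As \<open>P1 = 0\<close>, \<open>tri_T m k1 k2 k3\<close> does not depend on \<open>k1\<close>: the indices are determined by the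
  triangle only once their sum is fixed. The neighbour relation therefore ranges over the
  index triples of \<open>tris m\<close> and \<open>tris' m\<close>.\<close>

definition neighbours :: "nat \<Rightarrow> nat \<Rightarrow> triangle \<Rightarrow> triangle \<Rightarrow> bool" where
  "neighbours m j U U' \<longleftrightarrow> j \<in> {1, 2, 3} \<and>
     (\<exists>k1 k2 k3 :: nat. k1 + k2 + k3 = m - 2 \<and>
        U' = tri_T' m (int k1) (int k2) (int k3) \<and>
        U = tri_T m (int k1 + (if j = 1 then 1 else 0))
                    (int k2 + (if j = 2 then 1 else 0))
                    (int k3 + (if j = 3 then 1 else 0)))"


section \<open>Patterns systems\<close>

record patterns_system =
  white :: "triangle set"
  white' :: "triangle set"
  yellow :: "triangle set"
  yellow' :: "triangle set"

definition triangular_patterns_system :: "nat \<Rightarrow> patterns_system \<Rightarrow> bool" where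
  "triangular_patterns_system m S \<longleftrightarrow> m \<ge> 2 \<and>
     white S \<subseteq> tris m \<and> yellow S \<subseteq> tris m \<and> white' S \<subseteq> tris' m \<and> yellow' S \<subseteq> tris' m"

definition refine :: "patterns_system \<Rightarrow> patterns_system \<Rightarrow> patterns_system" where
  "refine R S = \<lparr>
     white = {tri_image U V | U V. U \<in> white R \<and> V \<in> white S}
           \<union> {tri_image U V | U V. U \<in> white' R \<and> V \<in> yellow' S},
     white' = {tri_image U V | U V. U \<in> white R \<and> V \<in> white' S}
            \<union> {tri_image U V | U V. U \<in> white' R \<and> V \<in> yellow S},
     yellow = {tri_image U V | U V. U \<in> yellow R \<and> V \<in> yellow S}
            \<union> {tri_image U V | U V. U \<in> yellow' R \<and> V \<in> white' S},
     yellow' = {tri_image U V | U V. U \<in> yellow R \<and> V \<in> yellow' S}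
             \<union> {tri_image U V | U V. U \<in> yellow' R \<and> V \<in> white S} \<rparr>"

text \<open>\<open>level S n\<close> is the system of order \<open>n \<ge> 1\<close>; \<open>level S 0\<close> is unspecified.\<close>

fun level :: "patterns_system \<Rightarrow> nat \<Rightarrow> patterns_system" where
  "level S (Suc 0) = S"
| "level S (Suc (Suc n)) = refine (level S (Suc n)) S"


section \<open>Labyrinth patterns systems\<close>

text \<open>The edges of the graph on the vertex set \<open>V\<close>, each paired with its label.\<close>

definition labelled_edges :: "nat \<Rightarrow> triangle set \<Rightarrow> (triangle set \<times> nat) set" where
  "labelled_edges m V = {({U, U'}, j) | U U' j. U \<in> V \<and> U' \<in> V \<and> neighbours m j U U'}"

text \<open>Trees among simple undirected graphs, given by vertices and two-element edges. (The
  predicate \<open>tree\<close> of the AFP entry Graph Theory is about directed cycles: an edge, viewed as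
  a pair of opposite arcs, already violates it.)\<close>

definition undirected_connected :: "'a set \<Rightarrow> 'a set set \<Rightarrow> bool" where
  "undirected_connected V E \<longleftrightarrow> V \<noteq> {} \<and>
     (\<forall>u\<in>V. \<forall>v\<in>V. (u, v) \<in> {(x, y). x \<in> V \<and> y \<in> V \<and> {x, y} \<in> E}\<^sup>*)"

definition undirected_cycle :: "'a set \<Rightarrow> 'a set set \<Rightarrow> 'a list \<Rightarrow> bool" where
  "undirected_cycle V E vs \<longleftrightarrow> length vs \<ge> 3 \<and> distinct vs \<and> set vs \<subseteq> V \<and>
     successively (\<lambda>x y. {x, y} \<in> E) vs \<and> {last vs, hd vs} \<in> E"

definition undirected_tree :: "'a set \<Rightarrow> 'a set set \<Rightarrow> bool" where
  "undirected_tree V E \<longleftrightarrow> undirected_connected V E \<and> (\<nexists>vs. undirected_cycle V E vs)"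

definition tree_property :: "nat \<Rightarrow> patterns_system \<Rightarrow> bool" where
  "tree_property m S \<longleftrightarrow>
     undirected_tree (white S \<union> white' S) (fst ` labelled_edges m (white S \<union> white' S)) \<and>
     undirected_tree (yellow S \<union> yellow' S) (fst ` labelled_edges m (yellow S \<union> yellow' S))"

fun exit_triple :: "nat \<Rightarrow> patterns_system \<Rightarrow> int \<times> int \<times> int \<Rightarrow> bool" where
  "exit_triple m S (k1, k2, k3) \<longleftrightarrow>
     k1 \<in> {0..int m - 1} \<and> k2 \<in> {0..int m - 1} \<and> k3 \<in> {0..int m - 1} \<and>
     tri_T m 0 k1 (int m - 1 - k1) \<in> white S \<and> tri_T m 0 (int m - 1 - k1) k1 \<in> yellow S \<and>
     tri_T m k2 0 (int m - 1 - k2) \<in> white S \<and> tri_T m (int m - 1 - k2) 0 k2 \<in> yellow S \<and>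
     tri_T m k3 (int m - 1 - k3) 0 \<in> white S \<and> tri_T m (int m - 1 - k3) k3 0 \<in> yellow S"

definition exits_property :: "nat \<Rightarrow> patterns_system \<Rightarrow> bool" where
  "exits_property m S \<longleftrightarrow> (\<exists>!k. exit_triple m S k)"

definition corner_triangles :: "triangle set \<Rightarrow> triangle set" where
  "corner_triangles A = {U \<in> A. P1 \<in> region U \<or> P2 \<in> region U \<or> P3 \<in> region U}"

definition corners_property :: "patterns_system \<Rightarrow> bool" where
  "corners_property S \<longleftrightarrow>
     corner_triangles (white S) \<inter> corner_triangles (yellow S) = {} \<and>
     (\<forall>U \<in> corner_triangles (white S). \<forall>V \<in> corner_triangles (white S). U = V) \<and>
     (\<forall>U \<in> corner_triangles (yellow S). \<forall>V \<in> corner_triangles (yellow S). U = V)"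

definition labyrinth_patterns_system :: "nat \<Rightarrow> patterns_system \<Rightarrow> bool" where
  "labyrinth_patterns_system m S \<longleftrightarrow>
     triangular_patterns_system m S \<and> tree_property m S \<and> exits_property m S \<and> corners_property S"

text \<open>The exits of the patterns, for \<open>i\<close> in \<open>{1, 2, 3}\<close>.\<close>

definition white_exit :: "nat \<Rightarrow> patterns_system \<Rightarrow> nat \<Rightarrow> triangle" where
  "white_exit m S i =
     (let (k1, k2, k3) = (THE k. exit_triple m S k)
      in if i = 1 then tri_T m 0 k1 (int m - 1 - k1)
         else if i = 2 then tri_T m k2 0 (int m - 1 - k2)
         else tri_T m k3 (int m - 1 - k3) 0)"

definition yellow_exit :: "nat \<Rightarrow> patterns_system \<Rightarrow> nat \<Rightarrow> triangle" where
  "yellow_exit m S i =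
     (let (k1, k2, k3) = (THE k. exit_triple m S k)
      in if i = 1 then tri_T m 0 (int m - 1 - k1) k1
         else if i = 2 then tri_T m (int m - 1 - k2) 0 k2
         else tri_T m (int m - 1 - k3) k3 0)"


section \<open>Fractals, exits and arcs\<close>

definition white_set :: "patterns_system \<Rightarrow> nat \<Rightarrow> point set" where
  "white_set S n = (\<Union>U \<in> white (level S n) \<union> white' (level S n). region U)"

definition yellow_set :: "patterns_system \<Rightarrow> nat \<Rightarrow> point set" where
  "yellow_set S n = (\<Union>U \<in> yellow (level S n) \<union> yellow' (level S n). region U)"

definition white_fractal :: "patterns_system \<Rightarrow> point set" where
  "white_fractal S = (\<Inter>n\<in>{1..}. white_set S n)"

definition yellow_fractal :: "patterns_system \<Rightarrow> point set" where
  "yellow_fractal S = (\<Inter>n\<in>{1..}. yellow_set S n)"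

definition white_exit_point :: "nat \<Rightarrow> patterns_system \<Rightarrow> nat \<Rightarrow> point" where
  "white_exit_point m S i =
     (THE x. {x} = (\<Inter>n\<in>{1..}. region (white_exit (m ^ n) (level S n) i)))"

definition yellow_exit_point :: "nat \<Rightarrow> patterns_system \<Rightarrow> nat \<Rightarrow> point" where
  "yellow_exit_point m S i =
     (THE x. {x} = (\<Inter>n\<in>{1..}. region (yellow_exit (m ^ n) (level S n) i)))"

text \<open>The arc in \<open>X\<close> from \<open>x\<close> to \<open>y\<close>, as a point set; meaningful when it is unique, as it is for
  distinct points of a dendrite.\<close>

definition the_arc :: "'a::topological_space set \<Rightarrow> 'a \<Rightarrow> 'a \<Rightarrow> 'a set" where
  "the_arc X x y =
     (THE A. A \<subseteq> X \<and> (\<exists>g. arc g \<and> path_image g = A \<and> pathstart g = x \<and> pathfinish g = y))"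

definition white_arc :: "nat \<Rightarrow> patterns_system \<Rightarrow> nat \<Rightarrow> nat \<Rightarrow> point set" where
  "white_arc m S i j = the_arc (white_fractal S) (white_exit_point m S i) (white_exit_point m S j)"

definition yellow_arc :: "nat \<Rightarrow> patterns_system \<Rightarrow> nat \<Rightarrow> nat \<Rightarrow> point set" where
  "yellow_arc m S i j = the_arc (yellow_fractal S) (yellow_exit_point m S i) (yellow_exit_point m S j)"

end

theory Submission
  imports Defs
begin

text \<open>
  The white and the yellow fractal form a graph-directed self-similar system: an upright piece
  carries a copy of the fractal of its own colour, an inverted piece a copy of the other one. By the
  corners property two pieces that are not neighbours never touch, and by the exits property
  neighbouring pieces touch exactly in their common exit. Hence a fractal is a finite tree of smaller
  copies, glued in single points that are exits of these copies. A continuum that contains two exits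
  must pass through all glueing points between them, at every order of refinement, so any arc
  between two exits is contained in any continuum joining them. In particular arcs between exits are
  unique; their existence follows by concatenating rescaled paths and passing to the uniform
  limit. The point \<open>C\<close> is the last point of the arc from the first exit to the third one that lies on
  the arc from the first exit to the second.
\<close>

subsection \<open>Branches of finite trees\<close>

text \<open>\<open>the_arc\<close> is a definite description, so every use of it must be backed by
  existence and uniqueness; both are derived for pairs of exits only, without any theory of
  dendrites. To run an induction over orders of refinement, the hypotheses have to survive
  restriction to a piece and rescaling. Two connected sets that meet in a single point do, once a
  retraction shows that traces of connected sets on a piece are connected and that exits go to
  exits. As the address of a point is infinite, a finite depth \<open>n\<close> only yields a point
  within \<open>D * r ^ n\<close>; closedness then finishes. Keeping the third set an arbitrary
  continuum, not an arc, permits the comparison with unions of subarcs in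
  \<open>triple_point\<close>. On the geometric side everything rests on integrality: the grid maps
  act on barycentric coordinates by \<open>(k + \<beta>) / m\<close> or
  \<open>(l - \<beta>) / m\<close>, so a common point of two pieces makes the difference or the sum
  of the coordinates of two fractal points integral. Coordinates lie between 0 and 1, hence only
  corners and mirror pairs on a side are left. The corners property removes the former, the exits
  property reduces the latter to one point.\<close>

abbreviation edge_rel :: "'a set \<Rightarrow> 'a set set \<Rightarrow> ('a \<times> 'a) set" where
  "edge_rel A E \<equiv> {(x, y). x \<in> A \<and> y \<in> A \<and> {x, y} \<in> E}"

lemma edge_rel_rtrancl_sym: "(x, y) \<in> (edge_rel A E)\<^sup>* \<Longrightarrow> (y, x) \<in> (edge_rel A E)\<^sup>*"
  by (rule symD[OF sym_rtrancl]) (auto simp: sym_def insert_commute)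

lemma edge_rel_rtrancl_mem: "(x, y) \<in> (edge_rel A E)\<^sup>* \<Longrightarrow> x \<in> A \<Longrightarrow> y \<in> A"
  by (induction rule: rtrancl_induct) auto

text \<open>Acyclicity speaks of lists of distinct vertices, reachability does not. Whenever a
  further step returns to a visited vertex, the list is cut back to that vertex.\<close>

lemma edge_rel_distinct_path:
  assumes "(x, y) \<in> (edge_rel A E)\<^sup>*" "x \<in> A"
  shows "\<exists>vs. vs \<noteq> [] \<and> hd vs = x \<and> last vs = y \<and> distinct vs \<and> set vs \<subseteq> A \<and>
           successively (\<lambda>x y. {x, y} \<in> E) vs"
  using assms
proof (induction rule: rtrancl_induct)
  case base
  then show ?case by (intro exI[of _ "[x]"]) auto
next
  case (step y z)
  then obtain vs where vs: "vs \<noteq> []" "hd vs = x" "last vs = y" "distinct vs" "set vs \<subseteq> A"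
    "successively (\<lambda>x y. {x, y} \<in> E) vs" by blast
  show ?case
  proof (cases "z \<in> set vs")
    case True
    then obtain ys zs where eq: "vs = (ys @ [z]) @ zs" by (auto simp: in_set_conv_decomp)
    have "hd (ys @ [z]) = x" using vs(2) unfolding eq by (cases ys) auto
    then show ?thesis using vs unfolding eq
      by (intro exI[of _ "ys @ [z]"]) (auto simp: successively_append_iff)
  next
    case False
    then show ?thesis using vs step.hyps
      by (intro exI[of _ "vs @ [z]"]) (auto simp: successively_append_iff)
  qed
qed

lemma path_edge_rel:
  assumes "successively (\<lambda>x y. {x, y} \<in> E) vs" "set vs \<subseteq> A" "vs \<noteq> []"
  shows "(hd vs, last vs) \<in> (edge_rel A E)\<^sup>*"
  using assms
proof (induction vs)
  case (Cons a vs)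
  show ?case
  proof (cases vs)
    case (Cons b ws)
    then have "(b, last vs) \<in> (edge_rel A E)\<^sup>*" using Cons.IH Cons.prems by auto
    moreover have "(a, b) \<in> edge_rel A E" using Cons.prems Cons by auto
    ultimately show ?thesis using Cons by (auto intro: converse_rtrancl_into_rtrancl)
  qed auto
qed auto

text \<open>In a tree, the neighbours \<open>w\<close> of \<open>u\<close> stand for the components that remain after deleting \<open>u\<close>.\<close>

definition in_branch :: "'a set \<Rightarrow> 'a set set \<Rightarrow> 'a \<Rightarrow> 'a \<Rightarrow> 'a \<Rightarrow> bool" where
  "in_branch V E u w v \<longleftrightarrow> w \<in> V - {u} \<and> {u, w} \<in> E \<and> (w, v) \<in> (edge_rel (V - {u}) E)\<^sup>*"

lemma in_branch_refl: "w \<in> V \<Longrightarrow> w \<noteq> u \<Longrightarrow> {u, w} \<in> E \<Longrightarrow> in_branch V E u w w"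
  by (auto simp: in_branch_def)

lemma in_branch_mem: "in_branch V E u w v \<Longrightarrow> v \<in> V \<and> v \<noteq> u"
  using edge_rel_rtrancl_mem[of w v "V - {u}" E] by (auto simp: in_branch_def)

lemma in_branch_edge:
  "in_branch V E u w v \<Longrightarrow> {v, v'} \<in> E \<Longrightarrow> v' \<in> V \<Longrightarrow> v' \<noteq> u \<Longrightarrow> in_branch V E u w v'"
  using in_branch_mem[of V E u w v] by (auto simp: in_branch_def intro: rtrancl_into_rtrancl)

lemma in_branch_exists:
  assumes "undirected_tree V E" "u \<in> V" "v \<in> V" "v \<noteq> u"
  obtains w where "in_branch V E u w v"
proof -
  have "(u, v) \<in> (edge_rel V E)\<^sup>*"
    using assms by (auto simp: undirected_tree_def undirected_connected_def)
  then have "v = u \<or> (\<exists>w. in_branch V E u w v)"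
  proof (induction rule: rtrancl_induct)
    case (step y z)
    then show ?case by (cases "z = u") (auto intro: in_branch_refl in_branch_edge)
  qed simp
  then show thesis using that assms by blast
qed

text \<open>A simple path between two neighbours of \<open>u\<close> that avoids \<open>u\<close>
  would close up through \<open>u\<close> to a cycle.\<close>

lemma in_branch_unique:
  assumes "undirected_tree V E" "u \<in> V" "in_branch V E u w v" "in_branch V E u w' v"
  shows "w = w'"
proof (rule ccontr)
  assume "w \<noteq> w'"
  have "(w, w') \<in> (edge_rel (V - {u}) E)\<^sup>*"
    using assms(3,4) edge_rel_rtrancl_sym[of w' v "V - {u}" E] rtrancl_trans[of w v _ w']
    by (simp only: in_branch_def)
  moreover have "w \<in> V - {u}" using assms(3) by (simp only: in_branch_def)
  ultimately obtain vs where vs: "vs \<noteq> []" "hd vs = w" "last vs = w'" "distinct vs"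
    "set vs \<subseteq> V - {u}" "successively (\<lambda>x y. {x, y} \<in> E) vs"
    using edge_rel_distinct_path[of w w'] by blast
  have "length vs \<ge> 2"
    using vs(1-3) \<open>w \<noteq> w'\<close> by (cases vs rule: remdups_adj.cases) auto
  then have "undirected_cycle V E (u # vs)"
    using vs assms
      by (auto simp: undirected_cycle_def in_branch_def insert_commute successively_Cons)
  then show False using assms(1) by (auto simp: undirected_tree_def)
qed

text \<open>A simple path from \<open>u\<close> to \<open>v\<close> avoiding \<open>u'\<close>
  leaves \<open>u\<close> through a neighbour other than \<open>u'\<close>, and would thus put
  \<open>v\<close> into a second branch at \<open>u\<close>.\<close>

lemma in_branch_asym:
  assumes "undirected_tree V E" "u \<in> V" "u' \<in> V" "in_branch V E u u' v"
  shows "\<not> in_branch V E u' u v"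
proof
  assume "in_branch V E u' u v"
  then have "(u, v) \<in> (edge_rel (V - {u'}) E)\<^sup>*" "u \<in> V - {u'}"
    by (simp_all only: in_branch_def)
  then obtain vs where vs: "vs \<noteq> []" "hd vs = u" "last vs = v" "distinct vs"
    "set vs \<subseteq> V - {u'}" "successively (\<lambda>x y. {x, y} \<in> E) vs"
    using edge_rel_distinct_path[of u v] by blast
  obtain w ws where eq: "vs = u # w # ws"
    using vs(1-3) in_branch_mem[OF assms(4)] by (cases vs rule: remdups_adj.cases) auto
  have "(w, v) \<in> (edge_rel (V - {u}) E)\<^sup>*"
    using path_edge_rel[of E "w # ws" "V - {u}"] vs unfolding eq by auto
  then have "in_branch V E u w v"
    using vs unfolding eq in_branch_def by auto
  then have "w = u'" using in_branch_unique[OF assms(1,2) _ assms(4)] by simp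
  then show False using vs unfolding eq by auto
qed

subsection \<open>Tree-like graph-directed self-similar sets\<close>

text \<open>The colour \<open>c\<close> indexes mutually dependent attractors: the piece \<open>u\<close> of \<open>L c\<close> is a similar copy
  of \<open>L (\<kappa> c u)\<close>. The points \<open>X c i\<close> are the exits of \<open>L c\<close>.\<close>

locale tree_ifs =
  fixes V :: "'c \<Rightarrow> 'v set" and E :: "'c \<Rightarrow> 'v set set"
    and f :: "'v \<Rightarrow> 'a::euclidean_space \<Rightarrow> 'a" and \<kappa> :: "'c \<Rightarrow> 'v \<Rightarrow> 'c"
    and L :: "'c \<Rightarrow> 'a set" and X :: "'c \<Rightarrow> 'i \<Rightarrow> 'a" and I :: "'i set" and r D :: real
  assumes finite_V: "finite (V c)"
    and tree: "undirected_tree (V c) (E c)"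
    and r: "0 < r" "r < 1"
    and dist_f: "u \<in> V c \<Longrightarrow> dist (f u x) (f u y) = r * dist x y"
    and compact_L: "compact (L c)"
    and dist_L: "x \<in> L c \<Longrightarrow> y \<in> L c \<Longrightarrow> dist x y \<le> D"
    and L_eq: "L c = (\<Union>u\<in>V c. f u ` L (\<kappa> c u))"
    and X_mem: "i \<in> I \<Longrightarrow> X c i \<in> L c"
    and X_self: "i \<in> I \<Longrightarrow> \<exists>u\<in>V c. \<exists>i'\<in>I. X c i = f u (X (\<kappa> c u) i')"
    and adjacent: "u \<in> V c \<Longrightarrow> v \<in> V c \<Longrightarrow> u \<noteq> v \<Longrightarrow> {u, v} \<in> E c \<Longrightarrow>
      \<exists>l\<in>I. f u ` L (\<kappa> c u) \<inter> f v ` L (\<kappa> c v) = {f u (X (\<kappa> c u) l)}"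
    and nonadjacent: "u \<in> V c \<Longrightarrow> v \<in> V c \<Longrightarrow> u \<noteq> v \<Longrightarrow> {u, v} \<notin> E c \<Longrightarrow>
      f u ` L (\<kappa> c u) \<inter> f v ` L (\<kappa> c v) = {}"
begin

definition K :: "'c \<Rightarrow> 'v \<Rightarrow> 'a set" where
  "K c u = f u ` L (\<kappa> c u)"

lemma continuous_f: "u \<in> V c \<Longrightarrow> continuous_on A (f u)"
  unfolding continuous_on_iff
proof safe
  fix x and e :: real assume "u \<in> V c" "e > 0"
  then show "\<exists>d>0. \<forall>x'\<in>A. dist x' x < d \<longrightarrow> dist (f u x') (f u x) < e"
    using r dist_f by (intro exI[of _ "e / r"]) (auto simp: field_simps)
qed

lemma inj_f: "u \<in> V c \<Longrightarrow> f u x = f u y \<longleftrightarrow> x = y"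
  using dist_f[of u c x y] r by auto

lemma closed_K: "u \<in> V c \<Longrightarrow> closed (K c u)"
  unfolding K_def by (intro compact_imp_closed compact_continuous_image continuous_f compact_L)

lemma L_pieces: "L c = (\<Union>u\<in>V c. K c u)"
  unfolding K_def by (rule L_eq)

section \<open>Branches and gates of a piece\<close>

definition Br :: "'c \<Rightarrow> 'v \<Rightarrow> 'v \<Rightarrow> 'a set" where
  "Br c u w = (\<Union>v\<in>{v. in_branch (V c) (E c) u w v}. K c v)"

definition nbs :: "'c \<Rightarrow> 'v \<Rightarrow> 'v set" where
  "nbs c u = {w \<in> V c. w \<noteq> u \<and> {u, w} \<in> E c}"

lemma closed_Br: "closed (Br c u w)"
  unfolding Br_def
proof (rule closed_UN)
  show "finite {v. in_branch (V c) (E c) u w v}"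
    by (rule finite_subset[OF _ finite_V[of c]]) (auto dest: in_branch_mem)
qed (auto dest!: in_branch_mem intro: closed_K)

lemma K_subset_Br: "w \<in> nbs c u \<Longrightarrow> K c w \<subseteq> Br c u w"
  unfolding Br_def nbs_def by (auto intro: in_branch_refl)

lemma K_subset_L: "u \<in> V c \<Longrightarrow> K c u \<subseteq> L c"
  by (auto simp: L_pieces)

lemma Br_subset_L: "Br c u w \<subseteq> L c"
  unfolding Br_def using in_branch_mem[of "V c" "E c" u w] by (intro UN_least K_subset_L) simp

lemma in_branch_nbs: "in_branch (V c) (E c) u w v \<Longrightarrow> w \<in> nbs c u"
  by (auto simp: in_branch_def nbs_def)

lemma L_branches: "u \<in> V c \<Longrightarrow> L c = K c u \<union> (\<Union>w\<in>nbs c u. Br c u w)"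
proof (intro equalityI subsetI)
  fix x assume u: "u \<in> V c" and "x \<in> L c"
  then obtain v where v: "v \<in> V c" "x \<in> K c v" by (auto simp: L_pieces)
  show "x \<in> K c u \<union> (\<Union>w\<in>nbs c u. Br c u w)"
  proof (cases "v = u")
    case False
    then obtain w where "in_branch (V c) (E c) u w v" using in_branch_exists[OF tree u] v by metis
    then show ?thesis using v in_branch_nbs by (fastforce simp: Br_def)
  qed (use v in auto)
qed (use Br_subset_L K_subset_L in blast)

lemma K_Int_edge:
  "x \<in> K c u \<Longrightarrow> x \<in> K c v \<Longrightarrow> u \<in> V c \<Longrightarrow> v \<in> V c \<Longrightarrow> u \<noteq> v \<Longrightarrow> {u, v} \<in> E c"
  using nonadjacent[of u c v] unfolding K_def by blast

text \<open>Touching pieces are equal or joined by an edge, and an edge that avoids \<open>u\<close>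
  does not leave its branch.\<close>

lemma Br_disjoint:
  assumes u: "u \<in> V c" and x: "x \<in> Br c u w" "x \<in> Br c u w'"
  shows "w = w'"
proof -
  obtain v v' where v: "in_branch (V c) (E c) u w v" "x \<in> K c v"
    and v': "in_branch (V c) (E c) u w' v'" "x \<in> K c v'"
    using x by (auto simp: Br_def)
  have "in_branch (V c) (E c) u w v'"
  proof (cases "v = v'")
    case False
    then show ?thesis using K_Int_edge v v' in_branch_mem in_branch_edge by metis
  qed (use v in simp)
  then show ?thesis using in_branch_unique[OF tree u] v' by metis
qed

definition gate :: "'c \<Rightarrow> 'v \<Rightarrow> 'v \<Rightarrow> 'a" where
  "gate c u w = the_elem (K c u \<inter> K c w)"

lemma gate:
  assumes "u \<in> V c" "w \<in> nbs c u"
  shows "K c u \<inter> K c w = {gate c u w}" "\<exists>l\<in>I. gate c u w = f u (X (\<kappa> c u) l)"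
proof -
  obtain l where l: "l \<in> I" "K c u \<inter> K c w = {f u (X (\<kappa> c u) l)}"
    using adjacent[of u c w] assms by (auto simp: K_def nbs_def)
  then have "gate c u w = f u (X (\<kappa> c u) l)" by (simp add: gate_def)
  with l show "K c u \<inter> K c w = {gate c u w}" "\<exists>l\<in>I. gate c u w = f u (X (\<kappa> c u) l)"
    by auto
qed

text \<open>A piece of the branch that touches \<open>K c u\<close> is a neighbour of
  \<open>u\<close>, hence the root of its own branch; so it can only be \<open>w\<close>
  itself.\<close>

lemma Br_Int_K:
  assumes u: "u \<in> V c" and w: "w \<in> nbs c u"
  shows "Br c u w \<inter> K c u = {gate c u w}"
proof -
  have "x = gate c u w" if x: "x \<in> Br c u w" "x \<in> K c u" for x
  proof -
    obtain v where v: "in_branch (V c) (E c) u w v" "x \<in> K c v"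
      using x(1) by (auto simp: Br_def)
    then have vV: "v \<in> V c" "v \<noteq> u" using in_branch_mem by metis+
    then have "{u, v} \<in> E c" using K_Int_edge[OF x(2) v(2) u] by metis
    then have "in_branch (V c) (E c) u v v" using vV in_branch_refl by metis
    then have "w = v" using in_branch_unique[OF tree u v(1)] by metis
    then show ?thesis using gate(1)[OF u w] v x by auto
  qed
  moreover have "gate c u w \<in> Br c u w" "gate c u w \<in> K c u"
    using gate(1)[OF u w] K_subset_Br[OF w] by auto
  ultimately show ?thesis by blast
qed

text \<open>The retraction onto a piece that collapses every branch to its gate.\<close>

definition ret :: "'c \<Rightarrow> 'v \<Rightarrow> 'a \<Rightarrow> 'a" where
  "ret c u x = (if x \<in> K c u then x else gate c u (SOME w. w \<in> nbs c u \<and> x \<in> Br c u w))"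

lemma ret_K [simp]: "x \<in> K c u \<Longrightarrow> ret c u x = x"
  by (simp add: ret_def)

lemma ret_Br:
  assumes u: "u \<in> V c" and w: "w \<in> nbs c u" and x: "x \<in> Br c u w"
  shows "ret c u x = gate c u w"
proof (cases "x \<in> K c u")
  case True
  then show ?thesis using Br_Int_K[OF u w] x by auto
next
  case False
  have "(SOME w. w \<in> nbs c u \<and> x \<in> Br c u w) = w"
    by (rule some_equality) (use Br_disjoint[OF u _ x] w x in blast)+
  then show ?thesis using False by (simp add: ret_def)
qed

section \<open>Traces of connected sets on a piece\<close>

lemma finite_nbs: "finite (nbs c u)"
  using finite_V[of c] by (auto simp: nbs_def)

text \<open>Pasting over finitely many closed sets: the identity on the piece and a constant on each
  branch, with agreement at the gates by \<open>ret_Br\<close>.\<close>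

lemma continuous_ret:
  assumes u: "u \<in> V c" shows "continuous_on (L c) (ret c u)"
  unfolding L_branches[OF u]
proof (rule continuous_on_closed_Un)
  show "closed (\<Union>w\<in>nbs c u. Br c u w)" by (intro closed_UN finite_nbs ballI closed_Br)
  show "continuous_on (K c u) (ret c u)"
    by (rule continuous_on_eq[of _ "\<lambda>x. x"]) simp_all
  show "continuous_on (\<Union>w\<in>nbs c u. Br c u w) (ret c u)"
  proof (rule continuous_on_closed_Union)
    fix w assume w: "w \<in> nbs c u"
    show "continuous_on (Br c u w) (ret c u)"
      by (rule continuous_on_eq[OF continuous_on_const]) (simp add: ret_Br[OF u w])
  qed (simp_all only: finite_nbs closed_Br)
qed (simp add: closed_K u)

text \<open>If the gate were missing, the branch on one side and the piece with all other branches
  on the other side would be closed sets disconnecting \<open>C\<close>.\<close>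

lemma connected_gate:
  assumes u: "u \<in> V c" and w: "w \<in> nbs c u" and C: "connected C" "C \<subseteq> L c"
    and "x \<in> C" "x \<in> Br c u w" "C \<inter> K c u \<noteq> {}"
  shows "gate c u w \<in> C"
proof (rule ccontr)
  assume g: "gate c u w \<notin> C"
  let ?R = "K c u \<union> (\<Union>w'\<in>nbs c u - {w}. Br c u w')"
  have R: "closed ?R" 
    by (intro closed_Un closed_UN ballI closed_Br closed_K[OF u] finite_Diff finite_nbs)
  have cover: "C \<subseteq> Br c u w \<union> ?R" 
  proof -
    have "C \<subseteq> K c u \<union> (\<Union>w\<in>nbs c u. Br c u w)" using C(2) unfolding L_branches[OF u] .
    then show ?thesis by blast
  qed
  have disj: "Br c u w \<inter> ?R \<inter> C = {}"
  proof -
    have "y \<notin> C" if y: "y \<in> Br c u w" "y \<in> ?R" for y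
    proof -
      have "y \<in> K c u" using y(2) Br_disjoint[OF u y(1)] by blast
      then have "y = gate c u w" using Br_Int_K[OF u w] y(1) by blast
      then show ?thesis using g by simp
    qed
    then show ?thesis by blast
  qed
  have "Br c u w \<inter> C \<noteq> {}" "?R \<inter> C \<noteq> {}" using assms(5,6,7) by blast+
  then show False
    using connected_closedD[OF C(1) disj cover closed_Br R] by argo
qed

text \<open>A connected set that meets the piece contains every gate through which it leaves it, so
  collapsing the branches produces no new point. The trace of \<open>C\<close> on the piece is
  thereby a continuous image of \<open>C\<close>, hence connected.\<close>

lemma ret_image:
  assumes u: "u \<in> V c" and C: "connected C" "C \<subseteq> L c" and meet: "C \<inter> K c u \<noteq> {}"
  shows "ret c u ` C = C \<inter> K c u"
proof (intro equalityI subsetI)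
  fix y assume "y \<in> ret c u ` C"
  then obtain x where x: "x \<in> C" "y = ret c u x" by auto
  show "y \<in> C \<inter> K c u"
  proof (cases "x \<in> K c u")
    case False
    then obtain w where w: "w \<in> nbs c u" "x \<in> Br c u w" using C(2) x(1) unfolding L_branches[OF u]
      by blast
    then have "gate c u w \<in> C" "y = gate c u w"
      using connected_gate[OF u w(1) C x(1) w(2) meet] ret_Br[OF u w] x(2) by simp_all
    then show ?thesis using gate(1)[OF u w(1)] by blast
  qed (use x in simp)
next
  fix y assume "y \<in> C \<inter> K c u"
  then show "y \<in> ret c u ` C" by (intro image_eqI[of _ _ y]) simp_all
qed

lemma connected_Int_K:
  assumes u: "u \<in> V c" and C: "connected C" "C \<subseteq> L c"
  shows "connected (C \<inter> K c u)"
proof (cases "C \<inter> K c u = {}")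
  case False
  show ?thesis
    unfolding ret_image[OF u C False, symmetric]
    by (rule connected_continuous_image[OF continuous_on_subset[OF continuous_ret[OF u] C(2)] C(1)])
qed simp

text \<open>Off the piece the retraction takes values in the finite set of gates, so a connected set
  that misses the piece is sent to a single point.\<close>

lemma ret_separates:
  assumes u: "u \<in> V c" and C: "connected C" "C \<subseteq> L c" and xy: "x \<in> C" "y \<in> C"
    "ret c u x \<noteq> ret c u y"
  shows "C \<inter> K c u \<noteq> {}"
proof
  assume none: "C \<inter> K c u = {}"
  have "ret c u ` C \<subseteq> gate c u ` nbs c u"
  proof
    fix z assume "z \<in> ret c u ` C"
    then obtain y where y: "y \<in> C" "z = ret c u y" by auto
    then obtain w where "w \<in> nbs c u" "y \<in> Br c u w" using none C(2) unfolding L_branches[OF u]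
      by blast
    then show "z \<in> gate c u ` nbs c u" using ret_Br[OF u, of w y] y(2) by simp
  qed
  then have "finite (ret c u ` C)" by (rule finite_subset) (simp add: finite_nbs)
  moreover have "connected (ret c u ` C)"
    using connected_continuous_image[OF continuous_on_subset[OF continuous_ret[OF u] C(2)] C(1)] .
  ultimately have "ret c u ` C = {} \<or> (\<exists>a. ret c u ` C = {a})"
    by (simp add: connected_finite_iff_sing)
  then obtain a where "ret c u ` C \<subseteq> {a}" by blast
  then have "ret c u x = a" "ret c u y = a" using xy(1,2) by blast+
  then show False using xy(3) by simp
qed

text \<open>Rescaling the trace on a piece gives a connected subset of the attractor carried by it;
  this is how connectedness passes to the next order.\<close>

lemma connected_vimage:
  assumes u: "u \<in> V c" and C: "connected C" "C \<subseteq> L c"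
  shows "connected {y \<in> L (\<kappa> c u). f u y \<in> C}"
proof -
  let ?g = "the_inv_into (L (\<kappa> c u)) (f u)"
  have inj: "inj_on (f u) (L (\<kappa> c u))" by (simp add: inj_on_def inj_f[OF u])
  have "continuous_on (K c u) ?g"
    unfolding K_def using continuous_on_inv_into[OF continuous_f[OF u] compact_L inj] .
  then have "connected (?g ` (C \<inter> K c u))"
    by (intro connected_continuous_image connected_Int_K[OF u C]) (rule continuous_on_subset, auto)
  moreover have "?g ` (C \<inter> K c u) = {y \<in> L (\<kappa> c u). f u y \<in> C}"
  proof (intro equalityI subsetI)
    fix y assume "y \<in> ?g ` (C \<inter> K c u)"
    then obtain z where "z \<in> L (\<kappa> c u)" "f u z \<in> C" "y = ?g (f u z)" by (auto simp: K_def)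
    then show "y \<in> {y \<in> L (\<kappa> c u). f u y \<in> C}" using the_inv_into_f_f[OF inj] by simp
  next
    fix y assume "y \<in> {y \<in> L (\<kappa> c u). f u y \<in> C}"
    then show "y \<in> ?g ` (C \<inter> K c u)"
      using the_inv_into_f_f[OF inj, of y] by (intro image_eqI[of _ _ "f u y"]) (auto simp: K_def)
  qed
  ultimately show ?thesis by simp
qed

text \<open>The image is either the exit itself, seen from the piece that contains it, or a gate,
  and gates are exits of the piece. The rescaled continua therefore join exits again.\<close>

lemma ret_exit:
  assumes u: "u \<in> V c" and i: "i \<in> I"
  obtains l where "l \<in> I" "ret c u (X c i) = f u (X (\<kappa> c u) l)"
proof -
  from X_self[OF i, of c] obtain v where v: "v \<in> V c" "\<exists>l\<in>I. X c i = f v (X (\<kappa> c v) l)"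
    by (rule bexE)
  from v(2) obtain l where l: "l \<in> I" "X c i = f v (X (\<kappa> c v) l)" by (rule bexE)
  have K: "X c i \<in> K c v" unfolding l(2) K_def by (intro imageI X_mem l(1))
  show thesis
  proof (cases "v = u")
    case True
    have "ret c u (X c i) = f u (X (\<kappa> c u) l)" using K l(2) ret_K unfolding True by metis
    then show ?thesis by (rule that[OF l(1)])
  next
    case False
    then obtain w where "in_branch (V c) (E c) u w v" using in_branch_exists[OF tree u v(1)]
      by blast
    then have "w \<in> nbs c u" "X c i \<in> Br c u w" using K in_branch_nbs by (auto simp: Br_def)
    then have "ret c u (X c i) = gate c u w" "\<exists>l\<in>I. gate c u w = f u (X (\<kappa> c u) l)"
      using ret_Br[OF u, of w] gate(2)[OF u, of w] by simp_all
    then show ?thesis using that by auto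
  qed
qed


section \<open>Separation of two exits by a point\<close>

lemma D_nonneg: "i \<in> I \<Longrightarrow> 0 \<le> D"
  using dist_L[OF X_mem X_mem, of i i] by simp

text \<open>Removing the edge between \<open>u\<close> and \<open>w\<close> leaves two halves of the
  tree. Pieces of different halves touch only across this edge, so the one on the side of
  \<open>u\<close> would have to be \<open>u\<close>.\<close>

lemma exit_not_in_two_branches:
  assumes u: "u \<in> V c" and w: "w \<in> nbs c u"
    and x: "x \<in> Br c u w" "x \<in> Br c w u" and "x \<notin> K c u"
  shows False
proof -
  obtain v where v: "in_branch (V c) (E c) u w v" "x \<in> K c v" using x(1) by (auto simp: Br_def)
  obtain v' where v': "in_branch (V c) (E c) w u v'" "x \<in> K c v'" using x(2) by (auto simp: Br_def)
  have w': "w \<in> V c" using w by (simp add: nbs_def)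
  have asym: "\<not> in_branch (V c) (E c) u w v'"
    using in_branch_asym[OF tree u w', of v'] v'(1) by blast
  then have "v \<noteq> v'" using v(1) by blast
  moreover have "v \<in> V c" "v' \<in> V c" using in_branch_mem[OF v(1)] in_branch_mem[OF v'(1)]
    by simp_all
  ultimately have "{v, v'} \<in> E c" using K_Int_edge[OF v(2) v'(2)] by simp
  moreover have "v' \<noteq> u" using v'(2) \<open>x \<notin> K c u\<close> by metis
  ultimately show False using in_branch_edge[OF v(1), of v'] \<open>v' \<in> V c\<close> asym by simp
qed

text \<open>The induction descends, by self-similarity, into a piece that contains \<open>a\<close> and is entered by
  \<open>C1\<close> and \<open>C2\<close> through different gates; \<open>B\<close> has to cross such a piece.\<close>

lemma separating_point_near:
  assumes "i \<in> I" "j \<in> I" "connected C1" "C1 \<subseteq> L c" "connected C2" "C2 \<subseteq> L c" "connected B"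
    "B \<subseteq> L c"
    "X c i \<in> C1" "X c j \<in> C2" "C1 \<inter> C2 = {a}" "X c i \<in> B" "X c j \<in> B"
  shows "\<exists>b\<in>B. dist a b \<le> D * r ^ n"
  using assms
proof (induction n arbitrary: c i j C1 C2 B a)
  case 0
  have "a \<in> L c" using 0 by blast
  then have "dist a (X c i) \<le> D" by (rule dist_L) (rule X_mem[OF \<open>i \<in> I\<close>])
  then show ?case using 0(12) by (intro bexI[of _ "X c i"]) simp_all
next
  case (Suc n)
  let ?goal = "\<exists>b\<in>B. dist a b \<le> D * r ^ Suc n"
  have aC: "a \<in> C1" "a \<in> C2" using Suc.prems(11) by blast+
  have ret_mem: "ret c u x \<in> A" "ret c u x \<in> K c u"
    if "u \<in> V c" "connected A" "A \<subseteq> L c" "A \<inter> K c u \<noteq> {}" "x \<in> A" for A u x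
    using ret_image[OF that(1-4)] imageI[OF that(5), of "ret c u"] by blast+
  \<comment> \<open>If both exits retract to the same point of the piece, this point lies in
    \<open>C1\<close> and in \<open>C2\<close>, so it is \<open>a\<close>. Then either
    \<open>B\<close> meets the piece and contains this common image, or \<open>B\<close> misses it
    and \<open>a\<close> is only the gate facing \<open>X c i\<close>. If the images differ, the
    induction hypothesis applies inside the piece.\<close>
  have step: "?goal \<or> X c i \<notin> K c u \<and> (\<exists>w\<in>nbs c u. X c i \<in> Br c u w \<and> a = gate c u w)"
    if u: "u \<in> V c" and a: "a \<in> K c u" for u
  proof (cases "ret c u (X c i) = ret c u (X c j)")
    case True
    have "ret c u (X c i) \<in> C1" using ret_mem[OF u Suc.prems(3,4) _ Suc.prems(9)] aC a by blast
    moreover have "ret c u (X c j) \<in> C2" using ret_mem[OF u Suc.prems(5,6) _ Suc.prems(10)] aC a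
      by blast
    ultimately have eq: "ret c u (X c i) = a" using True Suc.prems(11) by auto
    show ?thesis
    proof (cases "B \<inter> K c u = {}")
      case True
      then have X: "X c i \<notin> K c u" using Suc.prems(12) by blast
      moreover have "X c i \<in> L c" by (rule X_mem[OF Suc.prems(1)])
      ultimately obtain w where "w \<in> nbs c u" "X c i \<in> Br c u w" unfolding L_branches[OF u] by blast
      then show ?thesis using eq ret_Br[OF u, of w] X by auto
    next
      case False
      then have "a \<in> B" using ret_mem(1)[OF u Suc.prems(7,8) False Suc.prems(12)] eq by simp
      then show ?thesis using D_nonneg[OF Suc.prems(1)] r by (intro disjI1 bexI[of _ a]) auto
    qed
  next
    case False
    let ?c = "\<kappa> c u"
    obtain l where l: "l \<in> I" "ret c u (X c i) = f u (X ?c l)" using ret_exit[OF u Suc.prems(1)] .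
    obtain l' where l': "l' \<in> I" "ret c u (X c j) = f u (X ?c l')"
      using ret_exit[OF u Suc.prems(2)] .
    have B: "B \<inter> K c u \<noteq> {}" using ret_separates[OF u Suc.prems(7,8,12,13) False] .
    obtain a' where a': "a' \<in> L ?c" "a = f u a'" using a by (auto simp: K_def)
    let ?P = "\<lambda>A. {y \<in> L ?c. f u y \<in> A}"
    have X1: "X ?c l \<in> ?P C1"
      using ret_mem(1)[OF u Suc.prems(3,4) _ Suc.prems(9)] aC a l X_mem by auto
    have X2: "X ?c l' \<in> ?P C2"
      using ret_mem(1)[OF u Suc.prems(5,6) _ Suc.prems(10)] aC a l' X_mem by auto
    have XB: "X ?c l \<in> ?P B" "X ?c l' \<in> ?P B"
      using ret_mem(1)[OF u Suc.prems(7,8) B Suc.prems(12)] ret_mem(1)[OF u Suc.prems(7,8) B Suc.prems(13)]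
        l(2) l'(2) X_mem[OF l(1)] X_mem[OF l'(1)] by simp_all
    have single: "?P C1 \<inter> ?P C2 = {a'}"
    proof -
      have "y = a'" if "f u y \<in> C1" "f u y \<in> C2" for y
        using that Suc.prems(11) a'(2) inj_f[OF u, of y a'] by auto
      then show ?thesis using a' aC by blast
    qed
    note vim = connected_vimage[OF u] Collect_restrict
    have "\<exists>b\<in>?P B. dist a' b \<le> D * r ^ n"
      using Suc.IH[OF l(1) l'(1) vim(1)[OF Suc.prems(3,4)] vim(2) vim(1)[OF Suc.prems(5,6)] vim(2)
          vim(1)[OF Suc.prems(7,8)] vim(2) X1 X2 single XB] .
    then obtain b where b: "b \<in> ?P B" "dist a' b \<le> D * r ^ n" by blast
    then have "dist a (f u b) \<le> D * r ^ Suc n"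
      using dist_f[OF u, of a' b] a'(2) r mult_left_mono[OF b(2), of r] by (simp add: mult_ac)
    then show ?thesis using b(1) by blast
  qed
  have "a \<in> L c" using aC Suc.prems(4) by blast
  then have "a \<in> (\<Union>u\<in>V c. K c u)" by (simp only: L_pieces)
  then obtain u where u: "u \<in> V c" "a \<in> K c u" by (rule UN_E)
  show ?case
  proof (rule ccontr)
    assume no: "\<not> ?goal"
    have X: "X c i \<notin> K c u" and "\<exists>w\<in>nbs c u. X c i \<in> Br c u w \<and> a = gate c u w"
      using step[OF u] no by argo+
    then obtain w where w: "w \<in> nbs c u" "X c i \<in> Br c u w" "a = gate c u w" by auto
    \<comment> \<open>In the exceptional position \<open>a\<close> also belongs to the next piece
      \<open>w\<close> towards \<open>X c i\<close>, which is tried instead. If \<open>w\<close>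
      were exceptional too, its gate \<open>a\<close> would point back to \<open>u\<close>, placing
      \<open>X c i\<close> on both sides of the edge.\<close>
    have wV: "w \<in> V c" and uw: "u \<in> nbs c w" using w(1) u(1) by (auto simp: nbs_def insert_commute)
    have "a \<in> K c w" using gate(1)[OF u(1) w(1)] w(3) by blast
    then have "\<exists>w'\<in>nbs c w. X c i \<in> Br c w w' \<and> a = gate c w w'"
      using step[OF wV] no by argo
    then obtain w' where w': "w' \<in> nbs c w" "X c i \<in> Br c w w'" "a = gate c w w'" by auto
    have "a \<in> Br c w w'" using Br_Int_K[OF wV w'(1)] w'(3) by blast
    moreover have "a \<in> Br c w u" using K_subset_Br[OF uw] u(2) by blast
    ultimately have "w' = u" using Br_disjoint[OF wV] by blast
    then show False using exit_not_in_two_branches[OF u(1) w(1,2) _ X] w'(2) by simp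
  qed
qed

text \<open>The errors \<open>D * r ^ n\<close> tend to zero, so \<open>a\<close> is a limit of
  points of \<open>B\<close>.\<close>

lemma separating_point_mem:
  assumes "i \<in> I" "j \<in> I" "connected C1" "C1 \<subseteq> L c" "connected C2" "C2 \<subseteq> L c"
    "connected B" "closed B" "B \<subseteq> L c"
    "X c i \<in> C1" "X c j \<in> C2" "C1 \<inter> C2 = {a}" "X c i \<in> B" "X c j \<in> B"
  shows "a \<in> B"
proof -
  have "\<exists>b\<in>B. dist a b < e" if "e > 0" for e
  proof -
    have "(\<lambda>n. D * r ^ n) \<longlonglongrightarrow> 0"
      using r by (intro tendsto_mult_right_zero LIMSEQ_power_zero) auto
    then have "\<forall>\<^sub>F n in sequentially. D * r ^ n < e" by (rule order_tendstoD(2)[OF _ that])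
    then obtain n where "D * r ^ n < e" using eventually_happens'[OF sequentially_bot] by blast
    moreover obtain b where "b \<in> B" "dist a b \<le> D * r ^ n"
      using separating_point_near[OF assms(1-7) assms(9-14), of n] by blast
    ultimately show ?thesis by force
  qed
  then have "a \<in> closure B" unfolding closure_approachable by (auto simp: dist_commute)
  then show ?thesis using \<open>closed B\<close> by simp
qed

text \<open>By injectivity every point of an arc splits it into two connected halves that meet only
  there, which is the configuration of \<open>separating_point_mem\<close>.\<close>

lemma arc_path_image_minimal:
  assumes "i \<in> I" "j \<in> I" and g: "arc g" "path_image g \<subseteq> L c" "pathstart g = X c i"
    "pathfinish g = X c j"
    and B: "connected B" "closed B" "B \<subseteq> L c" "X c i \<in> B" "X c j \<in> B"
  shows "path_image g \<subseteq> B"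
proof
  fix a assume "a \<in> path_image g"
  then obtain t where t: "t \<in> {0..1}" "a = g t" by (auto simp: path_image_def)
  have cont: "continuous_on {0..1} g" and inj: "inj_on g {0..1}"
    using g(1) by (auto simp: arc_def path_def)
  have con: "connected (g ` {x..y})" if "0 \<le> x" "y \<le> 1" for x y
    using that by (intro connected_continuous_image continuous_on_subset[OF cont]) auto
  have "x = t" if "x \<in> {0..t}" "y \<in> {t..1}" "g x = g y" for x y
    using inj_onD[OF inj that(3)] that(1,2) t(1) by auto
  then have "g ` {0..t} \<inter> g ` {t..1} \<subseteq> {a}"
    unfolding t(2) by blast
  then have "g ` {0..t} \<inter> g ` {t..1} = {a}"
    using t by (auto intro!: image_eqI[of _ g t])
  moreover have "g ` {0..t} \<subseteq> L c" "g ` {t..1} \<subseteq> L c" using g(2) t by (auto simp: path_image_def)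
  moreover have "X c i \<in> g ` {0..t}"
    using g(3) t by (auto simp: pathstart_def intro!: image_eqI[of _ g 0])
  moreover have "X c j \<in> g ` {t..1}"
    using g(4) t by (auto simp: pathfinish_def intro!: image_eqI[of _ g 1])
  ultimately show "a \<in> B"
    using t by (intro separating_point_mem[OF assms(1,2) con _ con _ B(1-3) _ _ _ B(4,5)]) auto
qed

text \<open>Two arcs with the same exits as ends contain each other by minimality.\<close>

lemma the_arc_eq:
  assumes "i \<in> I" "j \<in> I" and g: "arc g" "path_image g \<subseteq> L c" "pathstart g = X c i"
    "pathfinish g = X c j"
  shows "the_arc (L c) (X c i) (X c j) = path_image g"
  unfolding the_arc_def
proof (rule the_equality)
  fix A assume A: "A \<subseteq> L c \<and> (\<exists>g. arc g \<and> path_image g = A \<and> pathstart g = X c i \<and> pathfinish g =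
      X c j)"
  then obtain h where h: "arc h" "path_image h = A" "pathstart h = X c i" "pathfinish h = X c j"
    by blast
  have *: "path_image g1 \<subseteq> path_image g2"
    if "arc g1" "path_image g1 \<subseteq> L c" "pathstart g1 = X c i" "pathfinish g1 = X c j"
      "arc g2" "path_image g2 \<subseteq> L c" "pathstart g2 = X c i" "pathfinish g2 = X c j" for g1 g2
    using that pathstart_in_path_image[of g2] pathfinish_in_path_image[of g2]
    by (intro arc_path_image_minimal[OF assms(1,2) that(1-4)])
      (auto intro: connected_path_image closed_path_image arc_imp_path)
  show "A = path_image g" using *[of g h] *[of h g] g h A by blast
qed (use g in blast)

end

subsection \<open>Arcs between exits\<close>

text \<open>The value \<open>undefined\<close> is harmless since chains are never empty. A last path
  is kept unjoined, so that no further piece is appended after its end.\<close>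

fun join_list :: "(real \<Rightarrow> 'a::topological_space) list \<Rightarrow> real \<Rightarrow> 'a" where
  "join_list [] = (\<lambda>_. undefined)"
| "join_list (g # gs) = (if gs = [] then g else g +++ join_list gs)"

context tree_ifs
begin

text \<open>An entry \<open>(u, a, b)\<close> crosses the piece \<open>u\<close> from its exit
  \<open>a\<close> to its exit \<open>b\<close>. Consecutive entries must agree in the actual point,
  which generally has different names as an exit of the two pieces.\<close>

inductive linked :: "'c \<Rightarrow> ('v \<times> 'i \<times> 'i) list \<Rightarrow> 'a \<Rightarrow> 'a \<Rightarrow> bool" for c where
  linked_single: "u \<in> V c \<Longrightarrow> a \<in> I \<Longrightarrow> b \<in> I \<Longrightarrow>
    linked c [(u, a, b)] (f u (X (\<kappa> c u) a)) (f u (X (\<kappa> c u) b))"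
| linked_Cons: "u \<in> V c \<Longrightarrow> a \<in> I \<Longrightarrow> b \<in> I \<Longrightarrow> linked c ss (f u (X (\<kappa> c u) b)) y \<Longrightarrow>
    linked c ((u, a, b) # ss) (f u (X (\<kappa> c u) a)) y"

lemma linked_nonempty: "linked c ss x y \<Longrightarrow> ss \<noteq> []"
  by (induction rule: linked.induct) simp_all

text \<open>The operator whose fixed point is wanted: a family of paths, one for each colour and
  pair of exits, is replaced by concatenations of its own scaled copies.\<close>

definition glue :: "'c \<Rightarrow> ('c \<Rightarrow> 'i \<Rightarrow> 'i \<Rightarrow> real \<Rightarrow> 'a) \<Rightarrow> ('v \<times> 'i \<times> 'i) list \<Rightarrow> real \<Rightarrow> 'a" where
  "glue c p ss = join_list (map (\<lambda>(u, a, b). f u \<circ> p (\<kappa> c u) a b) ss)"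

lemma glue_path:
  assumes "linked c ss x y"
    and p: "\<And>c a b. a \<in> I \<Longrightarrow> b \<in> I \<Longrightarrow>
      path (p c a b) \<and> pathstart (p c a b) = X c a \<and> pathfinish (p c a b) = X c b"
  shows "path (glue c p ss) \<and> pathstart (glue c p ss) = x \<and> pathfinish (glue c p ss) = y"
  using assms(1)
proof (induction rule: linked.induct)
  case (linked_single u a b)
  have "path (f u \<circ> p (\<kappa> c u) a b)"
    using p[of a b "\<kappa> c u"] linked_single by (intro path_continuous_image continuous_f) auto
  moreover have "glue c p [(u, a, b)] = f u \<circ> p (\<kappa> c u) a b"
    by (simp add: glue_def fun_eq_iff)
  ultimately show ?case
    using p[of a b "\<kappa> c u"] linked_single
      by (simp only: pathstart_compose pathfinish_compose simp_thms)
next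
  case (linked_Cons u a b ss y)
  have "path (f u \<circ> p (\<kappa> c u) a b)"
    using p[of a b "\<kappa> c u"] linked_Cons.hyps by (intro path_continuous_image continuous_f) auto
  moreover have "glue c p ((u, a, b) # ss) = (f u \<circ> p (\<kappa> c u) a b) +++ glue c p ss"
    using linked_nonempty[OF linked_Cons.hyps(4)] by (simp add: glue_def fun_eq_iff)
  ultimately show ?case
    using linked_Cons.IH linked_Cons.hyps p[of a b "\<kappa> c u"]
    by (simp only: pathstart_compose pathfinish_compose path_join pathstart_join pathfinish_join simp_thms)
qed

text \<open>The order of quantifiers matters: piece, exits and local parameter depend on
  \<open>t\<close> but not on the family \<open>p\<close>. Two families are thus compared at the
  same place, and gluing contracts their distance by the factor \<open>r\<close>.\<close>

lemma glue_local:
  assumes "linked c ss x y" "t \<in> {0..1}"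
  shows "\<exists>u\<in>V c. \<exists>a\<in>I. \<exists>b\<in>I. \<exists>s\<in>{0..1}. \<forall>p. glue c p ss t = f u (p (\<kappa> c u) a b s)"
  using assms
proof (induction arbitrary: t rule: linked.induct)
  case (linked_single u a b)
  show ?case
    by (rule bexI[of _ u], rule bexI[of _ a], rule bexI[of _ b], rule bexI[of _ t])
      (use linked_single in \<open>simp_all add: glue_def\<close>)
next
  case (linked_Cons u a b ss y)
  have eq: "glue c p ((u, a, b) # ss) = (f u \<circ> p (\<kappa> c u) a b) +++ glue c p ss" for p
    using linked_nonempty[OF linked_Cons.hyps(4)] by (simp add: glue_def fun_eq_iff)
  show ?case
  proof (cases "t \<le> 1/2")
    case True
    show ?thesis
      by (rule bexI[of _ u], rule bexI[of _ a], rule bexI[of _ b], rule bexI[of _ "2 * t"])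
        (use True linked_Cons.hyps linked_Cons.prems in \<open>simp_all add: eq joinpaths_def\<close>)
  next
    case False
    have "2 * t - 1 \<in> {0..1}" using False linked_Cons.prems by auto
    from linked_Cons.IH[OF this] show ?thesis using False by (simp add: eq joinpaths_def)
  qed
qed

text \<open>The chain follows a walk through the tree. It may backtrack, since only some path is
  needed here and an arc is extracted from it afterwards.\<close>

lemma linked_exists:
  assumes "i \<in> I" "j \<in> I"
  shows "\<exists>ss. linked c ss (X c i) (X c j)"
proof -
  from X_self[OF assms(1), of c] obtain u where u: "u \<in> V c" "\<exists>l\<in>I. X c i = f u (X (\<kappa> c u) l)"
    by (rule bexE)
  from X_self[OF assms(2), of c] obtain v where v: "v \<in> V c" "\<exists>l\<in>I. X c j = f v (X (\<kappa> c v) l)"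
    by (rule bexE)
  have "(u, v) \<in> (edge_rel (V c) (E c))\<^sup>*"
    using tree[of c] u(1) v(1) by (auto simp: undirected_tree_def undirected_connected_def)
  then have "\<forall>a\<in>I. \<forall>b\<in>I. \<exists>ss. linked c ss (f u (X (\<kappa> c u) a)) (f v (X (\<kappa> c v) b))"
  proof (induction rule: converse_rtrancl_induct)
    case base
    then show ?case using linked_single[OF v(1)] by blast
  next
    case (step x z)
    show ?case
    proof (cases "x = z")
      case True
      then show ?thesis using step.IH by simp
    next
      case False
      have xz: "x \<in> V c" "z \<in> nbs c x" "z \<in> V c" "x \<in> nbs c z"
        using step.hyps(1) False by (auto simp: nbs_def insert_commute)
      obtain l where l: "l \<in> I" "gate c x z = f x (X (\<kappa> c x) l)" using gate(2)[OF xz(1,2)] by blast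
      obtain l' where l': "l' \<in> I" "gate c z x = f z (X (\<kappa> c z) l')" using gate(2)[OF xz(3,4)]
        by blast
      \<comment> \<open>The common gate of the edge is one point with two names, an exit of
        \<open>x\<close> and an exit of \<open>z\<close>; this is where consecutive entries are
        matched.\<close>
      have eq: "gate c x z = gate c z x"
        using gate(1)[OF xz(1,2)] gate(1)[OF xz(3,4)] by (simp add: Int_commute)
      show ?thesis
      proof (intro ballI)
        fix a b assume ab: "a \<in> I" "b \<in> I"
        obtain ss where "linked c ss (f z (X (\<kappa> c z) l')) (f v (X (\<kappa> c v) b))"
          using step.IH l'(1) ab(2) by blast
        then have "linked c ss (f x (X (\<kappa> c x) l)) (f v (X (\<kappa> c v) b))"
          using eq l(2) l'(2) by simp
        then show "\<exists>ss. linked c ss (f x (X (\<kappa> c x) a)) (f v (X (\<kappa> c v) b))"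
          using linked_Cons[OF xz(1) ab(1) l(1)] by blast
      qed
    qed
  qed
  then show ?thesis using u(2) v(2) by auto
qed

definition steps :: "'c \<Rightarrow> 'i \<Rightarrow> 'i \<Rightarrow> ('v \<times> 'i \<times> 'i) list" where
  "steps c i j = (SOME ss. linked c ss (X c i) (X c j))"

lemma linked_steps: "i \<in> I \<Longrightarrow> j \<in> I \<Longrightarrow> linked c (steps c i j) (X c i) (X c j)"
  unfolding steps_def using linked_exists by (rule someI_ex)

section \<open>Successive approximation of a path inside the attractor\<close>

primrec approx_path :: "nat \<Rightarrow> 'c \<Rightarrow> 'i \<Rightarrow> 'i \<Rightarrow> real \<Rightarrow> 'a" where
  "approx_path 0 = (\<lambda>c i j. linepath (X c i) (X c j))"
| "approx_path (Suc n) = (\<lambda>c i j. glue c (approx_path n) (steps c i j))"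

lemma approx_path:
  "i \<in> I \<Longrightarrow> j \<in> I \<Longrightarrow> path (approx_path n c i j) \<and>
     pathstart (approx_path n c i j) = X c i \<and> pathfinish (approx_path n c i j) = X c j"
proof (induction n arbitrary: c i j)
  case (Suc n)
  then show ?case using glue_path[OF linked_steps[OF Suc.prems], of "approx_path n"] by simp
qed simp

lemma approx_path_local:
  assumes "i \<in> I" "j \<in> I" "t \<in> {0..1}"
  obtains u a b s where "u \<in> V c" "a \<in> I" "b \<in> I" "s \<in> {0..1}"
    "\<And>n. approx_path (Suc n) c i j t = f u (approx_path n (\<kappa> c u) a b s)"
proof -
  obtain u a b s where "u \<in> V c" "a \<in> I" "b \<in> I" "s \<in> {0..1}"
    "\<forall>p. glue c p (steps c i j) t = f u (p (\<kappa> c u) a b s)"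
    using glue_local[OF linked_steps[OF assms(1,2), of c] assms(3)] by blast
  then show thesis by (intro that[of u a b s]) simp_all
qed

text \<open>The initial segments may leave the attractor, but stay within \<open>D\<close> of an
  exit; each gluing scales this error by \<open>r\<close>.\<close>

lemma approx_path_near_L:
  "i \<in> I \<Longrightarrow> j \<in> I \<Longrightarrow> t \<in> {0..1} \<Longrightarrow> \<exists>z\<in>L c. dist (approx_path n c i j t) z \<le> D * r ^ n"
proof (induction n arbitrary: c i j t)
  case 0
  have "dist (linepath (X c i) (X c j) t) (X c i) = t * dist (X c i) (X c j)"
    using 0(3)
      by (simp add: linepath_def dist_norm algebra_simps norm_minus_commute flip: scaleR_diff_right)
  also have "\<dots> \<le> 1 * D"
    using 0 D_nonneg by (intro mult_mono dist_L[OF X_mem X_mem]) auto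
  finally show ?case using X_mem[OF 0(1)] by (intro bexI[of _ "X c i"]) auto
next
  case (Suc n)
  obtain u a b s where u: "u \<in> V c" "a \<in> I" "b \<in> I" "s \<in> {0..1}"
    and eq: "\<And>n. approx_path (Suc n) c i j t = f u (approx_path n (\<kappa> c u) a b s)"
    using approx_path_local[OF Suc.prems, of c] by blast
  obtain z where z: "z \<in> L (\<kappa> c u)" "dist (approx_path n (\<kappa> c u) a b s) z \<le> D * r ^ n"
    using Suc.IH[OF u(2,3,4)] by blast
  have "f u z \<in> L c" using z(1) u(1) L_eq[of c] by auto
  moreover have "dist (approx_path (Suc n) c i j t) (f u z) \<le> D * r ^ Suc n"
    using mult_left_mono[OF z(2), of r] r unfolding eq dist_f[OF u(1)] by (simp add: mult_ac)
  ultimately show ?case by blast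
qed

text \<open>The factor 3 comes from order zero: each of the two approximations is within
  \<open>D\<close> of the attractor, whose own diameter is at most \<open>D\<close>. Higher orders
  only rescale.\<close>

lemma approx_path_Cauchy:
  "i \<in> I \<Longrightarrow> j \<in> I \<Longrightarrow> t \<in> {0..1} \<Longrightarrow>
     dist (approx_path (Suc n) c i j t) (approx_path n c i j t) \<le> 3 * D * r ^ n"
proof (induction n arbitrary: c i j t)
  case 0
  obtain z0 where z0: "z0 \<in> L c" "dist (approx_path 0 c i j t) z0 \<le> D * r ^ 0"
    using approx_path_near_L[OF 0] by blast
  obtain z1 where z1: "z1 \<in> L c" "dist (approx_path (Suc 0) c i j t) z1 \<le> D * r ^ Suc 0"
    using approx_path_near_L[OF 0] by blast
  have "D * r \<le> D * 1" using D_nonneg[OF 0(1)] r by (intro mult_left_mono) auto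
  moreover have "dist z0 z1 \<le> D" using dist_L[OF z0(1) z1(1)] .
  ultimately show ?case
    using z0(2) z1(2) dist_triangle[of "approx_path (Suc 0) c i j t" "approx_path 0 c i j t" z1]
      dist_triangle[of z1 "approx_path 0 c i j t" z0]
    by (simp add: dist_commute del: approx_path.simps)
next
  case (Suc n)
  obtain u a b s where u: "u \<in> V c" "a \<in> I" "b \<in> I" "s \<in> {0..1}"
    and eq: "\<And>n. approx_path (Suc n) c i j t = f u (approx_path n (\<kappa> c u) a b s)"
    using approx_path_local[OF Suc.prems, of c] by blast
  show ?case
    using mult_left_mono[OF Suc.IH[OF u(2,3,4), of "\<kappa> c u"], of r] r
    unfolding eq dist_f[OF u(1)] by (simp add: mult_ac)
qed

lemma path_between_exits:
  assumes ij: "i \<in> I" "j \<in> I"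
  obtains g where "path g" "path_image g \<subseteq> L c" "pathstart g = X c i" "pathfinish g = X c j"
proof -
  define F where "F n = approx_path n c i j" for n
  \<comment> \<open>Writing the limit as a telescoping series makes the Weierstrass test applicable
    with the geometric majorant from \<open>approx_path_Cauchy\<close>.\<close>
  define h where "h n t = F (Suc n) t - F n t" for n t
  define S where "S t = (\<Sum>n. h n t)" for t
  define g where "g t = F 0 t + S t" for t
  have cont: "continuous_on {0..1} (F n)" for n
    using approx_path[OF ij] by (auto simp: F_def path_def)
  have "uniform_limit {0..1} (\<lambda>n t. \<Sum>k<n. h k t) S sequentially"
    unfolding S_def
  proof (rule Weierstrass_m_test)
    show "summable (\<lambda>n. 3 * D * r ^ n)"
      using r by (intro summable_mult summable_geometric) auto
    fix n and t :: real assume "t \<in> {0..1}"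
    then show "norm (h n t) \<le> 3 * D * r ^ n"
      using approx_path_Cauchy[OF ij] by (simp add: h_def F_def dist_norm del: approx_path.simps)
  qed
  then have lim: "uniform_limit {0..1} (\<lambda>n t. F n t - F 0 t) S sequentially"
    unfolding h_def by (simp add: sum_lessThan_telescope[of "\<lambda>k. F k _"])
  have "continuous_on {0..1} S"
    by (rule uniform_limit_theorem[OF _ lim]) (auto intro!: always_eventually continuous_intros cont)
  then have "path g" unfolding path_def g_def by (intro continuous_intros cont)
  have tendsto: "(\<lambda>n. F n t) \<longlonglongrightarrow> g t" if "t \<in> {0..1}" for t
  proof -
    have "(\<lambda>n. F 0 t + (F n t - F 0 t)) \<longlonglongrightarrow> F 0 t + S t"
      by (intro tendsto_add tendsto_const tendsto_uniform_limitI[OF lim that])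
    then show ?thesis by (simp add: g_def)
  qed
  have "path_image g \<subseteq> L c"
  proof
    fix y assume "y \<in> path_image g"
    then obtain t where t: "t \<in> {0..1}" "y = g t" by (auto simp: path_image_def)
    have "\<forall>n. \<exists>z\<in>L c. dist (F n t) z \<le> D * r ^ n"
      unfolding F_def using approx_path_near_L[OF ij t(1)] by blast
    then obtain z where z: "\<And>n. z n \<in> L c" "\<And>n. dist (F n t) (z n) \<le> D * r ^ n" by metis
    have "(\<lambda>n. D * r ^ n) \<longlonglongrightarrow> 0"
      using r by (intro tendsto_mult_right_zero LIMSEQ_power_zero) auto
    then have "(\<lambda>n. dist (F n t) (z n)) \<longlonglongrightarrow> 0"
      by (rule tendsto_sandwich[OF _ _ tendsto_const, rotated 2]) (auto simp: z(2))
    then have "(\<lambda>n. norm (z n - F n t)) \<longlonglongrightarrow> 0"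
      by (simp add: dist_norm norm_minus_commute)
    then have "(\<lambda>n. z n - F n t) \<longlonglongrightarrow> 0" by (rule tendsto_norm_zero_cancel)
    from tendsto_add[OF tendsto[OF t(1)] this] have "z \<longlonglongrightarrow> g t" by simp
    then show "y \<in> L c"
      unfolding t(2) by (rule closed_sequentially[OF compact_imp_closed[OF compact_L] z(1)])
  qed
  moreover have "pathstart g = X c i" "pathfinish g = X c j"
  proof -
    have "F n 0 = X c i" "F n 1 = X c j" for n
      using approx_path[OF ij, of n c] by (auto simp: F_def pathstart_def pathfinish_def)
    then show "pathstart g = X c i" "pathfinish g = X c j"
      using tendsto[of 0] tendsto[of 1]
        by (simp_all add: LIMSEQ_const_iff pathstart_def pathfinish_def)
  qed
  ultimately show thesis using that[OF \<open>path g\<close>] by blast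
qed

lemma arc_between_exits:
  assumes "i \<in> I" "j \<in> I" "X c i \<noteq> X c j"
  obtains g where "arc g" "path_image g \<subseteq> L c" "pathstart g = X c i" "pathfinish g = X c j"
    "path_image g = the_arc (L c) (X c i) (X c j)"
proof -
  obtain p where p: "path p" "path_image p \<subseteq> L c" "pathstart p = X c i" "pathfinish p = X c j"
    using path_between_exits[OF assms(1,2)] .
  obtain g where g: "arc g" "path_image g \<subseteq> path_image p" "pathstart g = X c i"
    "pathfinish g = X c j"
    using path_contains_arc[OF p(1,3,4) assms(3)] .
  have sub: "path_image g \<subseteq> L c" using g(2) p(2) by (rule subset_trans)
  show thesis
    by (rule that[OF g(1) sub g(3,4) the_arc_eq[OF assms(1,2) g(1) sub g(3,4), symmetric]])
qed


text \<open>Cut at \<open>C\<close>, the arcs \<open>h\<close> and \<open>g\<close> provide three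
  legs \<open>?H1\<close>, \<open>?H2\<close>, \<open>?G\<close>, one to each exit, that meet
  pairwise in \<open>C\<close> only. Each of the three arcs is confined to the union of two legs, so
  nothing but \<open>C\<close> can be common to all.\<close>

theorem triple_point:
  assumes I: "i \<in> I" "j \<in> I" "k \<in> I"
    and ne: "X c i \<noteq> X c j" "X c j \<noteq> X c k" "X c i \<noteq> X c k"
  shows "\<exists>C\<in>L c. {C} = the_arc (L c) (X c i) (X c j) \<inter> the_arc (L c) (X c j) (X c k)
                  \<inter> the_arc (L c) (X c i) (X c k)"
proof -
  obtain h where h: "arc h" "path_image h \<subseteq> L c" "pathstart h = X c i" "pathfinish h = X c j"
    "path_image h = the_arc (L c) (X c i) (X c j)" using arc_between_exits[OF I(1,2) ne(1)] .
  obtain q where q: "arc q" "path_image q \<subseteq> L c" "pathstart q = X c j" "pathfinish q = X c k"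
    "path_image q = the_arc (L c) (X c j) (X c k)" using arc_between_exits[OF I(2,3) ne(2)] .
  obtain g where g: "arc g" "path_image g \<subseteq> L c" "pathstart g = X c i" "pathfinish g = X c k"
    "path_image g = the_arc (L c) (X c i) (X c k)" using arc_between_exits[OF I(1,3) ne(3)] .
  have hc: "continuous_on {0..1} h" "inj_on h {0..1}" and gc: "continuous_on {0..1} g"
    "inj_on g {0..1}"
    using h(1) g(1) by (auto simp: arc_def path_def)
  have hends: "h 0 = X c i" "h 1 = X c j" and gends: "g 0 = X c i" "g 1 = X c k"
    using h(3,4) g(3,4) by (auto simp: pathstart_def pathfinish_def)
  define T where "T = {t \<in> {0..1}. g t \<in> path_image h}"
  have "closed T" unfolding T_def
    using continuous_closed_preimage[OF gc(1) closed_atLeastAtMost closed_path_image[OF arc_imp_path[OF h(1)]]]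
    by (simp add: vimage_def Int_def conj_commute)
  moreover have "{0..1} \<inter> T = T" by (auto simp: T_def)
  ultimately have "compact T"
    using compact_Int_closed[OF compact_Icc[of "0::real" 1], of T] by simp
  moreover have "0 \<in> T" using gends(1) h(3) pathstart_in_path_image[of h] by (simp add: T_def)
  \<comment> \<open>the last point of \<open>g\<close> on \<open>h\<close>\<close>
  ultimately obtain t where t: "t \<in> T" "\<And>x. x \<in> T \<Longrightarrow> x \<le> t"
    using compact_attains_sup[of T] by blast
  have t01: "t \<in> {0..1}" using t(1) by (simp add: T_def)
  obtain s where s: "s \<in> {0..1}" "h s = g t" using t(1) by (auto simp: T_def path_image_def)
  define C where "C = g t"
  let ?G = "g ` {t..1}" and ?H1 = "h ` {0..s}" and ?H2 = "h ` {s..1}"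
  have sub: "?G \<subseteq> L c" "?H1 \<subseteq> L c" "?H2 \<subseteq> L c"
    using g(2) h(2) t01 s(1) by (auto simp: path_image_def)
  have cpt: "compact ?G" "compact ?H1" "compact ?H2"
    using t01 s(1)
      by (auto intro!: compact_continuous_image continuous_on_subset[OF gc(1)] continuous_on_subset[OF hc(1)])
  have con: "connected ?G" "connected ?H1" "connected ?H2"
    using t01 s(1)
      by (auto intro!: connected_continuous_image continuous_on_subset[OF gc(1)] continuous_on_subset[OF hc(1)])
  have CG: "C \<in> ?G" and CH: "C \<in> ?H1" "C \<in> ?H2"
    using t01 s by (auto simp: C_def intro!: image_eqI[of _ h s])
  have ends: "X c k \<in> ?G" "X c i \<in> ?H1" "X c j \<in> ?H2"
    using t01 s(1) hends gends
    by (auto intro: image_eqI[of _ g 1] image_eqI[of _ h 0] image_eqI[of _ h 1])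
  have "path_image h = h ` ({0..s} \<union> {s..1})" using s(1)
    by (simp add: path_image_def ivl_disj_un_two_touch)
  then have him: "path_image h = ?H1 \<union> ?H2" by (simp add: image_Un)
  have GH: "?G \<inter> path_image h = {C}"
  proof -
    have "x = t" if "x \<in> {t..1}" "g x \<in> path_image h" for x
      using t(2)[of x] that t01 by (auto simp: T_def)
    then have "?G \<inter> path_image h \<subseteq> {C}" unfolding C_def by blast
    then show ?thesis using CG CH him by blast
  qed
  have HH: "?H1 \<inter> ?H2 = {C}"
  proof -
    have "x = s" if "x \<in> {0..s}" "y \<in> {s..1}" "h x = h y" for x y
      using inj_onD[OF hc(2) that(3)] that(1,2) s(1) by auto
    then have "?H1 \<inter> ?H2 \<subseteq> {C}" unfolding C_def s(2)[symmetric] by blast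
    then show ?thesis using CH by blast
  qed
  have GH12: "?G \<inter> ?H1 = {C}" "?G \<inter> ?H2 = {C}" using GH CG CH unfolding him by blast+
  have qB: "connected (path_image q)" "closed (path_image q)" "X c j \<in> path_image q"
    "X c k \<in> path_image q"
    using q(1) pathstart_in_path_image[of q] pathfinish_in_path_image[of q] q(3,4)
    by (auto intro: connected_path_image closed_path_image arc_imp_path)
  \<comment> \<open>The legs towards \<open>X c k\<close> and \<open>X c j\<close> meet in
    \<open>C\<close> alone, so the continuum \<open>path_image q\<close>, which joins these exits,
    has to contain \<open>C\<close>.\<close>
  have "C \<in> path_image q"
    by (rule separating_point_mem[OF I(3,2) con(1) sub(1) con(3) sub(3) qB(1,2) q(2) ends(1,3) GH12(2) qB(4,3)])
  moreover have "C \<in> path_image g" using t01 by (auto simp: C_def path_image_def)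
  moreover have "C \<in> path_image h" using CH(1) unfolding him by (rule UnI1)
  \<comment> \<open>The part of \<open>g\<close> before the parameter \<open>t\<close> has not been
    examined so far; minimality against the continuum \<open>?H1 \<union> ?G\<close> forces it into
    \<open>?H1 \<union> ?G\<close> all the same.\<close>
  moreover have "path_image g \<subseteq> ?H1 \<union> ?G"
    by (rule arc_path_image_minimal[OF I(1,3) g(1-4)])
      (use con sub cpt CG CH ends in \<open>auto intro!: connected_Un compact_imp_closed\<close>)
  moreover have "path_image q \<subseteq> ?H2 \<union> ?G"
    by (rule arc_path_image_minimal[OF I(2,3) q(1-4)])
      (use con sub cpt CG CH ends in \<open>auto intro!: connected_Un compact_imp_closed\<close>)
  moreover have "P \<inter> Q \<inter> R \<subseteq> {C}"
    if "P = A1 \<union> A2" "R \<subseteq> A1 \<union> A3" "Q \<subseteq> A2 \<union> A3" "A1 \<inter> A2 = {C}" "A3 \<inter> A1 = {C}" "A3 \<inter> A2 = {C}"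
    for P Q R A1 A2 A3 :: "'a set"
    using that by blast
  ultimately have "{C} = path_image h \<inter> path_image q \<inter> path_image g"
    using HH GH12 him by (intro equalityI) (simp, metis)
  moreover have "C \<in> L c" using CG sub(1) by (rule subsetD[rotated])
  ultimately show ?thesis unfolding h(5) q(5) g(5) by (rule bexI)
qed

end

subsection \<open>Affine maps of triangles\<close>

abbreviation idx :: "nat set" where "idx \<equiv> {1, 2, 3}"

text \<open>Barycentric coordinates with respect to \<open>P1\<close>, \<open>P2\<close>, \<open>P3\<close>.\<close>

definition bc :: "nat \<Rightarrow> point \<Rightarrow> real" where
  "bc i p = (if i = 1 then 1 - fst p - snd p / sqrt 3
             else if i = 2 then fst p - snd p / sqrt 3 else 2 * snd p / sqrt 3)"

definition corner :: "nat \<Rightarrow> point" where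
  "corner i = (if i = 1 then P1 else if i = 2 then P2 else P3)"

definition T1 :: "point set" where
  "T1 = {p. \<forall>i\<in>idx. 0 \<le> bc i p}"

fun amap :: "triangle \<Rightarrow> point \<Rightarrow> point" where
  "amap (A1, A2, A3) p = bc 1 p *\<^sub>R A1 + bc 2 p *\<^sub>R A2 + bc 3 p *\<^sub>R A3"

text \<open>An ordered triangle is the same as an affine map of the plane
  (\<open>triangle_eqI\<close>); this is composition of maps, hence associative.\<close>

fun tri_comp :: "triangle \<Rightarrow> triangle \<Rightarrow> triangle" where
  "tri_comp U (B1, B2, B3) = (amap U B1, amap U B2, amap U B3)"

lemma bc_sum: "bc 1 p + bc 2 p + bc 3 p = 1"
  by (simp add: bc_def field_simps)

lemma bc_expand: "bc 1 p *\<^sub>R P1 + bc 2 p *\<^sub>R P2 + bc 3 p *\<^sub>R P3 = p"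
  by (simp add: bc_def P1_def P2_def P3_def prod_eq_iff field_simps)

lemma bc_eqI: "(\<And>i. i \<in> idx \<Longrightarrow> bc i p = bc i q) \<Longrightarrow> p = q"
  by (metis bc_expand insertCI)

lemma bc_affine:
  "a + b + c = 1 \<Longrightarrow>
    bc i (a *\<^sub>R x + b *\<^sub>R y + c *\<^sub>R z) = a * bc i x + b * bc i y + c * bc i z"
  by (simp add: bc_def field_simps)

lemma bc_corner: "i \<in> idx \<Longrightarrow> j \<in> idx \<Longrightarrow> bc i (corner j) = (if i = j then 1 else 0)"
  by (auto simp: bc_def corner_def P1_def P2_def P3_def)

lemma bc_vertices:
  "bc (Suc 0) P1 = 1" "bc 2 P1 = 0" "bc 3 P1 = 0" "bc (Suc 0) P2 = 0" "bc 2 P2 = 1" "bc 3 P2 = 0"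
  "bc (Suc 0) P3 = 0" "bc 2 P3 = 0" "bc 3 P3 = 1"
  by (simp_all add: bc_def P1_def P2_def P3_def)

lemma bc_comb:
  assumes "a + b + c = 1"
  shows "bc 1 (a *\<^sub>R P1 + b *\<^sub>R P2 + c *\<^sub>R P3) = a" "bc 2 (a *\<^sub>R P1 + b *\<^sub>R P2 + c *\<^sub>R P3) = b"
    "bc 3 (a *\<^sub>R P1 + b *\<^sub>R P2 + c *\<^sub>R P3) = c"
  using assms by (simp_all add: bc_affine bc_vertices)

lemma bc_nonneg: "p \<in> T1 \<Longrightarrow> i \<in> idx \<Longrightarrow> 0 \<le> bc i p"
  by (auto simp: T1_def)

lemma bc_le_1: "p \<in> T1 \<Longrightarrow> i \<in> idx \<Longrightarrow> bc i p \<le> 1"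
  using bc_sum[of p] by (auto simp: T1_def)

lemma corner_eqI: "p \<in> T1 \<Longrightarrow> i \<in> idx \<Longrightarrow> bc i p = 1 \<Longrightarrow> p = corner i"
proof (rule bc_eqI)
  fix j assume "p \<in> T1" "i \<in> idx" "bc i p = 1" "j \<in> idx"
  then show "bc j p = bc j (corner i)"
    using bc_sum[of p] bc_nonneg[of p 1] bc_nonneg[of p 2] bc_nonneg[of p 3]
      by (auto simp: bc_corner)
qed

lemma corner_in_T1: "i \<in> idx \<Longrightarrow> corner i \<in> T1"
  by (auto simp: T1_def bc_corner)

lemma P_in_T1: "P1 \<in> T1" "P2 \<in> T1" "P3 \<in> T1"
  using corner_in_T1[of 1] corner_in_T1[of 2] corner_in_T1[of 3] by (simp_all add: corner_def)

lemma amap_P: "amap (A1, A2, A3) P1 = A1" "amap (A1, A2, A3) P2 = A2" "amap (A1, A2, A3) P3 = A3"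
  by (simp_all add: bc_vertices)

lemma triangle_eqI: "(\<And>p. amap U p = amap V p) \<Longrightarrow> U = V"
  by (cases U rule: prod_cases3; cases V rule: prod_cases3) (metis amap_P)

lemma region_amap: "region U = amap U ` T1"
proof -
  obtain A1 A2 A3 where fields: "U = (A1, A2, A3)" by (cases U rule: prod_cases3)
  show ?thesis
  proof (intro equalityI subsetI)
    fix x assume "x \<in> region U"
    then obtain u v w where uvw: "0 \<le> u" "0 \<le> v" "0 \<le> w" "u + v + w = 1"
      and x: "x = u *\<^sub>R A1 + v *\<^sub>R A2 + w *\<^sub>R A3"
      by (auto simp: fields convex_hull_3)
    let ?p = "u *\<^sub>R P1 + v *\<^sub>R P2 + w *\<^sub>R P3"
    have "?p \<in> T1" using uvw bc_comb[OF uvw(4)] by (auto simp: T1_def)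
    moreover have "x = amap U ?p" unfolding fields amap.simps bc_comb[OF uvw(4)] x ..
    ultimately show "x \<in> amap U ` T1" by blast
  next
    fix x assume "x \<in> amap U ` T1"
    then obtain p where p: "p \<in> T1" "x = amap U p" by blast
    then have "x = bc 1 p *\<^sub>R A1 + bc 2 p *\<^sub>R A2 + bc 3 p *\<^sub>R A3 \<and> 0 \<le> bc 1 p \<and> 0 \<le> bc 2 p \<and>
      0 \<le> bc 3 p \<and> bc 1 p + bc 2 p + bc 3 p = 1"
      using bc_sum[of p] by (simp add: fields T1_def)
    then show "x \<in> region U" unfolding fields region.simps convex_hull_3 by blast
  qed
qed

lemma tri_map_amap:
  assumes "p \<in> T1" shows "tri_map U p = amap U p"
proof -
  obtain A1 A2 A3 where fields: "U = (A1, A2, A3)" by (cases U rule: prod_cases3)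
  have "(bc 1 p, bc 2 p, bc 3 p) \<in> H"
    using bc_nonneg[OF assms] bc_le_1[OF assms] bc_sum[of p] by (auto simp: H_def)
  from tri_map_barycentric[OF this, of A1 A2 A3] show ?thesis
    unfolding bc_expand by (simp add: fields)
qed

lemma amap_tri_comp: "amap (tri_comp U V) p = amap U (amap V p)"
proof -
  obtain A1 A2 A3 B1 B2 B3 where UV: "U = (A1, A2, A3)" "V = (B1, B2, B3)"
    by (cases U rule: prod_cases3; cases V rule: prod_cases3)
  have bc: "bc i (amap V p) = bc 1 p * bc i B1 + bc 2 p * bc i B2 + bc 3 p * bc i B3" for i
    unfolding UV amap.simps by (rule bc_affine[OF bc_sum])
  show ?thesis
    unfolding UV(1) amap.simps bc unfolding UV tri_comp.simps amap.simps
    by (simp add: algebra_simps)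
qed

lemma tri_comp_assoc: "tri_comp (tri_comp U V) W = tri_comp U (tri_comp V W)"
  by (rule triangle_eqI) (simp add: amap_tri_comp)

section \<open>Upright and inverted grid triangles\<close>

definition up :: "nat \<Rightarrow> (nat \<Rightarrow> int) \<Rightarrow> triangle" where
  "up m k = tri_T m (k 1) (k 2) (k 3)"

text \<open>The indices of an inverted triangle are shifted by one, so that upright triangles act on
  barycentric coordinates by \<open>\<beta> \<mapsto> (k + \<beta>) / m\<close> and inverted ones by \<open>\<beta> \<mapsto> (l - \<beta>) / m\<close>.\<close>

definition dn :: "nat \<Rightarrow> (nat \<Rightarrow> int) \<Rightarrow> triangle" where
  "dn m l = tri_T' m (l 1 - 1) (l 2 - 1) (l 3 - 1)"

lemma amap_up:
  "amap (up m k) p =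
    (1 / real m) *\<^sub>R (of_int (k 1) *\<^sub>R P1 + of_int (k 2) *\<^sub>R P2 + of_int (k 3) *\<^sub>R P3 + p)"
proof -
  let ?K = "of_int (k 1) *\<^sub>R P1 + of_int (k 2) *\<^sub>R P2 + of_int (k 3) *\<^sub>R P3"
  have "amap (up m k) p = (1 / real m) *\<^sub>R ((bc 1 p + bc 2 p + bc 3 p) *\<^sub>R ?K
      + (bc 1 p *\<^sub>R P1 + bc 2 p *\<^sub>R P2 + bc 3 p *\<^sub>R P3))"
    unfolding up_def tri_T_def Let_def amap.simps by (simp add: algebra_simps)
  then show ?thesis unfolding bc_sum bc_expand by simp
qed

lemma amap_dn:
  "amap (dn m l) p =
    (1 / real m) *\<^sub>R (of_int (l 1) *\<^sub>R P1 + of_int (l 2) *\<^sub>R P2 + of_int (l 3) *\<^sub>R P3 - p)"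
proof -
  let ?K = "of_int (l 1) *\<^sub>R P1 + of_int (l 2) *\<^sub>R P2 + of_int (l 3) *\<^sub>R P3"
  have K: "of_int (l 1 - 1) *\<^sub>R P1 + of_int (l 2 - 1) *\<^sub>R P2 + of_int (l 3 - 1) *\<^sub>R P3 + P1 + P2 + P3 = ?K"
    by (simp add: algebra_simps)
  have "amap (dn m l) p = (1 / real m) *\<^sub>R ((bc 1 p + bc 2 p + bc 3 p) *\<^sub>R ?K
      - (bc 1 p *\<^sub>R P1 + bc 2 p *\<^sub>R P2 + bc 3 p *\<^sub>R P3))"
    unfolding dn_def tri_T'_def Let_def amap.simps K by (simp add: algebra_simps)
  then show ?thesis unfolding bc_sum bc_expand by simp
qed

lemma bc_amap_up:
  assumes "m > 0" "k 1 + k 2 + k 3 = int m - 1" "i \<in> idx"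
  shows "bc i (amap (up m k) p) = (real_of_int (k i) + bc i p) / real m"
proof -
  let ?a = "\<lambda>i. (real_of_int (k i) + bc i p) / real m"
  have "(1 / real m) *\<^sub>R (of_int (k 1) *\<^sub>R P1 + of_int (k 2) *\<^sub>R P2 + of_int (k 3) *\<^sub>R P3
      + (b1 *\<^sub>R P1 + b2 *\<^sub>R P2 + b3 *\<^sub>R P3))
    = ((k 1 + b1) / m) *\<^sub>R P1 + ((k 2 + b2) / m) *\<^sub>R P2 + ((k 3 + b3) / m) *\<^sub>R P3" for b1 b2 b3 :: real
    by (simp add: algebra_simps add_divide_distrib)
  from this[of "bc 1 p" "bc 2 p" "bc 3 p"]
  have eq: "amap (up m k) p = ?a 1 *\<^sub>R P1 + ?a 2 *\<^sub>R P2 + ?a 3 *\<^sub>R P3"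
    unfolding amap_up bc_expand .
  have "real_of_int (k 1) + real_of_int (k 2) + real_of_int (k 3) = real m - 1"
    using assms(2) by linarith
  then have "(k 1 + bc 1 p) + (k 2 + bc 2 p) + (k 3 + bc 3 p) = real m"
    using bc_sum[of p] by linarith
  then have "?a 1 + ?a 2 + ?a 3 = 1"
    using assms(1) by (simp only: add_divide_distrib[symmetric]) simp
  from bc_comb[OF this] show ?thesis unfolding eq using assms(3) by auto
qed

lemma bc_amap_dn:
  assumes "m > 0" "l 1 + l 2 + l 3 = int m + 1" "i \<in> idx"
  shows "bc i (amap (dn m l) p) = (real_of_int (l i) - bc i p) / real m"
proof -
  let ?a = "\<lambda>i. (real_of_int (l i) - bc i p) / real m"
  have "(1 / real m) *\<^sub>R (of_int (l 1) *\<^sub>R P1 + of_int (l 2) *\<^sub>R P2 + of_int (l 3) *\<^sub>R P3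
      - (b1 *\<^sub>R P1 + b2 *\<^sub>R P2 + b3 *\<^sub>R P3))
    = ((l 1 - b1) / m) *\<^sub>R P1 + ((l 2 - b2) / m) *\<^sub>R P2 + ((l 3 - b3) / m) *\<^sub>R P3" for b1 b2 b3 :: real
    by (simp add: algebra_simps diff_divide_distrib)
  from this[of "bc 1 p" "bc 2 p" "bc 3 p"]
  have eq: "amap (dn m l) p = ?a 1 *\<^sub>R P1 + ?a 2 *\<^sub>R P2 + ?a 3 *\<^sub>R P3"
    unfolding amap_dn bc_expand .
  have "real_of_int (l 1) + real_of_int (l 2) + real_of_int (l 3) = real m + 1"
    using assms(2) by linarith
  then have "(l 1 - bc 1 p) + (l 2 - bc 2 p) + (l 3 - bc 3 p) = real m"
    using bc_sum[of p] by linarith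
  then have "?a 1 + ?a 2 + ?a 3 = 1"
    using assms(1) by (simp only: add_divide_distrib[symmetric]) simp
  from bc_comb[OF this] show ?thesis unfolding eq using assms(3) by auto
qed

lemma dist_amap_up: "dist (amap (up m k) p) (amap (up m k) q) = 1 / real m * dist p q"
  unfolding amap_up dist_norm by (simp flip: scaleR_diff_right)

lemma dist_amap_dn: "dist (amap (dn m k) p) (amap (dn m k) q) = 1 / real m * dist p q"
  unfolding amap_dn dist_norm by (simp add: norm_minus_commute flip: scaleR_diff_right)

definition ups :: "nat \<Rightarrow> triangle set" where
  "ups m = {up m k | k. (\<forall>i\<in>idx. 0 \<le> k i) \<and> k 1 + k 2 + k 3 = int m - 1}"

text \<open>After the shift by one, natural indices with sum \<open>m - 2\<close> become indices at
  least 1 with sum \<open>m - 2 + 3\<close>.\<close>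

definition dns :: "nat \<Rightarrow> triangle set" where
  "dns m = {dn m l | l. (\<forall>i\<in>idx. 1 \<le> l i) \<and> l 1 + l 2 + l 3 = int m + 1}"

lemma upsI: "(\<And>i. i \<in> idx \<Longrightarrow> 0 \<le> k i) \<Longrightarrow> k 1 + k 2 + k 3 = int m - 1 \<Longrightarrow> up m k \<in> ups m"
  unfolding ups_def by blast

lemma upsE:
  assumes "U \<in> ups m"
  obtains k where "U = up m k" "\<forall>i\<in>idx. 0 \<le> k i" "k 1 + k 2 + k 3 = int m - 1"
  using assms unfolding ups_def by blast

lemma dnsI: "(\<And>i. i \<in> idx \<Longrightarrow> 1 \<le> l i) \<Longrightarrow> l 1 + l 2 + l 3 = int m + 1 \<Longrightarrow> dn m l \<in> dns m"
  unfolding dns_def by blast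

lemma dnsE:
  assumes "U \<in> dns m"
  obtains l where "U = dn m l" "\<forall>i\<in>idx. 1 \<le> l i" "l 1 + l 2 + l 3 = int m + 1"
  using assms unfolding dns_def by blast

lemma tris_subset_ups: "m \<ge> 1 \<Longrightarrow> tris m \<subseteq> ups m"
proof
  fix U assume "m \<ge> 1" "U \<in> tris m"
  then obtain k1 k2 k3 where k: "U = tri_T m (int k1) (int k2) (int k3)" "k1 + k2 + k3 = m - 1"
    unfolding tris_def by blast
  define k where "k i = (if i = (1::nat) then int k1 else if i = 2 then int k2 else int k3)" for i
  have "U = up m k" by (simp add: k up_def k_def)
  moreover have "up m k \<in> ups m" using k(2) \<open>m \<ge> 1\<close> by (intro upsI) (auto simp: k_def)
  ultimately show "U \<in> ups m" by simp
qed

lemma tris'_subset_dns: "m \<ge> 2 \<Longrightarrow> tris' m \<subseteq> dns m"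
proof
  fix U assume "m \<ge> 2" "U \<in> tris' m"
  then obtain k1 k2 k3 where k: "U = tri_T' m (int k1) (int k2) (int k3)" "k1 + k2 + k3 = m - 2"
    unfolding tris'_def by blast
  define k where "k i = (if i = (1::nat) then int k1 else if i =
      2 then int k2 else int k3) + 1" for i
  have "U = dn m k" by (simp add: k dn_def k_def)
  moreover have "dn m k \<in> dns m" using k(2) \<open>m \<ge> 2\<close> by (intro dnsI) (auto simp: k_def)
  ultimately show "U \<in> dns m" by simp
qed

lemma finite_tris: "finite (tris m)" "finite (tris' m)"
proof -
  have "tris m \<subseteq> (\<lambda>(a, b, c). tri_T m (int a) (int b) (int c)) ` ({..m} \<times> {..m} \<times> {..m})"
  proof
    fix U assume "U \<in> tris m"
    then obtain a b c where "U = tri_T m (int a) (int b) (int c)" "a + b + c = m - 1"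
      unfolding tris_def by blast
    then show "U \<in> (\<lambda>(a, b, c). tri_T m (int a) (int b) (int c)) ` ({..m} \<times> {..m} \<times> {..m})"
      by (intro image_eqI[of _ _ "(a, b, c)"]) auto
  qed
  then show "finite (tris m)" by (rule finite_subset) simp
  have "tris' m \<subseteq> (\<lambda>(a, b, c). tri_T' m (int a) (int b) (int c)) ` ({..m} \<times> {..m} \<times> {..m})"
  proof
    fix U assume "U \<in> tris' m"
    then obtain a b c where "U = tri_T' m (int a) (int b) (int c)" "a + b + c = m - 2"
      unfolding tris'_def by blast
    then show "U \<in> (\<lambda>(a, b, c). tri_T' m (int a) (int b) (int c)) ` ({..m} \<times> {..m} \<times> {..m})"
      by (intro image_eqI[of _ _ "(a, b, c)"]) auto
  qed
  then show "finite (tris' m)" by (rule finite_subset) simp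
qed

text \<open>Because \<open>P1\<close> is the origin, the vertices alone do not show
  \<open>k 1\<close>; the prescribed sum of the indices recovers it.\<close>

lemma up_inj:
  assumes "m > 0" "k 1 + k 2 + k 3 = int m - 1" "k' 1 + k' 2 + k' 3 = int m - 1"
    "up m k = up m k'" "i \<in> idx"
  shows "k i = k' i"
proof -
  have "(real_of_int (k i) + bc i P1) / m = (real_of_int (k' i) + bc i P1) / m"
    unfolding bc_amap_up[OF assms(1,2,5), of P1, symmetric] bc_amap_up[OF assms(1,3,5), of P1, symmetric]
      assms(4) ..
  then show ?thesis using assms(1) by simp
qed

text \<open>Orientation tells the families apart: on the way from \<open>P1\<close> to
  \<open>P2\<close> the first coordinate of the image falls for an upright triangle and rises for an
  inverted one.\<close>

lemma ups_dns_disjoint: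
  assumes "m > 0" shows "ups m \<inter> dns m = {}"
proof -
  have False if U: "U \<in> ups m" "U \<in> dns m" for U
  proof -
    obtain k where k: "U = up m k" "\<forall>i\<in>idx. 0 \<le> k i" "k 1 + k 2 + k 3 = int m - 1"
      by (rule upsE[OF U(1)])
    obtain l where l: "U = dn m l" "\<forall>i\<in>idx. 1 \<le> l i" "l 1 + l 2 + l 3 = int m + 1"
      by (rule dnsE[OF U(2)])
    have "real_of_int (k 1) + bc 1 p = real_of_int (l 1) - bc 1 p" for p
      using bc_amap_up[OF assms k(3), of 1 p] bc_amap_dn[OF assms l(3), of 1 p] k(1) l(1) assms
        by simp
    from this[of P1] this[of P2] show False using bc_corner[of 1 1] bc_corner[of 1 2]
      by (simp add: corner_def)
  qed
  then show ?thesis by blast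
qed

lemma amap_ups_T1:
  assumes "m > 0" "U \<in> ups m" "p \<in> T1" shows "amap U p \<in> T1"
proof -
  obtain k where k: "U = up m k" "\<forall>i\<in>idx. 0 \<le> k i" "k 1 + k 2 + k 3 = int m - 1"
    by (rule upsE[OF assms(2)])
  have "0 \<le> bc i (amap U p)" if "i \<in> idx" for i
    using bc_amap_up[OF assms(1) k(3) that, of p] bspec[OF k(2) that] bc_nonneg[OF assms(3) that]
      by (simp add: k(1))
  then show ?thesis unfolding T1_def by blast
qed

lemma amap_dns_T1:
  assumes "m > 0" "U \<in> dns m" "p \<in> T1" shows "amap U p \<in> T1"
proof -
  obtain l where l: "U = dn m l" "\<forall>i\<in>idx. 1 \<le> l i" "l 1 + l 2 + l 3 = int m + 1"
    by (rule dnsE[OF assms(2)])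
  have "0 \<le> bc i (amap U p)" if "i \<in> idx" for i
  proof -
    have "1 \<le> real_of_int (l i)" using bspec[OF l(2) that] by simp
    then show ?thesis
      using bc_amap_dn[OF assms(1) l(3) that, of p] bc_le_1[OF assms(3) that] by (simp add: l(1))
  qed
  then show ?thesis unfolding T1_def by blast
qed

text \<open>\<open>tri_map\<close> is meaningful only on \<open>T1\<close>, and the vertices of grid
  triangles lie there.\<close>

lemma tri_image_tri_comp:
  assumes "m > 0" "V \<in> ups m \<union> dns m" shows "tri_image U V = tri_comp U V"
proof -
  obtain B1 B2 B3 where V: "V = (B1, B2, B3)" by (cases V rule: prod_cases3)
  have "amap V p \<in> T1" if "p \<in> T1" for p
    using assms(2) amap_ups_T1[OF assms(1) _ that] amap_dns_T1[OF assms(1) _ that] by blast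
  from this[OF P_in_T1(1)] this[OF P_in_T1(2)] this[OF P_in_T1(3)]
  have "B1 \<in> T1" "B2 \<in> T1" "B3 \<in> T1" unfolding V amap_P .
  then show ?thesis unfolding V by (simp add: tri_map_amap)
qed

text \<open>The outer index becomes the leading digit in base \<open>m\<close>, as in \<open>(a + (b
  + \<beta>) / m) / M = (m * a + b + \<beta>) / (M * m)\<close>. An inverted outer triangle
  subtracts the inner digit instead, and orientations multiply like signs.\<close>

lemma comp_up_up:
  assumes "M > 0" "m > 0" "a 1 + a 2 + a 3 = int M - 1" "b 1 + b 2 + b 3 = int m - 1"
  shows "tri_comp (up M a) (up m b) = up (M * m) (\<lambda>i. int m * a i + b i)"
    "(int m * a 1 + b 1) + (int m * a 2 + b 2) + (int m * a 3 + b 3) = int (M * m) - 1"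
proof -
  have "(int m * a 1 + b 1) + (int m * a 2 + b 2) + (int m * a 3 + b 3) =
      int m * (a 1 + a 2 + a 3) + (b 1 + b 2 + b 3)"
    by (simp add: algebra_simps)
  moreover have Mm: "0 < M * m" using assms(1,2) by simp
  ultimately show s: "(int m * a 1 + b 1) + (int m * a 2 + b 2) + (int m * a 3 + b 3) =
      int (M * m) - 1"
    unfolding assms(3,4) by (simp add: algebra_simps)
  show "tri_comp (up M a) (up m b) = up (M * m) (\<lambda>i. int m * a i + b i)"
  proof (rule triangle_eqI, rule bc_eqI)
    fix p and i :: nat assume i: "i \<in> idx"
    show "bc i (amap (tri_comp (up M a) (up m b)) p) =
        bc i (amap (up (M * m) (\<lambda>i. int m * a i + b i)) p)"
      unfolding amap_tri_comp bc_amap_up[OF assms(1,3) i] bc_amap_up[OF assms(2,4) i]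
        bc_amap_up[of "M * m" "\<lambda>i. int m * a i + b i", OF Mm s i]
      using assms(1,2) by (simp add: field_simps)
  qed
qed

lemma comp_up_dn:
  assumes "M > 0" "m > 0" "a 1 + a 2 + a 3 = int M - 1" "b 1 + b 2 + b 3 = int m + 1"
  shows "tri_comp (up M a) (dn m b) = dn (M * m) (\<lambda>i. int m * a i + b i)"
    "(int m * a 1 + b 1) + (int m * a 2 + b 2) + (int m * a 3 + b 3) = int (M * m) + 1"
proof -
  have "(int m * a 1 + b 1) + (int m * a 2 + b 2) + (int m * a 3 + b 3) =
      int m * (a 1 + a 2 + a 3) + (b 1 + b 2 + b 3)"
    by (simp add: algebra_simps)
  moreover have Mm: "0 < M * m" using assms(1,2) by simp
  ultimately show s: "(int m * a 1 + b 1) + (int m * a 2 + b 2) + (int m * a 3 + b 3) =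
      int (M * m) + 1"
    unfolding assms(3,4) by (simp add: algebra_simps)
  show "tri_comp (up M a) (dn m b) = dn (M * m) (\<lambda>i. int m * a i + b i)"
  proof (rule triangle_eqI, rule bc_eqI)
    fix p and i :: nat assume i: "i \<in> idx"
    show "bc i (amap (tri_comp (up M a) (dn m b)) p) =
        bc i (amap (dn (M * m) (\<lambda>i. int m * a i + b i)) p)"
      unfolding amap_tri_comp bc_amap_up[OF assms(1,3) i] bc_amap_dn[OF assms(2,4) i]
        bc_amap_dn[of "M * m" "\<lambda>i. int m * a i + b i", OF Mm s i]
      using assms(1,2) by (simp add: field_simps)
  qed
qed

lemma comp_dn_up:
  assumes "M > 0" "m > 0" "a 1 + a 2 + a 3 = int M + 1" "b 1 + b 2 + b 3 = int m - 1"
  shows "tri_comp (dn M a) (up m b) = dn (M * m) (\<lambda>i. int m * a i - b i)"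
    "(int m * a 1 - b 1) + (int m * a 2 - b 2) + (int m * a 3 - b 3) = int (M * m) + 1"
proof -
  have "(int m * a 1 - b 1) + (int m * a 2 - b 2) + (int m * a 3 - b 3) =
      int m * (a 1 + a 2 + a 3) - (b 1 + b 2 + b 3)"
    by (simp add: algebra_simps)
  moreover have Mm: "0 < M * m" using assms(1,2) by simp
  ultimately show s: "(int m * a 1 - b 1) + (int m * a 2 - b 2) + (int m * a 3 - b 3) =
      int (M * m) + 1"
    unfolding assms(3,4) by (simp add: algebra_simps)
  show "tri_comp (dn M a) (up m b) = dn (M * m) (\<lambda>i. int m * a i - b i)"
  proof (rule triangle_eqI, rule bc_eqI)
    fix p and i :: nat assume i: "i \<in> idx"
    show "bc i (amap (tri_comp (dn M a) (up m b)) p) =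
        bc i (amap (dn (M * m) (\<lambda>i. int m * a i - b i)) p)"
      unfolding amap_tri_comp bc_amap_dn[OF assms(1,3) i] bc_amap_up[OF assms(2,4) i]
        bc_amap_dn[of "M * m" "\<lambda>i. int m * a i - b i", OF Mm s i]
      using assms(1,2) by (simp add: field_simps)
  qed
qed

lemma comp_dn_dn:
  assumes "M > 0" "m > 0" "a 1 + a 2 + a 3 = int M + 1" "b 1 + b 2 + b 3 = int m + 1"
  shows "tri_comp (dn M a) (dn m b) = up (M * m) (\<lambda>i. int m * a i - b i)"
    "(int m * a 1 - b 1) + (int m * a 2 - b 2) + (int m * a 3 - b 3) = int (M * m) - 1"
proof -
  have "(int m * a 1 - b 1) + (int m * a 2 - b 2) + (int m * a 3 - b 3) =
      int m * (a 1 + a 2 + a 3) - (b 1 + b 2 + b 3)"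
    by (simp add: algebra_simps)
  moreover have Mm: "0 < M * m" using assms(1,2) by simp
  ultimately show s: "(int m * a 1 - b 1) + (int m * a 2 - b 2) + (int m * a 3 - b 3) =
      int (M * m) - 1"
    unfolding assms(3,4) by (simp add: algebra_simps)
  show "tri_comp (dn M a) (dn m b) = up (M * m) (\<lambda>i. int m * a i - b i)"
  proof (rule triangle_eqI, rule bc_eqI)
    fix p and i :: nat assume i: "i \<in> idx"
    show "bc i (amap (tri_comp (dn M a) (dn m b)) p) =
        bc i (amap (up (M * m) (\<lambda>i. int m * a i - b i)) p)"
      unfolding amap_tri_comp bc_amap_dn[OF assms(1,3) i] bc_amap_dn[OF assms(2,4) i]
        bc_amap_up[of "M * m" "\<lambda>i. int m * a i - b i", OF Mm s i]
      using assms(1,2) by (simp add: field_simps)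
  qed
qed

lemma ups_nonneg_le:
  assumes "\<forall>i\<in>idx. 0 \<le> k i" "k 1 + k 2 + k 3 = int m - 1" "i \<in> idx"
  shows "k i \<le> int m - 1"
  using assms by auto

text \<open>The other two indices are at least 1. This gap below \<open>m\<close> keeps inverted
  triangles away from the corners, and inverted triangles inside inverted ones away from the whole
  boundary.\<close>

lemma dns_le:
  assumes "\<forall>i\<in>idx. 1 \<le> l i" "l 1 + l 2 + l 3 = int m + 1" "i \<in> idx"
  shows "l i \<le> int m - 1"
  using assms by auto

lemma comp_ups_ups:
  assumes "M > 0" "m > 0" "U \<in> ups M" "V \<in> ups m" shows "tri_comp U V \<in> ups (M * m)"
proof -
  obtain a where a: "U = up M a" "\<forall>i\<in>idx. 0 \<le> a i" "a 1 + a 2 + a 3 = int M - 1"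
    by (rule upsE[OF assms(3)])
  obtain b where b: "V = up m b" "\<forall>i\<in>idx. 0 \<le> b i" "b 1 + b 2 + b 3 = int m - 1"
    by (rule upsE[OF assms(4)])
  show ?thesis unfolding a(1) b(1) comp_up_up(1)[OF assms(1,2) a(3) b(3)]
    by (rule upsI[OF _ comp_up_up(2)[OF assms(1,2) a(3) b(3)]]) (use a(2) b(2) in auto)
qed

lemma comp_ups_dns:
  assumes "M > 0" "m > 0" "U \<in> ups M" "V \<in> dns m" shows "tri_comp U V \<in> dns (M * m)"
proof -
  obtain a where a: "U = up M a" "\<forall>i\<in>idx. 0 \<le> a i" "a 1 + a 2 + a 3 = int M - 1"
    by (rule upsE[OF assms(3)])
  obtain b where b: "V = dn m b" "\<forall>i\<in>idx. 1 \<le> b i" "b 1 + b 2 + b 3 = int m + 1"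
    by (rule dnsE[OF assms(4)])
  show ?thesis unfolding a(1) b(1) comp_up_dn(1)[OF assms(1,2) a(3) b(3)]
  proof (rule dnsI[OF _ comp_up_dn(2)[OF assms(1,2) a(3) b(3)]])
    fix i assume i: "i \<in> idx"
    have "0 \<le> int m * a i" using bspec[OF a(2) i] by simp
    then show "1 \<le> int m * a i + b i" using bspec[OF b(2) i] by linarith
  qed
qed

lemma comp_dns_ups:
  assumes "M > 0" "m > 0" "U \<in> dns M" "V \<in> ups m" shows "tri_comp U V \<in> dns (M * m)"
proof -
  obtain a where a: "U = dn M a" "\<forall>i\<in>idx. 1 \<le> a i" "a 1 + a 2 + a 3 = int M + 1"
    by (rule dnsE[OF assms(3)])
  obtain b where b: "V = up m b" "\<forall>i\<in>idx. 0 \<le> b i" "b 1 + b 2 + b 3 = int m - 1"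
    by (rule upsE[OF assms(4)])
  show ?thesis unfolding a(1) b(1) comp_dn_up(1)[OF assms(1,2) a(3) b(3)]
  proof (rule dnsI[OF _ comp_dn_up(2)[OF assms(1,2) a(3) b(3)]])
    fix i assume i: "i \<in> idx"
    have "int m * 1 \<le> int m * a i" using bspec[OF a(2) i] by (intro mult_left_mono) auto
    then show "1 \<le> int m * a i - b i" using ups_nonneg_le[OF b(2,3) i] by linarith
  qed
qed

lemma comp_dns_dns:
  assumes "M > 0" "m > 0" "U \<in> dns M" "V \<in> dns m" shows "tri_comp U V \<in> ups (M * m)"
proof -
  obtain a where a: "U = dn M a" "\<forall>i\<in>idx. 1 \<le> a i" "a 1 + a 2 + a 3 = int M + 1"
    by (rule dnsE[OF assms(3)])
  obtain b where b: "V = dn m b" "\<forall>i\<in>idx. 1 \<le> b i" "b 1 + b 2 + b 3 = int m + 1"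
    by (rule dnsE[OF assms(4)])
  show ?thesis unfolding a(1) b(1) comp_dn_dn(1)[OF assms(1,2) a(3) b(3)]
  proof (rule upsI[OF _ comp_dn_dn(2)[OF assms(1,2) a(3) b(3)]])
    fix i assume i: "i \<in> idx"
    have "int m * 1 \<le> int m * a i" using bspec[OF a(2) i] by (intro mult_left_mono) auto
    then show "0 \<le> int m * a i - b i" using dns_le[OF b(2,3) i] by linarith
  qed
qed

subsection \<open>Levels of a patterns system\<close>

declare tri_comp.simps [simp del] amap.simps [simp del]

definition products :: "triangle set \<Rightarrow> triangle set \<Rightarrow> triangle set" where
  "products A B = (\<Union>U\<in>A. tri_comp U ` B)"

lemma UN_products: "(\<Union>W\<in>products A B. F W) = (\<Union>U\<in>A. \<Union>V\<in>B. F (tri_comp U V))"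
  unfolding products_def by blast

lemma products_assoc: "products (products A B) C = products A (products B C)"
proof -
  have "tri_comp U ` products B C = (\<Union>V\<in>B. tri_comp (tri_comp U V) ` C)" for U
    by (simp add: products_def image_UN image_image tri_comp_assoc)
  then show ?thesis
    unfolding products_def[of "products A B"] products_def[of A "products B C"] UN_products by simp
qed

lemma products_Un: "products (A \<union> B) C = products A C \<union> products B C"
  "products A (B \<union> C) = products A B \<union> products A C"
  by (simp_all add: products_def image_Un UN_Un_distrib)

lemma finite_products: "finite A \<Longrightarrow> finite B \<Longrightarrow> finite (products A B)"
  by (simp add: products_def)

text \<open>The part of the pattern conditions that every order inherits from the first.\<close>

definition fits :: "nat \<Rightarrow> patterns_system \<Rightarrow> bool" where
  "fits M R \<longleftrightarrow> 0 < M \<and> white R \<subseteq> ups M \<and> yellow R \<subseteq> ups M \<and> white' R \<subseteq> dns M \<and> yellow' R \<subseteq> dns M \<and>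
     finite (white R) \<and> finite (yellow R) \<and> finite (white' R) \<and> finite (yellow' R)"

text \<open>An involution that commutes with forming levels (\<open>level_swap\<close>); statements
  about yellow are the white ones for the swapped system.\<close>

definition swap_colours :: "patterns_system \<Rightarrow> patterns_system" where
  "swap_colours S = \<lparr>white = yellow S, white' = yellow' S, yellow = white S, yellow' = white' S\<rparr>"

lemma swap_colours_sel [simp]: "white (swap_colours S) = yellow S"
  "white' (swap_colours S) = yellow' S"
  "yellow (swap_colours S) = white S" "yellow' (swap_colours S) = white' S"
    "swap_colours (swap_colours S) = S"
  by (simp_all add: swap_colours_def)

lemma fits_swap [simp]: "fits m (swap_colours S) = fits m S"
  by (auto simp: fits_def)

lemma triangular_patterns_system_fits: "triangular_patterns_system m S \<Longrightarrow> fits m S"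
  unfolding triangular_patterns_system_def fits_def
  using tris_subset_ups[of m] tris'_subset_dns[of m] finite_tris[of m]
  by (auto intro: finite_subset)

lemma tri_image_products:
  assumes "0 < m" "B \<subseteq> ups m \<union> dns m"
  shows "{tri_image U V | U V. U \<in> A \<and> V \<in> B} = products A B"
proof -
  have "tri_image U V = tri_comp U V" if "V \<in> B" for U V
    using tri_image_tri_comp[OF assms(1)] assms(2) that by blast
  then have "{tri_image U V | U V. U \<in> A \<and> V \<in> B} = {tri_comp U V | U V. U \<in> A \<and> V \<in> B}"
    by (intro Collect_cong ex_cong1) metis
  also have "\<dots> = products A B" unfolding products_def by blast
  finally show ?thesis .
qed

lemma refine_products:
  assumes "fits m S"
  shows "white (refine R S) = products (white R) (white S) \<union> products (white' R) (yellow' S)"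
    "white' (refine R S) = products (white R) (white' S) \<union> products (white' R) (yellow S)"
    "yellow (refine R S) = products (yellow R) (yellow S) \<union> products (yellow' R) (white' S)"
    "yellow' (refine R S) = products (yellow R) (yellow' S) \<union> products (yellow' R) (white S)"
proof -
  have "0 < m" "white S \<subseteq> ups m \<union> dns m" "yellow S \<subseteq> ups m \<union> dns m" "white' S \<subseteq> ups m \<union> dns m"
    "yellow' S \<subseteq> ups m \<union> dns m" using assms by (auto simp: fits_def)
  note * = tri_image_products[OF this(1) this(2)] tri_image_products[OF this(1) this(3)]
    tri_image_products[OF this(1) this(4)] tri_image_products[OF this(1) this(5)]
  show "white (refine R S) = products (white R) (white S) \<union> products (white' R) (yellow' S)"
    "white' (refine R S) = products (white R) (white' S) \<union> products (white' R) (yellow S)"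
    "yellow (refine R S) = products (yellow R) (yellow S) \<union> products (yellow' R) (white' S)"
    "yellow' (refine R S) = products (yellow R) (yellow' S) \<union> products (yellow' R) (white S)"
    unfolding refine_def patterns_system.simps * by (rule refl)+
qed

lemma products_subset: "(\<And>U V. U \<in> A \<Longrightarrow> V \<in> B \<Longrightarrow> tri_comp U V \<in> C) \<Longrightarrow> products A B \<subseteq> C"
  unfolding products_def by blast

lemma fits_refine:
  assumes "fits M R" "fits m S" shows "fits (M * m) (refine R S)"
proof -
  have M: "0 < M" "0 < m" using assms by (auto simp: fits_def)
  have R: "white R \<subseteq> ups M" "yellow R \<subseteq> ups M" "white' R \<subseteq> dns M" "yellow' R \<subseteq> dns M"
    and S: "white S \<subseteq> ups m" "yellow S \<subseteq> ups m" "white' S \<subseteq> dns m" "yellow' S \<subseteq> dns m"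
    using assms by (simp_all add: fits_def)
  have c: "A \<subseteq> ups M \<Longrightarrow> B \<subseteq> ups m \<Longrightarrow> products A B \<subseteq> ups (M * m)"
    "A \<subseteq> ups M \<Longrightarrow> B \<subseteq> dns m \<Longrightarrow> products A B \<subseteq> dns (M * m)"
    "A \<subseteq> dns M \<Longrightarrow> B \<subseteq> ups m \<Longrightarrow> products A B \<subseteq> dns (M * m)"
    "A \<subseteq> dns M \<Longrightarrow> B \<subseteq> dns m \<Longrightarrow> products A B \<subseteq> ups (M * m)" for A B
    using comp_ups_ups[OF M] comp_ups_dns[OF M] comp_dns_ups[OF M] comp_dns_dns[OF M]
    by (intro products_subset, blast)+
  show ?thesis
    unfolding fits_def refine_products[OF assms(2)]
    using assms M by (simp add: c R S finite_products fits_def)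
qed

lemma fits_level:
  assumes "fits m S" "n \<ge> 1" shows "fits (m ^ n) (level S n)"
  using assms(2,1)
proof (induction n rule: nat_induct_at_least)
  case base
  then show ?case by simp
next
  case (Suc n)
  obtain n' where n: "n = Suc n'" using Suc.hyps by (cases n) auto
  show ?case using fits_refine[OF Suc.IH[OF Suc.prems] Suc.prems] by (simp add: n mult.commute)
qed

lemma level_Suc: "n \<ge> 1 \<Longrightarrow> level S (Suc n) = refine (level S n) S"
  by (cases n) auto

lemma level_swap: "n \<ge> 1 \<Longrightarrow> level (swap_colours S) n = swap_colours (level S n)"
proof (induction n rule: nat_induct_at_least)
  case (Suc n)
  then show ?case by (simp add: level_Suc) (simp add: refine_def swap_colours_def)
qed simp

text \<open>This is the rebracketing \<open>(S R) S = S (R S)\<close>, with the four classes of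
  colour and orientation tracked through associativity.\<close>

lemma refine_first_digit:
  assumes S: "fits m S"
    and "white Q = products (white S) (white R) \<union> products (white' S) (yellow' R)"
    "white' Q = products (white S) (white' R) \<union> products (white' S) (yellow R)"
    "yellow Q = products (yellow S) (yellow R) \<union> products (yellow' S) (white' R)"
    "yellow' Q = products (yellow S) (yellow' R) \<union> products (yellow' S) (white R)"
    and "white Q' = products (white R) (white S) \<union> products (white' R) (yellow' S)"
    "white' Q' = products (white R) (white' S) \<union> products (white' R) (yellow S)"
    "yellow Q' = products (yellow R) (yellow S) \<union> products (yellow' R) (white' S)"
    "yellow' Q' = products (yellow R) (yellow' S) \<union> products (yellow' R) (white S)"
  shows "white (refine Q S) = products (white S) (white Q') \<union> products (white' S) (yellow' Q') \<and>
    white' (refine Q S) = products (white S) (white' Q') \<union> products (white' S) (yellow Q') \<and>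
    yellow (refine Q S) = products (yellow S) (yellow Q') \<union> products (yellow' S) (white' Q') \<and>
    yellow' (refine Q S) = products (yellow S) (yellow' Q') \<union> products (yellow' S) (white Q')"
  unfolding refine_products[OF S] assms products_Un products_assoc by (simp only: Un_ac simp_thms)

text \<open>The definition of the levels refines the last digit of an address; the fractals are
  self-similar with respect to the first one.\<close>

lemma level_first_digit:
  assumes S: "fits m S" and n: "n \<ge> 1"
  shows "white (level S (Suc n)) = products (white S) (white (level S n)) \<union>
      products (white' S) (yellow' (level S n)) \<and>
    white' (level S (Suc n)) = products (white S) (white' (level S n)) \<union>
      products (white' S) (yellow (level S n)) \<and>
    yellow (level S (Suc n)) = products (yellow S) (yellow (level S n)) \<union>
      products (yellow' S) (white' (level S n)) \<and>
    yellow' (level S (Suc n)) = products (yellow S) (yellow' (level S n)) \<union>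
      products (yellow' S) (white (level S n))"
  using n
proof (induction n rule: nat_induct_at_least)
  case base
  show ?case using refine_products[OF S, of S] by simp
next
  case (Suc n)
  have eq: "level S (Suc n) = refine (level S n) S"
    "level S (Suc (Suc n)) = refine (level S (Suc n)) S"
    using Suc.hyps by (simp_all only: level_Suc le_SucI)
  note IH = Suc.IH[THEN conjunct1] Suc.IH[THEN conjunct2, THEN conjunct1]
    Suc.IH[THEN conjunct2, THEN conjunct2, THEN conjunct1] Suc.IH[THEN conjunct2, THEN conjunct2, THEN conjunct2]
  show ?case
    unfolding eq(2)
    by (rule refine_first_digit[OF S IH refine_products[OF S, of "level S n", folded eq(1)]])
qed

definition pieces :: "patterns_system \<Rightarrow> triangle set" where
  "pieces S = white S \<union> white' S"

text \<open>The system whose white fractal is scaled into the piece \<open>U\<close>.\<close>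

definition carried :: "patterns_system \<Rightarrow> triangle \<Rightarrow> patterns_system" where
  "carried S U = (if U \<in> white' S then swap_colours S else S)"

lemma carried_white: "fits m S \<Longrightarrow> U \<in> white S \<Longrightarrow> carried S U = S"
  using ups_dns_disjoint[of m] by (auto simp: carried_def fits_def)

lemma finite_pieces: "fits m S \<Longrightarrow> finite (pieces S)"
  by (simp add: fits_def pieces_def)

lemma pieces_T1: "fits m S \<Longrightarrow> U \<in> pieces S \<Longrightarrow> p \<in> T1 \<Longrightarrow> amap U p \<in> T1"
  using amap_ups_T1[of m U p] amap_dns_T1[of m U p] by (auto simp: fits_def pieces_def)

lemma dist_amap: "fits m S \<Longrightarrow> U \<in> pieces S \<Longrightarrow> dist (amap U p) (amap U q) = 1 / real m * dist p q"
  unfolding fits_def pieces_def ups_def dns_def using dist_amap_up dist_amap_dn by blast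

section \<open>Self-similarity and compactness of the fractals\<close>

lemma yellow_set_swap: "n \<ge> 1 \<Longrightarrow> yellow_set S n = white_set (swap_colours S) n"
  by (simp add: yellow_set_def white_set_def level_swap)

lemma yellow_fractal_swap: "yellow_fractal S = white_fractal (swap_colours S)"
  unfolding yellow_fractal_def white_fractal_def by (rule INF_cong) (simp_all add: yellow_set_swap)

lemma white_set_1: "white_set S (Suc 0) = (\<Union>U\<in>pieces S. amap U ` T1)"
  by (simp add: white_set_def pieces_def region_amap)

lemma white_set_Suc:
  assumes S: "fits m S" and n: "n \<ge> 1"
  shows "white_set S (Suc n) = (\<Union>U\<in>pieces S. amap U ` white_set (carried S U) n)"
proof -
  let ?R = "level S n"
  have reg: "(\<Union>W\<in>products A B. region W) = (\<Union>U\<in>A. amap U ` (\<Union>V\<in>B. region V))" for A B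
    unfolding UN_products by (simp add: region_amap image_UN image_image amap_tri_comp)
  have "white_set S (Suc n) = (\<Union>W\<in>products (white S) (white ?R \<union> white' ?R). region W)
      \<union> (\<Union>W\<in>products (white' S) (yellow ?R \<union> yellow' ?R). region W)"
    unfolding white_set_def using level_first_digit[OF S n] by (auto simp: products_Un)
  also have "\<dots> = (\<Union>U\<in>white S. amap U ` white_set S n) \<union>
      (\<Union>U\<in>white' S. amap U ` white_set (swap_colours S) n)"
    unfolding reg white_set_def level_swap[OF n] by simp
  also have "\<dots> = (\<Union>U\<in>pieces S. amap U ` white_set (carried S U) n)"
    using carried_white[OF S] by (auto simp: pieces_def carried_def)
  finally show ?thesis .
qed

lemma fits_carried: "fits m S \<Longrightarrow> fits m (carried S U)"
  by (simp add: carried_def)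

lemma white_set_T1:
  assumes "fits m S" "n \<ge> 1" shows "white_set S n \<subseteq> T1"
  using assms(2,1)
proof (induction n arbitrary: S rule: nat_induct_at_least)
  case base
  then show ?case using pieces_T1[OF base] by (auto simp: white_set_1)
next
  case (Suc n)
  show ?case
    unfolding white_set_Suc[OF Suc.prems Suc.hyps]
    using Suc.IH[OF fits_carried[OF Suc.prems]] pieces_T1[OF Suc.prems] by blast
qed

lemma white_set_decreasing:
  assumes "fits m S" "n \<ge> 1" shows "white_set S (Suc n) \<subseteq> white_set S n"
  using assms(2,1)
proof (induction n arbitrary: S rule: nat_induct_at_least)
  case base
  have "white_set (carried S U) 1 \<subseteq> T1" for U
    by (rule white_set_T1[OF fits_carried[OF base]]) simp
  then show ?case
    unfolding white_set_Suc[OF base order.refl] white_set_1[of S, folded One_nat_def]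
    by (intro UN_mono image_mono subset_refl)
next
  case (Suc n)
  have "n \<ge> 1" "Suc n \<ge> 1" using Suc.hyps by simp_all
  show ?case
    unfolding white_set_Suc[OF Suc.prems \<open>n \<ge> 1\<close>] white_set_Suc[OF Suc.prems \<open>Suc n \<ge> 1\<close>]
    using Suc.IH[OF fits_carried[OF Suc.prems]] by (intro UN_mono image_mono subset_refl)
qed

lemma white_set_antimono:
  assumes "fits m S" "1 \<le> k" "k \<le> n" shows "white_set S n \<subseteq> white_set S k"
  using assms(3,1,2)
proof (induction n rule: dec_induct)
  case (step n)
  have "white_set S (Suc n) \<subseteq> white_set S n"
    using step.hyps(1) step.prems by (intro white_set_decreasing[of m]) simp_all
  then show ?case using step.IH[OF step.prems] by (rule subset_trans)
qed simp

lemma compact_T1: "compact T1"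
proof -
  have "region (P1, P2, P3) = T1"
    unfolding region_amap amap.simps bc_expand by simp
  then have "T1 = convex hull {P1, P2, P3}" unfolding region.simps by (rule sym)
  then show ?thesis unfolding \<open>T1 = _\<close> by (intro compact_convex_hull finite_imp_compact) simp
qed

lemma continuous_amap:
  assumes "fits m S" "U \<in> pieces S" shows "continuous_on A (amap U)"
  unfolding continuous_on_iff
proof (intro ballI allI impI)
  fix x and e :: real assume "e > 0"
  moreover have "m > 0" using assms(1) by (simp add: fits_def)
  ultimately show "\<exists>d>0. \<forall>x'\<in>A. dist x' x < d \<longrightarrow> dist (amap U x') (amap U x) < e"
    unfolding dist_amap[OF assms] by (intro exI[of _ "e * m"]) (simp add: field_simps)
qed

lemma compact_white_set:
  assumes "fits m S" "n \<ge> 1" shows "compact (white_set S n)"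
  using assms(2,1)
proof (induction n arbitrary: S rule: nat_induct_at_least)
  case base
  then show ?case
    unfolding One_nat_def white_set_1
    by (intro compact_UN finite_pieces compact_continuous_image continuous_amap compact_T1)
next
  case (Suc n)
  show ?case
    unfolding white_set_Suc[OF Suc.prems Suc.hyps]
    using Suc.prems by (intro compact_UN compact_continuous_image Suc.IH fits_carried)
      (auto intro: finite_pieces continuous_amap)
qed

lemma compact_white_fractal:
  assumes "fits m S" shows "compact (white_fractal S)"
proof -
  have "closed (white_fractal S)"
    unfolding white_fractal_def
    using compact_white_set[OF assms] by (intro closed_INT ballI compact_imp_closed) simp
  then have "compact (white_set S 1 \<inter> white_fractal S)"
    using compact_white_set[OF assms, of 1] by (intro compact_Int_closed) simp_all
  moreover have "white_set S 1 \<inter> white_fractal S = white_fractal S"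
    by (auto simp: white_fractal_def)
  ultimately show ?thesis by simp
qed

lemma white_fractal_T1: "fits m S \<Longrightarrow> white_fractal S \<subseteq> T1"
  using white_set_T1[of m S 1] by (force simp: white_fractal_def)

text \<open>Union and intersection commute because there are finitely many pieces and the orders
  decrease: if every piece lost \<open>x\<close> at some order, the largest of these orders would
  lose \<open>x\<close> altogether.\<close>

lemma white_fractal_eq:
  assumes S: "fits m S"
  shows "white_fractal S = (\<Union>U\<in>pieces S. amap U ` white_fractal (carried S U))"
proof (intro equalityI subsetI)
  fix x assume x: "x \<in> white_fractal S"
  have "\<exists>U\<in>pieces S. \<forall>n\<ge>1. x \<in> amap U ` white_set (carried S U) n"
  proof (rule ccontr)
    assume "\<not> ?thesis"
    then obtain N where N: "\<And>U. U \<in> pieces S \<Longrightarrow> N U \<ge> 1 \<and> x \<notin> amap U ` white_set (carried S U) (N U)"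
      by metis
    define M where "M = Max (insert 1 (N ` pieces S))"
    have M: "M \<ge> 1" "\<And>U. U \<in> pieces S \<Longrightarrow> N U \<le> M"
      using finite_pieces[OF S] by (auto simp: M_def)
    have "x \<in> white_set S (Suc M)" using x by (auto simp: white_fractal_def)
    then obtain U where U: "U \<in> pieces S" "x \<in> amap U ` white_set (carried S U) M"
      unfolding white_set_Suc[OF S M(1)] by blast
    then show False
      using N[OF U(1)] white_set_antimono[OF fits_carried[OF S], of "N U" M] M(2)[OF U(1)] by blast
  qed
  then obtain U where U: "U \<in> pieces S" "\<And>n. n \<ge> 1 \<Longrightarrow> x \<in> amap U ` white_set (carried S U) n"
    by blast
  obtain y where y: "x = amap U y" using U(2)[of 1] by blast
  have "y \<in> white_set (carried S U) n" if n: "n \<ge> 1" for n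
  proof -
    obtain z where z: "z \<in> white_set (carried S U) n" "x = amap U z" using U(2)[OF n] by blast
    then have "dist y z = 0"
      using dist_amap[OF S U(1), of y z] y S by (simp add: fits_def)
    then show ?thesis using z by simp
  qed
  then show "x \<in> (\<Union>U\<in>pieces S. amap U ` white_fractal (carried S U))"
    using U(1) y by (auto simp: white_fractal_def)
next
  fix x assume "x \<in> (\<Union>U\<in>pieces S. amap U ` white_fractal (carried S U))"
  then obtain U y where U: "U \<in> pieces S" "y \<in> white_fractal (carried S U)" "x = amap U y" by blast
  have *: "x \<in> white_set S (Suc n)" if "n \<ge> 1" for n
    unfolding white_set_Suc[OF S that] using U that by (auto simp: white_fractal_def)
  have "x \<in> white_set S n" if n: "n \<ge> 1" for n
    using *[OF n] white_set_decreasing[OF S n] by blast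
  then show "x \<in> white_fractal S" by (simp add: white_fractal_def)
qed

subsection \<open>Exits\<close>

text \<open>\<open>exit_index M j k\<close> is the \<open>k\<close>-th upright triangle along the side opposite to the \<open>j\<close>-th corner;
  the corresponding yellow exit has \<open>k\<close> replaced by \<open>M - 1 - k\<close>.\<close>

definition exit_index :: "nat \<Rightarrow> nat \<Rightarrow> int \<Rightarrow> nat \<Rightarrow> int" where
  "exit_index M j k = (\<lambda>i. if i = j then 0 else if i = (if j =
      1 then 2 else 1) then k else int M - 1 - k)"

definition exit_at :: "nat \<Rightarrow> patterns_system \<Rightarrow> nat \<Rightarrow> int \<Rightarrow> bool" where
  "exit_at M R j k \<longleftrightarrow> 0 \<le> k \<and> k \<le> int M - 1 \<and> up M (exit_index M j k) \<in> white R \<and>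
     up M (exit_index M j (int M - 1 - k)) \<in> yellow R"

definition exit_pos :: "nat \<Rightarrow> patterns_system \<Rightarrow> nat \<Rightarrow> int" where
  "exit_pos M R j = (THE k. exit_at M R j k)"

lemma exit_triple_exit_at:
  "exit_triple M R (k1, k2, k3) \<longleftrightarrow> exit_at M R 1 k1 \<and> exit_at M R 2 k2 \<and> exit_at M R 3 k3"
  by (auto simp: exit_at_def up_def exit_index_def exit_triple.simps)

declare exit_triple.simps [simp del]

text \<open>The sides impose independent conditions, and a product of three sets is a singleton
  exactly if each factor is. Refinement can thus be treated side by side.\<close>

lemma exits_property_exit_at: "exits_property M R \<longleftrightarrow> (\<forall>j\<in>idx. \<exists>!k. exit_at M R j k)"
proof
  assume "exits_property M R"
  then obtain a b c where abc: "exit_triple M R (a, b, c)"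
    and uniq: "\<And>k. exit_triple M R k \<Longrightarrow> k = (a, b, c)"
    unfolding exits_property_def by (metis prod_cases3)
  have "exit_at M R 1 k \<longleftrightarrow> k = a" "exit_at M R 2 k \<longleftrightarrow> k = b" "exit_at M R 3 k \<longleftrightarrow> k = c" for k
    using abc uniq[of "(k, b, c)"] uniq[of "(a, k, c)"] uniq[of "(a, b, k)"]
    unfolding exit_triple_exit_at by auto
  then show "\<forall>j\<in>idx. \<exists>!k. exit_at M R j k" by (metis insertE singletonD)
next
  assume *: "\<forall>j\<in>idx. \<exists>!k. exit_at M R j k"
  obtain a where a: "exit_at M R 1 a" using bspec[OF *, of 1] by blast
  obtain b where b: "exit_at M R 2 b" using bspec[OF *, of 2] by blast
  obtain c where c: "exit_at M R 3 c" using bspec[OF *, of 3] by blast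
  have uniq: "k = k'" if "exit_at M R j k" "exit_at M R j k'" "j \<in> idx" for j k k'
    using bspec[OF * that(3)] that(1,2) by blast
  show "exits_property M R"
    unfolding exits_property_def
  proof (rule ex1I[of _ "(a, b, c)"])
    show "exit_triple M R (a, b, c)" unfolding exit_triple_exit_at using a b c by simp
    fix t assume t: "exit_triple M R t"
    obtain a' b' c' where t': "t = (a', b', c')" by (cases t rule: prod_cases3)
    have "exit_at M R 1 a'" "exit_at M R 2 b'" "exit_at M R 3 c'"
      using t unfolding t' exit_triple_exit_at by simp_all
    then show "t = (a, b, c)" unfolding t' using uniq a b c by simp
  qed
qed

lemma exits_propertyI: "(\<And>j k. j \<in> idx \<Longrightarrow> exit_at M R j k \<longleftrightarrow> k = g j) \<Longrightarrow> exits_property M R"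
  unfolding exits_property_exit_at by (rule ballI, rule ex1I[of _ "g _"]) simp_all

lemma exit_at_exit_pos: "exits_property M R \<Longrightarrow> j \<in> idx \<Longrightarrow> exit_at M R j k \<longleftrightarrow> k = exit_pos M R j"
  unfolding exits_property_exit_at exit_pos_def by (metis the1_equality)

lemma exit_triangles:
  assumes R: "exits_property M R" and j: "j \<in> idx"
  shows "white_exit M R j = up M (exit_index M j (exit_pos M R j))"
    "yellow_exit M R j = up M (exit_index M j (int M - 1 - exit_pos M R j))"
proof -
  have "exit_at M R j (exit_pos M R j)" if "j \<in> idx" for j
    using exit_at_exit_pos[OF R that] by simp
  then have "exit_triple M R (exit_pos M R 1, exit_pos M R 2, exit_pos M R 3)"
    unfolding exit_triple_exit_at by blast
  then have "(THE k. exit_triple M R k) = (exit_pos M R 1, exit_pos M R 2, exit_pos M R 3)"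
    using R unfolding exits_property_def by (rule the1_equality[rotated])
  then show "white_exit M R j = up M (exit_index M j (exit_pos M R j))"
    "yellow_exit M R j = up M (exit_index M j (int M - 1 - exit_pos M R j))"
    using j by (auto simp: white_exit_def yellow_exit_def up_def exit_index_def)
qed

lemma exit_at_swap: "exit_at M (swap_colours R) j k \<longleftrightarrow> exit_at M R j (int M - 1 - k)"
  by (auto simp: exit_at_def)

lemma exits_property_swap:
  assumes "exits_property M R" shows "exits_property M (swap_colours R)"
    "j \<in> idx \<Longrightarrow> exit_pos M (swap_colours R) j = int M - 1 - exit_pos M R j"
proof -
  have *: "exit_at M (swap_colours R) j k \<longleftrightarrow> k = int M - 1 - exit_pos M R j" if "j \<in> idx" for j k
    unfolding exit_at_swap exit_at_exit_pos[OF assms that] by auto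
  then show "exits_property M (swap_colours R)" by (rule exits_propertyI)
  then show "j \<in> idx \<Longrightarrow> exit_pos M (swap_colours R) j = int M - 1 - exit_pos M R j"
    using * exit_at_exit_pos by blast
qed

section \<open>Exit positions under refinement\<close>

lemma exit_index_sum: "j \<in> idx \<Longrightarrow> exit_index M j k 1 + exit_index M j k 2 + exit_index M j k 3 =
    int M - 1"
  by (auto simp: exit_index_def)

lemma exit_index_self [simp]: "exit_index M j k j = 0"
  by (simp add: exit_index_def)

lemma exit_index_comb:
  "int m * exit_index M j A i + exit_index m j b i = exit_index (M * m) j (int m * A + b) i"
  by (simp add: exit_index_def algebra_simps)

lemma up_cong: "(\<And>i. i \<in> idx \<Longrightarrow> k i = k' i) \<Longrightarrow> up m k = up m k'"
  by (simp add: up_def)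

lemma exit_index_exists:
  assumes "j \<in> idx" "a j = 0" "a 1 + a 2 + a 3 = int M - 1"
  shows "\<exists>k. \<forall>i\<in>idx. a i = exit_index M j k i"
  using assms by (intro exI[of _ "a (if j = 1 then 2 else 1)"]) (auto simp: exit_index_def)

lemma exit_index_inj:
  assumes "j \<in> idx" and eq: "\<And>i. i \<in> idx \<Longrightarrow> exit_index M j k i = exit_index M j k' i"
  shows "k = k'"
  using assms(1) eq[of "if j = 1 then 2 else 1"] by (auto simp: exit_index_def split: if_splits)

lemma exit_index_bounds:
  assumes "j \<in> idx" "\<forall>i\<in>idx. 0 \<le> exit_index M j k i" shows "0 \<le> k" "k \<le> int M - 1"
  using assms by (auto simp: exit_index_def)

text \<open>Along a side the index \<open>int m * a j + b j\<close> vanishes, which forces both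
  nonnegative digits to vanish. A product of two inverted triangles has a positive index there and
  is excluded.\<close>

lemma boundary_digits:
  assumes R: "fits M R" and S: "fits m S" and j: "j \<in> idx"
    and mem: "up (M * m) (exit_index (M * m) j K) \<in> white (refine R S)"
  shows "\<exists>A b. K = int m * A + b \<and> 0 \<le> b \<and> b \<le> int m - 1 \<and> 0 \<le> A \<and> A \<le> int M - 1 \<and>
    up M (exit_index M j A) \<in> white R \<and> up m (exit_index m j b) \<in> white S"
proof -
  have M: "0 < M" "0 < m" "0 < M * m" using R S by (auto simp: fits_def)
  note sumK = exit_index_sum[OF j, of "M * m" K]
  from mem consider U V where "U \<in> white R" "V \<in> white S"
    "up (M * m) (exit_index (M * m) j K) = tri_comp U V"
    | U V where "U \<in> white' R" "V \<in> yellow' S" "up (M * m) (exit_index (M * m) j K) = tri_comp U V"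
    unfolding refine_products[OF S] products_def by blast
  then show ?thesis
  proof cases
    case 1
    have UV: "U \<in> ups M" "V \<in> ups m" using 1 R S by (auto simp: fits_def)
    obtain a where a: "U = up M a" "\<forall>i\<in>idx. 0 \<le> a i" "a 1 + a 2 + a 3 = int M - 1"
      by (rule upsE[OF UV(1)])
    obtain b where b: "V = up m b" "\<forall>i\<in>idx. 0 \<le> b i" "b 1 + b 2 + b 3 = int m - 1"
      by (rule upsE[OF UV(2)])
    note ab = comp_up_up[OF M(1,2) a(3) b(3)]
    have eq: "exit_index (M * m) j K i = int m * a i + b i" if "i \<in> idx" for i
      using up_inj[of "M * m" "exit_index (M * m) j K"
        "\<lambda>i. int m * a i + b i", OF M(3) sumK ab(2) _ that]
        1(3) ab(1) a(1) b(1) by simp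
    have "0 \<le> a j" "0 \<le> b j" using a(2) b(2) j by blast+
    moreover have "0 = int m * a j + b j" using eq[OF j] by simp
    ultimately have z: "a j = 0" "b j = 0"
      using M(2) mult_nonneg_nonneg[of "int m" "a j"] by (auto simp: add_nonneg_eq_0_iff)
    obtain A where A: "\<forall>i\<in>idx. a i = exit_index M j A i" using exit_index_exists[OF j z(1) a(3)] ..
    obtain B where B: "\<forall>i\<in>idx. b i = exit_index m j B i" using exit_index_exists[OF j z(2) b(3)] ..
    have "K = int m * A + B"
    proof (rule exit_index_inj[OF j])
      fix i :: nat assume "i \<in> idx"
      then show "exit_index (M * m) j K i = exit_index (M * m) j (int m * A + B) i"
        using eq A B by (simp flip: exit_index_comb)
    qed
    moreover have "U = up M (exit_index M j A)" "V = up m (exit_index m j B)"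
      unfolding a(1) b(1) using A B by (auto intro!: up_cong)
    moreover have "0 \<le> A" "A \<le> int M - 1"
      using a(2) A by (intro exit_index_bounds[OF j, of M A]; simp)+
    moreover have "0 \<le> B" "B \<le> int m - 1"
      using b(2) B by (intro exit_index_bounds[OF j, of m B]; simp)+
    ultimately show ?thesis using 1 by blast
  next
    case 2
    have UV: "U \<in> dns M" "V \<in> dns m" using 2 R S by (auto simp: fits_def)
    obtain a where a: "U = dn M a" "\<forall>i\<in>idx. 1 \<le> a i" "a 1 + a 2 + a 3 = int M + 1"
      by (rule dnsE[OF UV(1)])
    obtain b where b: "V = dn m b" "\<forall>i\<in>idx. 1 \<le> b i" "b 1 + b 2 + b 3 = int m + 1"
      by (rule dnsE[OF UV(2)])
    note ab = comp_dn_dn[OF M(1,2) a(3) b(3)]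
    have "exit_index (M * m) j K j = int m * a j - b j"
      using up_inj[of "M * m" "exit_index (M * m) j K"
        "\<lambda>i. int m * a i - b i", OF M(3) sumK ab(2) _ j]
        2(3) ab(1) a(1) b(1) by simp
    moreover have "int m * 1 \<le> int m * a j" using a(2) j by (intro mult_left_mono) auto
    ultimately have False using dns_le[OF b(2,3) j] by simp
    then show ?thesis ..
  qed
qed

lemma exit_at_refine:
  assumes R: "fits M R" and S: "fits m S" and j: "j \<in> idx"
  shows "exit_at (M * m) (refine R S) j K \<longleftrightarrow>
    (\<exists>A b. K = int m * A + b \<and> exit_at M R j A \<and> exit_at m S j b)"
proof
  have M: "0 < M" "0 < m" using R S by (auto simp: fits_def)
  assume ex: "exit_at (M * m) (refine R S) j K"
  obtain A b where A: "K = int m * A + b" "0 \<le> b" "b \<le> int m - 1" "0 \<le> A" "A \<le> int M - 1"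
    "up M (exit_index M j A) \<in> white R" "up m (exit_index m j b) \<in> white S"
    using boundary_digits[OF R S j, of K] ex by (auto simp: exit_at_def)
  have "up (M * m) (exit_index (M * m) j (int (M * m) - 1 - K)) \<in> white (refine (swap_colours R) (swap_colours S))"
    using ex by (simp add: exit_at_def refine_def)
  then obtain A' b' where A': "int (M * m) - 1 - K = int m * A' + b'" "0 \<le> b'" "b' \<le> int m - 1"
    "up M (exit_index M j A') \<in> yellow R" "up m (exit_index m j b') \<in> yellow S"
    using boundary_digits[of M "swap_colours R" m "swap_colours S" j "int (M * m) - 1 - K"] R S j
      by auto
  \<comment> \<open>The white position and its yellow mirror position were decomposed separately.
    Their last digits satisfy \<open>0 < b + b' + 1 < 2 * m\<close>, and this number is a multiple
    of \<open>m\<close>, so it equals \<open>m\<close>: the digits are complementary and no carry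
    occurs.\<close>
  have q: "int m * (int M - A - A') = b + b' + 1" using A(1) A'(1) by (simp add: algebra_simps)
  then have "0 < int m * (int M - A - A')" "int m * (int M - A - A') < int m * 2"
    using A(2,3) A'(2,3) by linarith+
  then have "int M - A - A' = 1" using M(2) by (simp add: zero_less_mult_iff)
  then have "A' = int M - 1 - A" "b' = int m - 1 - b" using q by simp_all
  then show "\<exists>A b. K = int m * A + b \<and> exit_at M R j A \<and> exit_at m S j b"
    using A A' by (intro exI[of _ A] exI[of _ b]) (simp add: exit_at_def)
next
  have M: "0 < M" "0 < m" using R S by (auto simp: fits_def)
  assume "\<exists>A b. K = int m * A + b \<and> exit_at M R j A \<and> exit_at m S j b"
  then obtain A b where K: "K = int m * A + b" and A: "exit_at M R j A" and b: "exit_at m S j b"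
    by blast
  have c: "tri_comp (up M (exit_index M j x)) (up m (exit_index m j y)) =
      up (M * m) (exit_index (M * m) j (int m * x + y))" for x y
    using comp_up_up(1)[of M m "exit_index M j x"
      "exit_index m j y", OF M exit_index_sum[OF j] exit_index_sum[OF j]]
        by (simp add: exit_index_comb)
  have compl: "int (M * m) - 1 - K = int m * (int M - 1 - A) + (int m - 1 - b)"
    using K by (simp add: algebra_simps)
  have "up (M * m) (exit_index (M * m) j K) \<in> white (refine R S)"
    unfolding refine_products[OF S] products_def K c[symmetric] using A b
      by (auto simp: exit_at_def)
  moreover have "up (M * m) (exit_index (M * m) j (int (M * m) - 1 - K)) \<in> yellow (refine R S)"
    unfolding refine_products[OF S] products_def compl c[symmetric] using A b
      by (auto simp: exit_at_def)
  moreover have "0 \<le> int m * A" "0 \<le> int m * (int M - 1 - A)"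
    using A by (auto simp: exit_at_def)
  then have "0 \<le> K" "K \<le> int (M * m) - 1"
    using compl K b by (auto simp: exit_at_def)
  ultimately show "exit_at (M * m) (refine R S) j K" by (simp add: exit_at_def)
qed

text \<open>The numeral consisting of \<open>n\<close> ones in base \<open>m\<close>. An exit
  position all of whose digits are \<open>k\<close> is \<open>k\<close> times this number.\<close>

primrec repunit :: "nat \<Rightarrow> nat \<Rightarrow> int" where
  "repunit m 0 = 0"
| "repunit m (Suc n) = int m * repunit m n + 1"

lemma repunit: "(int m - 1) * repunit m n = int (m ^ n) - 1"
  by (induction n) (simp_all add: algebra_simps)

lemma exits_property_level:
  assumes S: "fits m S" "exits_property m S" and "n \<ge> 1"
  shows "exits_property (m ^ n) (level S n)"
    "j \<in> idx \<Longrightarrow> exit_pos (m ^ n) (level S n) j = repunit m n * exit_pos m S j"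
proof -
  have *: "exit_at (m ^ n) (level S n) j K \<longleftrightarrow> K =
      repunit m n * exit_pos m S j" if j: "j \<in> idx" for j K
    using \<open>n \<ge> 1\<close>
  proof (induction n arbitrary: K rule: nat_induct_at_least)
    case base
    then show ?case using exit_at_exit_pos[OF S(2) j] by simp
  next
    case (Suc n)
    show ?case
      unfolding level_Suc[OF Suc.hyps] power_Suc2 exit_at_refine[OF fits_level[OF S(1) Suc.hyps] S(1) j]
        Suc.IH exit_at_exit_pos[OF S(2) j] by (auto simp: algebra_simps)
  qed
  then show "exits_property (m ^ n) (level S n)" by (rule exits_propertyI)
  then show "j \<in> idx \<Longrightarrow> exit_pos (m ^ n) (level S n) j = repunit m n * exit_pos m S j"
    using * exit_at_exit_pos by blast
qed

text \<open>The limit of the exits in closed form: the expansion with constant digit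
  \<open>k\<close> in base \<open>m\<close> has the value \<open>k / (m - 1)\<close>.\<close>

definition exit_pt :: "nat \<Rightarrow> patterns_system \<Rightarrow> nat \<Rightarrow> point" where
  "exit_pt m S j = (let a = (\<lambda>i. real_of_int (exit_index m j (exit_pos m S j) i) / (real m - 1))
     in a 1 *\<^sub>R P1 + a 2 *\<^sub>R P2 + a 3 *\<^sub>R P3)"

lemma bc_exit_pt:
  assumes "m \<ge> 2" "i \<in> idx" "j \<in> idx"
  shows "bc i (exit_pt m S j) = real_of_int (exit_index m j (exit_pos m S j) i) / (real m - 1)"
proof -
  let ?e = "exit_index m j (exit_pos m S j)"
  have "real_of_int (?e 1) + real_of_int (?e 2) + real_of_int (?e 3) = real m - 1"
    using exit_index_sum[OF assms(3), of m "exit_pos m S j"] by linarith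
  then have "?e 1 / (real m - 1) + ?e 2 / (real m - 1) + ?e 3 / (real m - 1) = 1"
    using assms(1) by (simp only: add_divide_distrib[symmetric]) simp
  from bc_comb[OF this] show ?thesis using assms(2) by (auto simp: exit_pt_def Let_def)
qed

lemma labyrinthD:
  assumes "labyrinth_patterns_system m S"
  shows "m \<ge> 2" "fits m S" "exits_property m S"
  using assms by (auto simp: labyrinth_patterns_system_def triangular_patterns_system_def
      intro: triangular_patterns_system_fits)

lemma labyrinth_swap:
  assumes "labyrinth_patterns_system m S" shows "labyrinth_patterns_system m (swap_colours S)"
  using assms exits_property_swap(1)[OF labyrinthD(3)[OF assms]]
  unfolding labyrinth_patterns_system_def triangular_patterns_system_def tree_property_def corners_property_def
  by (simp add: Int_commute)

lemma exit_index_repunit: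
  "exit_index (m ^ n) j (repunit m n * k) i = repunit m n * exit_index m j k i"
  using repunit[of m n] by (simp add: exit_index_def algebra_simps)

lemma exit_at_exit_pos_self: "exits_property M R \<Longrightarrow> j \<in> idx \<Longrightarrow> exit_at M R j (exit_pos M R j)"
  by (simp only: exit_at_exit_pos)

lemma exit_index_nonneg:
  "exit_at M R j k \<Longrightarrow> 0 \<le> exit_index M j k i"
  by (auto simp: exit_at_def exit_index_def)

lemma exit_pt_T1:
  assumes "m \<ge> 2" "exits_property m S" "j \<in> idx" shows "exit_pt m S j \<in> T1"
proof -
  have "0 \<le> bc i (exit_pt m S j)" if "i \<in> idx" for i
    unfolding bc_exit_pt[OF assms(1) that assms(3)]
    using exit_index_nonneg[OF exit_at_exit_pos_self[OF assms(2,3)], of i] assms(1) by simp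
  then show ?thesis unfolding T1_def by blast
qed

text \<open>Prepending further equal digits does not change a constant expansion, so the point is
  fixed by its exit map of every order.\<close>

lemma amap_exit_pt:
  assumes m: "m \<ge> 2" and j: "j \<in> idx"
  shows "amap (up (m ^ n) (exit_index (m ^ n) j (repunit m n * exit_pos m S j))) (exit_pt m S j) =
      exit_pt m S j"
proof (rule bc_eqI)
  fix i :: nat assume i: "i \<in> idx"
  let ?v = "exit_index m j (exit_pos m S j) i" and ?X = "exit_pt m S j"
  have M: "0 < m ^ n" using m by simp
  have "real_of_int (int m - 1) * real_of_int (repunit m n) = real_of_int (int (m ^ n) - 1)"
    using repunit[of m n] by (metis of_int_mult)
  then have rep: "(real m - 1) * real_of_int (repunit m n) = real (m ^ n) - 1" by simp
  have "bc i (amap (up (m ^ n) (exit_index (m ^ n) j (repunit m n * exit_pos m S j))) ?X)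
      = (real_of_int (repunit m n) * real_of_int ?v + real_of_int ?v / (real m - 1)) / real (m ^ n)"
    unfolding bc_amap_up[OF M exit_index_sum[OF j] i] exit_index_repunit bc_exit_pt[OF m i j]
      by simp
  also have "real_of_int (repunit m n) * real_of_int ?v + real_of_int ?v / (real m - 1)
      = ((real m - 1) * real_of_int (repunit m n) + 1) * (real_of_int ?v / (real m - 1))"
    using m by (simp add: field_simps)
  also have "\<dots> / real (m ^ n) = real_of_int ?v / (real m - 1)" unfolding rep using M by simp
  finally show "bc i (amap (up (m ^ n) (exit_index (m ^ n) j (repunit m n * exit_pos m S j))) ?X) =
      bc i ?X"
    unfolding bc_exit_pt[OF m i j] .
qed

lemma T1_bounded: obtains D where "\<And>p q. p \<in> T1 \<Longrightarrow> q \<in> T1 \<Longrightarrow> dist p q \<le> D"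
  using compact_imp_bounded[OF compact_T1] bounded_two_points[of T1] by metis

lemma eq_of_dist_le_powers:
  fixes x y :: "'a::metric_space"
  assumes "m \<ge> 2" "\<And>n. n \<ge> 1 \<Longrightarrow> dist x y \<le> D / real m ^ n"
  shows "x = y"
proof (rule ccontr)
  assume "x \<noteq> y"
  have "(\<lambda>n. D * (1 / real m) ^ n) \<longlonglongrightarrow> 0"
    using assms(1) by (intro tendsto_mult_right_zero LIMSEQ_power_zero) auto
  then have "dist x y \<le> 0"
  proof (rule tendsto_lowerbound)
    show "\<forall>\<^sub>F n in sequentially. dist x y \<le> D * (1 / real m) ^ n"
      using eventually_ge_at_top[of 1]
        by eventually_elim (use assms(2) in \<open>simp add: power_one_over\<close>)
  qed simp
  then show False using \<open>x \<noteq> y\<close> by simp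
qed

lemma exit_region:
  assumes lab: "labyrinth_patterns_system m S" and j: "j \<in> idx" and n: "n \<ge> 1"
  shows "exit_pt m S j \<in> region (white_exit (m ^ n) (level S n) j)"
    "white_exit (m ^ n) (level S n) j \<in> white (level S n)"
    "\<exists>k. white_exit (m ^ n) (level S n) j = up (m ^ n) k"
proof -
  note m = labyrinthD[OF lab] and lev = exits_property_level[OF labyrinthD(2,3)[OF lab] n]
  have eq: "white_exit (m ^ n) (level S n) j =
      up (m ^ n) (exit_index (m ^ n) j (repunit m n * exit_pos m S j))"
    unfolding exit_triangles(1)[OF lev(1) j] lev(2)[OF j] ..
  then show "\<exists>k. white_exit (m ^ n) (level S n) j = up (m ^ n) k" by blast
  show "exit_pt m S j \<in> region (white_exit (m ^ n) (level S n) j)"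
    unfolding eq region_amap using amap_exit_pt[OF m(1) j] exit_pt_T1[OF m(1,3) j]
      by (metis image_eqI)
  show "white_exit (m ^ n) (level S n) j \<in> white (level S n)"
    using exit_at_exit_pos_self[OF lev(1) j] unfolding exit_triangles(1)[OF lev(1) j] exit_at_def
      by blast
qed

lemma white_exit_point_eq:
  assumes lab: "labyrinth_patterns_system m S" and j: "j \<in> idx"
  shows "white_exit_point m S j = exit_pt m S j"
proof -
  note m = labyrinthD[OF lab]
  obtain D where D: "\<And>p q. p \<in> T1 \<Longrightarrow> q \<in> T1 \<Longrightarrow> dist p q \<le> D" using T1_bounded by blast
  have "x = exit_pt m S j" if x: "\<And>n. n \<ge> 1 \<Longrightarrow> x \<in> region (white_exit (m ^ n) (level S n) j)" for x
  proof (rule eq_of_dist_le_powers[OF m(1)])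
    fix n :: nat assume n: "n \<ge> 1"
    obtain k where k: "white_exit (m ^ n) (level S n) j = up (m ^ n) k"
      using exit_region(3)[OF lab j n] ..
    obtain p where p: "p \<in> T1" "x = amap (up (m ^ n) k) p" using x[OF n] unfolding k region_amap
      by blast
    obtain q where q: "q \<in> T1" "exit_pt m S j = amap (up (m ^ n) k) q"
      using exit_region(1)[OF lab j n] unfolding k region_amap by blast
    have "dist x (exit_pt m S j) = 1 / real (m ^ n) * dist p q" unfolding p(2) q(2)
      by (rule dist_amap_up)
    also have "\<dots> \<le> 1 / real (m ^ n) * D" using D[OF p(1) q(1)] by (intro mult_left_mono) auto
    finally show "dist x (exit_pt m S j) \<le> D / real m ^ n" by simp
  qed
  then have eq: "(\<Inter>n\<in>{1..}. region (white_exit (m ^ n) (level S n) j)) = {exit_pt m S j}"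
    using exit_region(1)[OF lab j] by auto
  show ?thesis unfolding white_exit_point_def eq by simp
qed

lemma exit_pt_in_fractal:
  assumes lab: "labyrinth_patterns_system m S" and j: "j \<in> idx"
  shows "exit_pt m S j \<in> white_fractal S"
  using exit_region(1,2)[OF lab j] unfolding white_fractal_def white_set_def by auto

lemma bc_exit_pt_swap:
  assumes lab: "labyrinth_patterns_system m S" and i: "i \<in> idx" and j: "j \<in> idx"
  shows "bc i (exit_pt m (swap_colours S) j) = (if i = j then 0 else 1 - bc i (exit_pt m S j))"
proof -
  have "exit_index m j (int m - 1 - k) i = (if i =
      j then 0 else int m - 1 - exit_index m j k i)" for k
    by (simp add: exit_index_def)
  then show ?thesis
    using labyrinthD(1)[OF lab]
    unfolding bc_exit_pt[OF labyrinthD(1)[OF lab] i j] exits_property_swap(2)[OF labyrinthD(3)[OF lab] j]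
    by (simp add: diff_divide_distrib)
qed

lemma yellow_exit_point_eq:
  assumes lab: "labyrinth_patterns_system m S" and j: "j \<in> idx"
  shows "yellow_exit_point m S j = white_exit_point m (swap_colours S) j"
proof -
  have "yellow_exit (m ^ n) (level S n) j =
      white_exit (m ^ n) (level (swap_colours S) n) j" if n: "n \<ge> 1" for n
  proof -
    note lev = exits_property_level(1)[OF labyrinthD(2,3)[OF lab] n]
    show ?thesis
      unfolding level_swap[OF n] exit_triangles(2)[OF lev j] exit_triangles(1)[OF exits_property_swap(1)[OF lev] j]
        exits_property_swap(2)[OF lev j] ..
  qed
  then have "(\<Inter>n\<in>{1..}. region (yellow_exit (m ^ n) (level S n) j))
      = (\<Inter>n\<in>{1..}. region (white_exit (m ^ n) (level (swap_colours S) n) j))" by simp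
  then show ?thesis unfolding yellow_exit_point_def white_exit_point_def by simp
qed

text \<open>The differences lie in -1, 0, 1 and add up to 0. If they are not all zero, both 1 and -1
  occur, and each is possible only for extreme values of the coordinates.\<close>

lemma integral_difference_corners:
  assumes p: "p \<in> T1" and q: "q \<in> T1" and d: "\<And>i. i \<in> idx \<Longrightarrow> bc i p - bc i q = real_of_int (d i)"
    and "p \<noteq> q"
  shows "\<exists>i\<in>idx. \<exists>j\<in>idx. i \<noteq> j \<and> p = corner i \<and> q = corner j"
proof -
  have b: "d i \<le> 1" "-1 \<le> d i" if "i \<in> idx" for i
    using d[OF that] bc_nonneg[OF p that] bc_nonneg[OF q that] bc_le_1[OF p that] bc_le_1[OF q that]
      by linarith+
  have "real_of_int (d 1) + real_of_int (d 2) + real_of_int (d 3) = 0"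
    using d[of 1] d[of 2] d[of 3] bc_sum[of p] bc_sum[of q] by simp
  then have s: "d 1 + d 2 + d 3 = 0" by linarith
  have nz: "\<not> (d 1 = 0 \<and> d 2 = 0 \<and> d 3 = 0)"
  proof
    assume "d 1 = 0 \<and> d 2 = 0 \<and> d 3 = 0"
    then have "bc i p = bc i q" if "i \<in> idx" for i using d[OF that] that by auto
    then show False using bc_eqI \<open>p \<noteq> q\<close> by blast
  qed
  have le: "d 1 \<le> 1" "d 2 \<le> 1" "d 3 \<le> 1" and ge: "-1 \<le> d 1" "-1 \<le> d 2" "-1 \<le> d 3"
    using b by blast+
  have "d 1 = 1 \<or> d 2 = 1 \<or> d 3 = 1" using s nz le by presburger
  then have "\<exists>i\<in>idx. d i = 1" by blast
  then obtain i where i: "i \<in> idx" "d i = 1" by blast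
  have "d 1 = -1 \<or> d 2 = -1 \<or> d 3 = -1" using s nz ge by presburger
  then have "\<exists>j\<in>idx. d j = -1" by blast
  then obtain j where j: "j \<in> idx" "d j = -1" by blast
  have "bc i p = 1" using d[OF i(1)] i(2) bc_nonneg[OF q i(1)] bc_le_1[OF p i(1)] by simp
  moreover have "bc j q = 1" using d[OF j(1)] j(2) bc_nonneg[OF p j(1)] bc_le_1[OF q j(1)] by simp
  ultimately have "p = corner i" "q = corner j" using corner_eqI p q i(1) j(1) by simp_all
  then show ?thesis using i j by (metis one_neq_neg_one)
qed

text \<open>Three nonnegative integers with sum 2 are 2, 0, 0 or 1, 1, 0 in some order: contact at a
  corner, or across the side opposite to the \<open>j\<close>-th corner.\<close>

lemma integral_sum_cases:
  assumes p: "p \<in> T1" and q: "q \<in> T1" and d: "\<And>i. i \<in> idx \<Longrightarrow> bc i p + bc i q = real_of_int (d i)"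
  obtains i where "i \<in> idx" "p = corner i" "q = corner i"
    | j where "j \<in> idx" "\<And>i. i \<in> idx \<Longrightarrow> d i = (if i = j then 0 else 1)"
proof -
  have b: "d i \<le> 2" "0 \<le> d i" if "i \<in> idx" for i
    using d[OF that] bc_nonneg[OF p that] bc_nonneg[OF q that] bc_le_1[OF p that] bc_le_1[OF q that]
      by linarith+
  have "real_of_int (d 1) + real_of_int (d 2) + real_of_int (d 3) = 2"
    using d[of 1] d[of 2] d[of 3] bc_sum[of p] bc_sum[of q] by simp
  then have s: "d 1 + d 2 + d 3 = 2" by linarith
  show thesis
  proof (cases "\<exists>i\<in>idx. d i = 2")
    case True
    then obtain i where i: "i \<in> idx" "d i = 2" by blast
    have "bc i p = 1" "bc i q = 1"
      using d[OF i(1)] i(2) bc_le_1[OF p i(1)] bc_le_1[OF q i(1)] by simp_all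
    then show thesis using that(1) corner_eqI p q i(1) by metis
  next
    case False
    then have b': "d i = 0 \<or> d i = 1" if "i \<in> idx" for i using b[OF that] that by force
    have "\<exists>j\<in>idx. d j = 0"
    proof (rule ccontr)
      assume "\<not> ?thesis"
      then have "d i = 1" if "i \<in> idx" for i using b'[OF that] that by blast
      then show False using s by simp
    qed
    then obtain j where j: "j \<in> idx" "d j = 0" by blast
    have "d i = (if i = j then 0 else 1)" if "i \<in> idx" for i
      using j that s b'[of 1] b'[of 2] b'[of 3] by auto
    then show thesis using that(2)[OF j(1)] by blast
  qed
qed

subsection \<open>Contacts between pieces\<close>

lemma mult_bc_up:
  "m > 0 \<Longrightarrow> k 1 + k 2 + k 3 = int m - 1 \<Longrightarrow> i \<in> idx \<Longrightarrow>
    real m * bc i (amap (up m k) p) = real_of_int (k i) + bc i p"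
  by (simp only: bc_amap_up) simp

lemma mult_bc_dn:
  "m > 0 \<Longrightarrow> l 1 + l 2 + l 3 = int m + 1 \<Longrightarrow> i \<in> idx \<Longrightarrow>
    real m * bc i (amap (dn m l) p) = real_of_int (l i) - bc i p"
  by (simp only: bc_amap_dn) simp

lemma piece_cases:
  assumes "fits m S" "U \<in> pieces S"
  obtains "U \<in> white S" "U \<in> ups m" "carried S U = S"
    | "U \<in> white' S" "U \<in> dns m" "carried S U = swap_colours S"
proof (cases "U \<in> white S")
  case True
  then show thesis using that(1) carried_white[OF assms(1)] assms(1) by (metis fits_def subsetD)
next
  case False
  then have "U \<in> white' S" using assms(2) by (simp add: pieces_def)
  moreover have "U \<in> dns m" using calculation assms(1) by (metis fits_def subsetD)
  ultimately show thesis using that(2) by (simp add: carried_def)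
qed

text \<open>The corners property concerns upright triangles of order one only. It reaches the
  fractal because inverted triangles avoid the corners, and an upright triangle containing a corner
  is determined by it.\<close>

lemma corner_triangle:
  assumes lab: "labyrinth_patterns_system m S" and i: "i \<in> idx" and "corner i \<in> white_fractal S"
  shows "up m (\<lambda>h. if h = i then int m - 1 else 0) \<in> corner_triangles (white S)"
proof -
  note S = labyrinthD[OF lab]
  have m: "m > 0" using S(1) by simp
  have "corner i \<in> white_set S (Suc 0)" using assms(3) by (auto simp: white_fractal_def)
  then obtain U p where U: "U \<in> pieces S" "p \<in> T1" "corner i = amap U p" unfolding white_set_1
    by blast
  have ci: "bc i (corner i) = 1" using bc_corner[OF i i] by simp
  have "U \<notin> white' S"
  proof
    assume "U \<in> white' S"
    then have "U \<in> dns m" using S(2) by (auto simp: fits_def)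
    then obtain l where l: "U = dn m l" "\<forall>i\<in>idx. 1 \<le> l i" "l 1 + l 2 + l 3 = int m + 1"
      by (rule dnsE)
    have "real m = real_of_int (l i) - bc i p"
      using mult_bc_dn[OF m l(3) i, of p] ci unfolding U(3) l(1) by simp
    then show False using dns_le[OF l(2,3) i] bc_nonneg[OF U(2) i] by linarith
  qed
  then have Uw: "U \<in> white S" using U(1) by (simp add: pieces_def)
  then have "U \<in> ups m" using S(2) by (auto simp: fits_def)
  then obtain k where k: "U = up m k" "\<forall>i\<in>idx. 0 \<le> k i" "k 1 + k 2 + k 3 = int m - 1" by (rule upsE)
  have "real m = real_of_int (k i) + bc i p"
    using mult_bc_up[OF m k(3) i, of p] ci unfolding U(3) k(1) by simp
  then have "int m - 1 \<le> k i" using bc_le_1[OF U(2) i] by linarith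
  then have "k h = (if h = i then int m - 1 else 0)" if "h \<in> idx" for h
    using k(2,3) i that ups_nonneg_le[OF k(2,3) i] by auto
  then have "U = up m (\<lambda>h. if h = i then int m - 1 else 0)" unfolding k(1) by (rule up_cong)
  moreover have "corner i \<in> region U" unfolding region_amap using U(2,3) by blast
  then have "U \<in> corner_triangles (white S)"
    using Uw i unfolding corner_triangles_def corner_def by auto
  ultimately show ?thesis by simp
qed

lemma corner_unique:
  assumes lab: "labyrinth_patterns_system m S" and ij: "i \<in> idx" "j \<in> idx"
    and "corner i \<in> white_fractal S" "corner j \<in> white_fractal S"
  shows "i = j"
proof (rule ccontr)
  assume "i \<noteq> j"
  let ?k = "\<lambda>i h. if h = i then int m - 1 else 0"
  have m: "m \<ge> 2" "m > 0" using labyrinthD(1)[OF lab] by simp_all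
  have "up m (?k i) = up m (?k j)"
    using corner_triangle[OF lab ij(1) assms(4)] corner_triangle[OF lab ij(2) assms(5)] lab
    unfolding labyrinth_patterns_system_def corners_property_def by blast
  moreover have "?k h 1 + ?k h 2 + ?k h 3 = int m - 1" if "h \<in> idx" for h using that by auto
  ultimately have "?k i i = ?k j i"
    using up_inj[of m "?k i" "?k j" i] m(2) ij by blast
  then show False using \<open>i \<noteq> j\<close> m(1) by simp
qed

lemma corner_not_both:
  assumes lab: "labyrinth_patterns_system m S" and i: "i \<in> idx"
    and "corner i \<in> white_fractal S" "corner i \<in> white_fractal (swap_colours S)"
  shows False
  using corner_triangle[OF lab i assms(3)] corner_triangle[OF labyrinth_swap[OF lab] i assms(4)] lab
  unfolding labyrinth_patterns_system_def corners_property_def swap_colours_sel by blast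

text \<open>Excludes contacts of pieces with equal orientation: they would put two different corners
  into one fractal.\<close>

lemma same_fractal_eq:
  assumes lab: "labyrinth_patterns_system m S" and p: "p \<in> white_fractal S"
    and q: "q \<in> white_fractal S"
    and d: "\<And>i. i \<in> idx \<Longrightarrow> bc i p - bc i q = real_of_int (d i)"
  shows "p = q"
proof (rule ccontr)
  assume "p \<noteq> q"
  have "p \<in> T1" "q \<in> T1" using white_fractal_T1[OF labyrinthD(2)[OF lab]] p q by blast+
  then obtain i j where "i \<in> idx" "j \<in> idx" "i \<noteq> j" "p = corner i" "q = corner j"
    using integral_difference_corners[of p q d] d \<open>p \<noteq> q\<close> by blast
  then show False using corner_unique[OF lab] p q by blast
qed

text \<open>For pieces of opposite orientation, contact at a vertex would put the same corner into
  both colours; only contact across a side remains.\<close>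

lemma opposite_fractals_sum:
  assumes lab: "labyrinth_patterns_system m S" and p: "p \<in> white_fractal S"
    and q: "q \<in> white_fractal (swap_colours S)"
    and d: "\<And>i. i \<in> idx \<Longrightarrow> bc i p + bc i q = real_of_int (d i)"
  obtains j where "j \<in> idx" "\<And>i. i \<in> idx \<Longrightarrow> d i = (if i = j then 0 else 1)"
proof -
  have T: "p \<in> T1" "q \<in> T1"
    using white_fractal_T1[OF labyrinthD(2)[OF lab]]
      white_fractal_T1[OF labyrinthD(2)[OF labyrinth_swap[OF lab]]] p q by blast+
  show thesis
    by (rule integral_sum_cases[OF T d]) (use corner_not_both[OF lab] p q that in blast)+
qed

text \<open>The four cases are the combinations of an upright or inverted piece on either side; only the
  pair of mutually reflected upright exit pieces can meet.\<close>

lemma mirror_step: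
  assumes lab: "labyrinth_patterns_system m S" and j: "j \<in> idx"
    and p: "p \<in> white_fractal S" and p': "p' \<in> white_fractal (swap_colours S)"
    and sum: "\<And>i. i \<in> idx \<Longrightarrow> bc i p + bc i p' = (if i = j then 0 else 1)"
  shows "\<exists>b\<in>white_fractal S. \<exists>b'\<in>white_fractal (swap_colours S).
    p = amap (up m (exit_index m j (exit_pos m S j))) b \<and>
    (\<forall>i\<in>idx. bc i b + bc i b' = (if i = j then 0 else 1))"
proof -
  note S = labyrinthD[OF lab] and lab' = labyrinth_swap[OF lab]
  have m: "m > 0" using S(1) by simp
  \<comment> \<open>The scaled coordinate sum is integral, so removing the indices of the two pieces
    leaves an integral relation between the inner points \<open>b\<close> and
    \<open>b'\<close>.\<close>
  define \<delta> where "\<delta> i = (if i = j then 0 else int m)" for i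
  have sum_m: "real m * bc i p + real m * bc i p' = real_of_int (\<delta> i)" if "i \<in> idx" for i
    using sum[OF that] unfolding \<delta>_def by (simp flip: distrib_left)
  have \<delta>j: "\<delta> j = 0" by (simp add: \<delta>_def)
  obtain U b where U: "U \<in> pieces S" "b \<in> white_fractal (carried S U)" "p = amap U b"
    using p white_fractal_eq[OF S(2)] by blast
  obtain U' b' where U': "U' \<in> pieces (swap_colours S)"
    "b' \<in> white_fractal (carried (swap_colours S) U')" "p' = amap U' b'"
    using p' white_fractal_eq[of m "swap_colours S"] S(2)
      by (metis (no_types, lifting) UN_E fits_swap imageE)
  consider (up) "U \<in> white S" "U \<in> ups m" "b \<in> white_fractal S"
    | (dn) "U \<in> white' S" "U \<in> dns m" "b \<in> white_fractal (swap_colours S)"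
    using U(2) by (cases rule: piece_cases[OF S(2) U(1)]) simp_all
  note U_cases = this
  consider (up) "U' \<in> yellow S" "U' \<in> ups m" "b' \<in> white_fractal (swap_colours S)"
    | (dn) "U' \<in> yellow' S" "U' \<in> dns m" "b' \<in> white_fractal S"
    using U'(2) by (cases rule: piece_cases[OF labyrinthD(2)[OF lab'] U'(1)]) simp_all
  note U'_cases = this
  show ?thesis
  proof (cases rule: U_cases)
    case up
    note Uup = up
    obtain k where k: "U = up m k" "\<forall>i\<in>idx. 0 \<le> k i" "k 1 + k 2 + k 3 = int m - 1"
      using up(2) by (rule upsE)
    have pk: "real m * bc i p = real_of_int (k i) + bc i b" if "i \<in> idx" for i
      unfolding U(3) k(1) by (rule mult_bc_up[OF m k(3) that])
    show ?thesis
    proof (cases rule: U'_cases)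
      case up
      obtain k' where k': "U' = up m k'" "\<forall>i\<in>idx. 0 \<le> k' i" "k' 1 + k' 2 + k' 3 = int m - 1"
        using up(2) by (rule upsE)
      have pk': "real m * bc i p' = real_of_int (k' i) + bc i b'" if "i \<in> idx" for i
        unfolding U'(3) k'(1) by (rule mult_bc_up[OF m k'(3) that])
      have d: "bc i b + bc i b' = real_of_int (\<delta> i - k i - k' i)" if "i \<in> idx" for i
        using sum_m[OF that] pk[OF that] pk'[OF that] by simp
      obtain h where h: "h \<in> idx" "\<And>i. i \<in> idx \<Longrightarrow> \<delta> i - k i - k' i = (if i = h then 0 else 1)"
        using opposite_fractals_sum[OF lab Uup(3) up(3) d] by blast
      \<comment> \<open>At \<open>j\<close> the indices are nonnegative and
        \<open>\<delta> j\<close> is 0, so the remainder there cannot be 1; the inner contact is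
        across the same side.\<close>
      have nn: "0 \<le> k j" "0 \<le> k' j" using k(2) k'(2) j by blast+
      then have hj: "h = j" using h(2)[OF j] \<delta>j by (auto split: if_splits)
      then have z: "k j = 0" "k' j = 0" using h(2)[OF j] \<delta>j nn by simp_all
      obtain \<kappa> where \<kappa>: "\<forall>i\<in>idx. k i = exit_index m j \<kappa> i"
        using exit_index_exists[OF j z(1) k(3)] ..
      \<comment> \<open>Off \<open>j\<close> the relation reads \<open>k i + k' i = m - 1\<close>,
        so \<open>U'\<close> is the mirror image of \<open>U\<close> along the side. The two form an
        admissible pair, and uniqueness of the exit identifies \<open>\<kappa>\<close>.\<close>
      have "k' i = exit_index m j (int m - 1 - \<kappa>) i" if "i \<in> idx" for i
        using h(2)[OF that] bspec[OF \<kappa> that] z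
          by (auto simp: hj \<delta>_def exit_index_def split: if_splits)
      then have "U' = up m (exit_index m j (int m - 1 - \<kappa>))" unfolding k'(1) by (rule up_cong)
      moreover have Uk: "U = up m (exit_index m j \<kappa>)" unfolding k(1) using \<kappa>
        by (intro up_cong) blast
      moreover have "0 \<le> \<kappa>" "\<kappa> \<le> int m - 1"
        using k(2) \<kappa> by (intro exit_index_bounds[OF j, of m \<kappa>]; simp)+
      ultimately have "exit_at m S j \<kappa>" using Uup(1) up(1) by (simp add: exit_at_def)
      then have "\<kappa> = exit_pos m S j" using exit_at_exit_pos[OF S(3) j] by blast
      then have "p = amap (up m (exit_index m j (exit_pos m S j))) b" using U(3) Uk by simp
      moreover have "bc i b + bc i b' = (if i = j then 0 else 1)" if "i \<in> idx" for i
        using d[OF that] h(2)[OF that] hj by simp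
      ultimately show ?thesis using Uup(3) up(3) by blast
    next
      case dn
      obtain l where l: "U' = dn m l" "\<forall>i\<in>idx. 1 \<le> l i" "l 1 + l 2 + l 3 = int m + 1"
        using dn(2) by (rule dnsE)
      have pl: "real m * bc i p' = real_of_int (l i) - bc i b'" if "i \<in> idx" for i
        unfolding U'(3) l(1) by (rule mult_bc_dn[OF m l(3) that])
      have d: "bc i b - bc i b' = real_of_int (\<delta> i - k i - l i)" if "i \<in> idx" for i
        using sum_m[OF that] pk[OF that] pl[OF that] by simp
      have "b = b'" using same_fractal_eq[OF lab up(3) dn(3) d] .
      then have "\<delta> j - k j - l j = 0" using d[OF j] by simp
      moreover have "0 \<le> k j" "1 \<le> l j" using k(2) l(2) j by blast+
      ultimately show ?thesis using \<delta>j by simp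
    qed
  next
    case dn
    note Udn = dn
    obtain l where l: "U = dn m l" "\<forall>i\<in>idx. 1 \<le> l i" "l 1 + l 2 + l 3 = int m + 1"
      using dn(2) by (rule dnsE)
    have pl: "real m * bc i p = real_of_int (l i) - bc i b" if "i \<in> idx" for i
      unfolding U(3) l(1) by (rule mult_bc_dn[OF m l(3) that])
    have lj: "1 \<le> l j" using l(2) j by blast
    show ?thesis
    proof (cases rule: U'_cases)
      case up
      obtain k where k: "U' = up m k" "\<forall>i\<in>idx. 0 \<le> k i" "k 1 + k 2 + k 3 = int m - 1"
        using up(2) by (rule upsE)
      have pk: "real m * bc i p' = real_of_int (k i) + bc i b'" if "i \<in> idx" for i
        unfolding U'(3) k(1) by (rule mult_bc_up[OF m k(3) that])
      have d: "bc i b' - bc i b = real_of_int (\<delta> i - k i - l i)" if "i \<in> idx" for i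
        using sum_m[OF that] pk[OF that] pl[OF that] by simp
      have "b' = b" using same_fractal_eq[OF lab' up(3) Udn(3) d] .
      then have "\<delta> j - k j - l j = 0" using d[OF j] by simp
      moreover have "0 \<le> k j" using k(2) j by blast
      ultimately show ?thesis using \<delta>j lj by simp
    next
      case dn
      obtain l' where l': "U' = dn m l'" "\<forall>i\<in>idx. 1 \<le> l' i" "l' 1 + l' 2 + l' 3 = int m + 1"
        using dn(2) by (rule dnsE)
      have pl': "real m * bc i p' = real_of_int (l' i) - bc i b'" if "i \<in> idx" for i
        unfolding U'(3) l'(1) by (rule mult_bc_dn[OF m l'(3) that])
      have d: "bc i b' + bc i b = real_of_int (l i + l' i - \<delta> i)" if "i \<in> idx" for i
        using sum_m[OF that] pl[OF that] pl'[OF that] by simp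
      obtain h where h: "h \<in> idx" "\<And>i. i \<in> idx \<Longrightarrow> l i + l' i - \<delta> i = (if i = h then 0 else 1)"
        using opposite_fractals_sum[OF lab dn(3) Udn(3) d] by blast
      have "1 \<le> l' j" using l'(2) j by blast
      then show ?thesis using h(2)[OF j] \<delta>j lj by (auto split: if_splits)
    qed
  qed
qed

text \<open>The inner points satisfy the same relation again, so the step can be repeated at every
  order with the same contraction, whose fixed point is the exit.\<close>

lemma mirror_meet:
  assumes lab: "labyrinth_patterns_system m S" and j: "j \<in> idx"
    and p: "p \<in> white_fractal S" and p': "p' \<in> white_fractal (swap_colours S)"
    and sum: "\<And>i. i \<in> idx \<Longrightarrow> bc i p + bc i p' = (if i = j then 0 else 1)"
  shows "p = exit_pt m S j"
proof -
  note S = labyrinthD[OF lab]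
  obtain D where D: "\<And>p q. p \<in> T1 \<Longrightarrow> q \<in> T1 \<Longrightarrow> dist p q \<le> D" using T1_bounded by blast
  have fixed: "amap (up m (exit_index m j (exit_pos m S j))) (exit_pt m S j) = exit_pt m S j"
    using amap_exit_pt[OF S(1) j, of 1 S] by simp
  have "dist p (exit_pt m S j) \<le> D / real m ^ n" for n
    using p p' sum
  proof (induction n arbitrary: p p')
    case 0
    have "p \<in> T1" using white_fractal_T1[OF S(2)] 0(1) by blast
    then show ?case using D[OF _ exit_pt_T1[OF S(1,3) j]] by simp
  next
    case (Suc n)
    obtain b b' where b: "b \<in> white_fractal S" "b' \<in> white_fractal (swap_colours S)"
      "p = amap (up m (exit_index m j (exit_pos m S j))) b"
      "\<forall>i\<in>idx. bc i b + bc i b' = (if i = j then 0 else 1)"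
      using mirror_step[OF lab j Suc.prems] by blast
    have "dist p (exit_pt m S j) = 1 / real m * dist b (exit_pt m S j)"
      unfolding b(3) using dist_amap_up[of m _ b "exit_pt m S j"] fixed by metis
    also have "\<dots> \<le> 1 / real m * (D / real m ^ n)"
      using Suc.IH[OF b(1,2) bspec[OF b(4)]] by (intro mult_left_mono) auto
    finally show ?case by simp
  qed
  then show ?thesis by (rule eq_of_dist_le_powers[OF S(1)])
qed

section \<open>Adjacency of pieces and their common points\<close>

lemma neighbours_coordinates:
  assumes S: "fits m S" "m \<ge> 2" and nb: "neighbours m j U U'" and U: "U \<in> pieces S" "U' \<in> pieces S"
  obtains k l where "j \<in> idx" "U = up m k" "k 1 + k 2 + k 3 = int m - 1" "U' = dn m l"
    "l 1 + l 2 + l 3 = int m + 1" "\<And>i. i \<in> idx \<Longrightarrow> l i = k i + (if i = j then 0 else 1)"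
    "U \<in> white S" "U' \<in> white' S"
proof -
  obtain k1 k2 k3 :: nat where j: "j \<in> idx" and sum: "k1 + k2 + k3 = m - 2"
    and U': "U' = tri_T' m (int k1) (int k2) (int k3)"
    and UU: "U = tri_T m (int k1 + (if j = 1 then 1 else 0)) (int k2 + (if j = 2 then 1 else 0))
                    (int k3 + (if j = 3 then 1 else 0))"
    using nb unfolding neighbours_def by blast
  define v where "v i = (if i = (1::nat) then int k1 else if i = 2 then int k2 else int k3)" for i
  define k where "k i = v i + (if i = j then 1 else 0)" for i
  define l where "l i = v i + 1" for i
  have s: "int k1 + int k2 + int k3 = int m - 2" using sum S(2) by linarith
  have k: "U = up m k" "k 1 + k 2 + k 3 = int m - 1" "\<And>i. 0 \<le> k i"
    using UU s j by (auto simp: up_def k_def v_def)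
  have l: "U' = dn m l" "l 1 + l 2 + l 3 = int m + 1" "\<And>i. 1 \<le> l i"
    using U' s by (auto simp: dn_def l_def v_def)
  have "U \<in> ups m" "U' \<in> dns m" unfolding k(1) l(1) using k(2,3) l(2,3) by (auto intro: upsI dnsI)
  then have "U \<notin> dns m" "U' \<notin> ups m" using ups_dns_disjoint[of m] S(2) by auto
  then have "U \<in> white S" "U' \<in> white' S" using U S(1) by (auto simp: pieces_def fits_def)
  then show thesis using that[OF j k(1,2) l(1,2)] by (simp add: k_def l_def)
qed

lemma neighbours_meet:
  assumes lab: "labyrinth_patterns_system m S" and nb: "neighbours m j U U'"
    and U: "U \<in> pieces S" "U' \<in> pieces S"
  shows "j \<in> idx" "carried S U = S" "carried S U' = swap_colours S"
    "amap U ` white_fractal S \<inter> amap U' ` white_fractal (swap_colours S) = {amap U (exit_pt m S j)}"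
    "amap U (exit_pt m S j) = amap U' (exit_pt m (swap_colours S) j)"
proof -
  note S = labyrinthD[OF lab] and lab' = labyrinth_swap[OF lab]
  have m: "m > 0" using S(1) by simp
  obtain k l where j: "j \<in> idx" and k: "U = up m k" "k 1 + k 2 + k 3 = int m - 1"
    and l: "U' = dn m l" "l 1 + l 2 + l 3 = int m + 1"
    and kl: "\<And>i. i \<in> idx \<Longrightarrow> l i = k i + (if i = j then 0 else 1)"
    and mem: "U \<in> white S" "U' \<in> white' S"
    using neighbours_coordinates[OF S(2,1) nb U] by blast
  show "j \<in> idx" by (rule j)
  show "carried S U = S" by (rule carried_white[OF S(2) mem(1)])
  show "carried S U' = swap_colours S" using mem(2) by (simp add: carried_def)
  show eq: "amap U (exit_pt m S j) = amap U' (exit_pt m (swap_colours S) j)"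
  proof (rule bc_eqI)
    fix i :: nat assume i: "i \<in> idx"
    have "bc j (exit_pt m S j) = 0" unfolding bc_exit_pt[OF S(1) j j] by simp
    then show "bc i (amap U (exit_pt m S j)) = bc i (amap U' (exit_pt m (swap_colours S) j))"
      unfolding k(1) l(1) bc_amap_up[OF m k(2) i] bc_amap_dn[OF m l(2) i] bc_exit_pt_swap[OF lab i j]
      using kl[OF i] by simp
  qed
  have "x = amap U (exit_pt m S j)"
    if x: "x \<in> amap U ` white_fractal S" "x \<in> amap U' ` white_fractal (swap_colours S)" for x
  proof -
    obtain p where p: "p \<in> white_fractal S" "x = amap U p" using x(1) by blast
    obtain q where q: "q \<in> white_fractal (swap_colours S)" "x = amap U' q" using x(2) by blast
    have "bc i p + bc i q = (if i = j then 0 else 1)" if i: "i \<in> idx" for i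
      using mult_bc_up[OF m k(2) i, of p] mult_bc_dn[OF m l(2) i, of q] p(2) q(2) kl[OF i] k(1) l(1)
        by simp
    then have "p = exit_pt m S j" by (rule mirror_meet[OF lab j p(1) q(1)])
    then show ?thesis using p(2) by simp
  qed
  moreover have "amap U (exit_pt m S j) \<in> amap U ` white_fractal S"
    using exit_pt_in_fractal[OF lab j] by blast
  moreover have "amap U (exit_pt m S j) \<in> amap U' ` white_fractal (swap_colours S)"
    unfolding eq using exit_pt_in_fractal[OF lab' j] by blast
  ultimately show "amap U ` white_fractal S \<inter> amap U' ` white_fractal (swap_colours S) =
      {amap U (exit_pt m S j)}"
    by blast
qed

lemma edgeI: "U \<in> W \<Longrightarrow> U' \<in> W \<Longrightarrow> neighbours m j U U' \<Longrightarrow> {U, U'} \<in> fst ` labelled_edges m W"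
  unfolding labelled_edges_def by (intro image_eqI[of _ _ "({U, U'}, j)"]) (simp, blast)

lemma edgeE:
  assumes "{U, V} \<in> fst ` labelled_edges m W"
  obtains j where "U \<in> W" "V \<in> W" "neighbours m j U V" | j where "U \<in> W" "V \<in> W"
    "neighbours m j V U"
proof -
  obtain A B j where "{U, V} = {A, B}" "A \<in> W" "B \<in> W" "neighbours m j A B"
    using assms unfolding labelled_edges_def by force
  then show thesis using that by (metis doubleton_eq_iff)
qed

lemma up_dn_meet:
  assumes lab: "labyrinth_patterns_system m S" and U: "U \<in> white S" and V: "V \<in> white' S"
    and p: "p \<in> white_fractal S" and q: "q \<in> white_fractal (swap_colours S)"
      and eq: "amap U p = amap V q"
  shows "\<exists>j. neighbours m j U V"
proof -
  note S = labyrinthD[OF lab]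
  have m: "m > 0" using S(1) by simp
  have UV: "U \<in> ups m" "V \<in> dns m" using U V S(2) by (auto simp: fits_def)
  obtain k where k: "U = up m k" "\<forall>i\<in>idx. 0 \<le> k i" "k 1 + k 2 + k 3 = int m - 1" using UV(1)
    by (rule upsE)
  obtain l where l: "V = dn m l" "\<forall>i\<in>idx. 1 \<le> l i" "l 1 + l 2 + l 3 = int m + 1" using UV(2)
    by (rule dnsE)
  have "bc i p + bc i q = real_of_int (l i - k i)" if i: "i \<in> idx" for i
    using mult_bc_up[OF m k(3) i, of p] mult_bc_dn[OF m l(3) i, of q] eq k(1) l(1) by simp
  then obtain j where j: "j \<in> idx" and kl: "\<And>i. i \<in> idx \<Longrightarrow> l i - k i = (if i = j then 0 else 1)"
    using opposite_fractals_sum[OF lab p q, of "\<lambda>i. l i - k i"] by blast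
  \<comment> \<open>\<open>neighbours\<close> ranges over natural indices; they are recovered by
    undoing the shift, which is possible as every \<open>l i\<close> is at least 1.\<close>
  have v: "int (nat (l i - 1)) = l i - 1" if "i \<in> idx" for i using bspec[OF l(2) that] by simp
  have v123: "int (nat (l 1 - 1)) = l 1 - 1" "int (nat (l 2 - 1)) = l 2 - 1"
    "int (nat (l 3 - 1)) = l 3 - 1"
    by (intro v; simp)+
  have V': "V = tri_T' m (int (nat (l 1 - 1))) (int (nat (l 2 - 1))) (int (nat (l 3 - 1)))"
    unfolding v123 l(1) dn_def ..
  have U': "U = tri_T m (int (nat (l 1 - 1)) + (if j = 1 then 1 else 0))
      (int (nat (l 2 - 1)) + (if j = 2 then 1 else 0)) (int (nat (l 3 - 1)) + (if j = 3 then 1 else 0))"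
  proof -
    have "k i = int (nat (l i - 1)) + (if j = i then 1 else 0)" if "i \<in> idx" for i
      unfolding v[OF that] using kl[OF that] by (simp split: if_splits)
    from this[of 1] this[of 2] this[of 3] show ?thesis unfolding k(1) up_def
      by (simp del: One_nat_def)
  qed
  have sum: "nat (l 1 - 1) + nat (l 2 - 1) + nat (l 3 - 1) = m - 2"
    using v123 l(3) S(1) by linarith
  show ?thesis
    unfolding neighbours_def using j sum V' U'
    by (intro exI[of _ j] conjI exI[of _ "nat (l 1 - 1)"] exI[of _ "nat (l 2 - 1)"] exI[of _ "nat (l 3 - 1)"])
qed

lemma pieces_meet:
  assumes lab: "labyrinth_patterns_system m S" and U: "U \<in> pieces S" and V: "V \<in> pieces S"
    and ne: "U \<noteq> V"
    and p: "p \<in> white_fractal (carried S U)" and q: "q \<in> white_fractal (carried S V)"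
    and eq: "amap U p = amap V q"
  shows "{U, V} \<in> fst ` labelled_edges m (pieces S)"
proof -
  note S = labyrinthD[OF lab] and lab' = labyrinth_swap[OF lab]
  have m: "m > 0" using S(1) by simp
  show ?thesis
  proof (cases rule: piece_cases[OF S(2) U])
    case 1
    note U1 = 1
    show ?thesis
    proof (cases rule: piece_cases[OF S(2) V])
      case 1
      obtain k where k: "U = up m k" "\<forall>i\<in>idx. 0 \<le> k i" "k 1 + k 2 + k 3 = int m - 1" using U1(2)
        by (rule upsE)
      obtain l where l: "V = up m l" "\<forall>i\<in>idx. 0 \<le> l i" "l 1 + l 2 + l 3 = int m - 1" using 1(2)
        by (rule upsE)
      have d: "bc i p - bc i q = real_of_int (l i - k i)" if i: "i \<in> idx" for i
        using mult_bc_up[OF m k(3) i, of p] mult_bc_up[OF m l(3) i, of q] eq k(1) l(1) by simp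
      have "p = q" using same_fractal_eq[OF lab _ _ d] p q U1(3) 1(3) by simp
      then have "k i = l i" if "i \<in> idx" for i using d[OF that] by simp
      then have "U = V" unfolding k(1) l(1) by (rule up_cong)
      then show ?thesis using ne by simp
    next
      case 2
      have "\<exists>j. neighbours m j U V"
        using p q U1(3) 2(3) eq by (intro up_dn_meet[OF lab U1(1) 2(1), of p q]) simp_all
      then show ?thesis using edgeI[OF U V] by blast
    qed
  next
    case 2
    note U2 = 2
    show ?thesis
    proof (cases rule: piece_cases[OF S(2) V])
      case 1
      have "\<exists>j. neighbours m j V U"
        using p q U2(3) 1(3) eq by (intro up_dn_meet[OF lab 1(1) U2(1), of q p]) simp_all
      then show ?thesis unfolding insert_commute[of U V] using edgeI[OF V U] by blast
    next
      case 2
      obtain k where k: "U = dn m k" "\<forall>i\<in>idx. 1 \<le> k i" "k 1 + k 2 + k 3 = int m + 1" using U2(2)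
        by (rule dnsE)
      obtain l where l: "V = dn m l" "\<forall>i\<in>idx. 1 \<le> l i" "l 1 + l 2 + l 3 = int m + 1" using 2(2)
        by (rule dnsE)
      have d: "bc i p - bc i q = real_of_int (k i - l i)" if i: "i \<in> idx" for i
        using mult_bc_dn[OF m k(3) i, of p] mult_bc_dn[OF m l(3) i, of q] eq k(1) l(1) by simp
      have "p = q" using same_fractal_eq[OF lab' _ _ d] p q U2(3) 2(3) by simp
      then have "k i = l i" if "i \<in> idx" for i using d[OF that] by simp
      then have "U = V" unfolding k(1) l(1) by (simp add: dn_def)
      then show ?thesis using ne by simp
    qed
  qed
qed

text \<open>A common white exit on two sides has two vanishing coordinates. Reflecting it along
  either side gives two yellow exits that are different corners, against the corners property.
  Distinct ends are what the arcs require.\<close>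

lemma exit_pt_distinct:
  assumes lab: "labyrinth_patterns_system m S" and ij: "i \<in> idx" "j \<in> idx" "i \<noteq> j"
  shows "exit_pt m S i \<noteq> exit_pt m S j"
proof
  assume eq: "exit_pt m S i = exit_pt m S j"
  note S = labyrinthD[OF lab] and lab' = labyrinth_swap[OF lab]
  have z: "bc h (exit_pt m S h) = 0" if "h \<in> idx" for h
    unfolding bc_exit_pt[OF S(1) that that] by simp
  have "bc j (exit_pt m (swap_colours S) i) = 1" "bc i (exit_pt m (swap_colours S) j) = 1"
    using bc_exit_pt_swap[OF lab ij(2,1)] bc_exit_pt_swap[OF lab ij(1,2)] z[OF ij(1)] z[OF ij(2)] eq ij(3)
    by simp_all
  moreover have "exit_pt m (swap_colours S) h \<in> T1" if "h \<in> idx" for h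
    using exit_pt_T1[OF labyrinthD(1,3)[OF lab'] that] .
  ultimately have "exit_pt m (swap_colours S) i = corner j"
    "exit_pt m (swap_colours S) j = corner i"
    using corner_eqI ij by blast+
  then have "corner j \<in> white_fractal (swap_colours S)" "corner i \<in> white_fractal (swap_colours S)"
    using exit_pt_in_fractal[OF lab' ij(1)] exit_pt_in_fractal[OF lab' ij(2)] by simp_all
  then show False using corner_unique[OF lab' ij(1,2)] ij(3) by blast
qed

section \<open>Both colours as one self-similar system\<close>

definition colour_system :: "patterns_system \<Rightarrow> bool \<Rightarrow> patterns_system" where
  "colour_system S c = (if c then S else swap_colours S)"

definition carried_colour :: "patterns_system \<Rightarrow> bool \<Rightarrow> triangle \<Rightarrow> bool" where
  "carried_colour S c U = (if U \<in> white' (colour_system S c) then \<not> c else c)"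

lemma carried_colour_system:
  "colour_system S (carried_colour S c U) = carried (colour_system S c) U"
  by (simp add: colour_system_def carried_colour_def carried_def)

lemma labyrinth_tree_ifs:
  assumes lab: "labyrinth_patterns_system m S"
  obtains D where "tree_ifs (\<lambda>c. pieces (colour_system S c))
    (\<lambda>c. fst ` labelled_edges m (pieces (colour_system S c))) amap (carried_colour S)
    (\<lambda>c. white_fractal (colour_system S c)) (\<lambda>c. exit_pt m (colour_system S c)) idx (1 / real m) D"
proof -
  obtain D where D: "\<And>p q. p \<in> T1 \<Longrightarrow> q \<in> T1 \<Longrightarrow> dist p q \<le> D" using T1_bounded by blast
  have labc: "labyrinth_patterns_system m (colour_system S c)" for c
    using lab labyrinth_swap[OF lab] by (simp add: colour_system_def)
  note S = labyrinthD[OF labc]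
  show thesis
  proof (rule that[of D], unfold_locales, unfold carried_colour_system)
    fix c
    show "finite (pieces (colour_system S c))" by (rule finite_pieces[OF S(2)])
    show "undirected_tree (pieces (colour_system S c)) (fst ` labelled_edges m (pieces (colour_system S c)))"
      using labc[of c] unfolding labyrinth_patterns_system_def tree_property_def pieces_def by blast
    show "0 < 1 / real m" "1 / real m < 1" using S(1) by simp_all
    show "compact (white_fractal (colour_system S c))" by (rule compact_white_fractal[OF S(2)])
    show "white_fractal (colour_system S c) =
        (\<Union>u\<in>pieces (colour_system S c). amap u ` white_fractal (carried (colour_system S c) u))"
      by (rule white_fractal_eq[OF S(2)])
  next
    fix c u x y assume "u \<in> pieces (colour_system S c)"
    then show "dist (amap u x) (amap u y) = 1 / real m * dist x y" by (rule dist_amap[OF S(2)])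
  next
    fix x c y assume "x \<in> white_fractal (colour_system S c)" "y \<in> white_fractal (colour_system S c)"
    then show "dist x y \<le> D" using white_fractal_T1[OF S(2)] D by blast
  next
    fix i c assume i: "i \<in> idx"
    show "exit_pt m (colour_system S c) i \<in> white_fractal (colour_system S c)"
      by (rule exit_pt_in_fractal[OF labc i])
    \<comment> \<open>The exit triangle is upright, so it carries the same colour, and its map fixes
      the exit point; the exit keeps its index in this piece.\<close>
    let ?e = "up m (exit_index m i (exit_pos m (colour_system S c) i))"
    have "?e \<in> white (colour_system S c)"
      using exit_at_exit_pos_self[OF S(3) i] by (simp add: exit_at_def)
    moreover have "amap ?e (exit_pt m (colour_system S c) i) = exit_pt m (colour_system S c) i"
      using amap_exit_pt[OF S(1) i, of 1 "colour_system S c"] by simp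
    ultimately show "\<exists>u\<in>pieces (colour_system S c). \<exists>i'\<in>idx.
        exit_pt m (colour_system S c) i = amap u (exit_pt m (carried (colour_system S c) u) i')"
      using carried_white[OF S(2)] i by (intro bexI[of _ ?e] bexI[of _ i]) (auto simp: pieces_def)
  next
    fix u c v assume uv: "u \<in> pieces (colour_system S c)" "v \<in> pieces (colour_system S c)" "u \<noteq> v"
    show "\<exists>l\<in>idx. amap u ` white_fractal (carried (colour_system S c) u) \<inter>
          amap v ` white_fractal (carried (colour_system S c) v) =
          {amap u (exit_pt m (carried (colour_system S c) u) l)}"
      if "{u, v} \<in> fst ` labelled_edges m (pieces (colour_system S c))"
      using that
    proof (cases rule: edgeE)
      case (1 j)
      note nb = neighbours_meet[OF labc 1(3) uv(1,2)]
      show ?thesis using nb(1,4) unfolding nb(2,3) by blast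
    next
      case (2 j)
      \<comment> \<open>Here \<open>u\<close> is the inverted piece, so the common point has to be
        renamed as an exit of the swapped system by \<open>nb(5)\<close>.\<close>
      note nb = neighbours_meet[OF labc 2(3) uv(2,1)]
      show ?thesis using nb(1,4) unfolding nb(2,3) nb(5) by (metis Int_commute)
    qed
    show "amap u ` white_fractal (carried (colour_system S c) u) \<inter>
          amap v ` white_fractal (carried (colour_system S c) v) = {}"
      if "{u, v} \<notin> fst ` labelled_edges m (pieces (colour_system S c))"
      using that pieces_meet[OF labc uv] by blast
  qed
qed

lemma white_triple_point:
  assumes lab: "labyrinth_patterns_system m S"
  shows "\<exists>C \<in> white_fractal S. {C} = white_arc m S 1 2 \<inter> white_arc m S 2 3 \<inter> white_arc m S 1 3"
proof -
  obtain D where "tree_ifs (\<lambda>c. pieces (colour_system S c))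
    (\<lambda>c. fst ` labelled_edges m (pieces (colour_system S c))) amap (carried_colour S)
    (\<lambda>c. white_fractal (colour_system S c)) (\<lambda>c. exit_pt m (colour_system S c)) idx (1 / real m) D"
    using labyrinth_tree_ifs[OF lab] .
  from tree_ifs.triple_point[OF this, of 1 2 3 True] exit_pt_distinct[OF lab, of 1 2]
    exit_pt_distinct[OF lab, of 2 3] exit_pt_distinct[OF lab, of 1 3]
  show ?thesis
    using white_exit_point_eq[OF lab, of 1] white_exit_point_eq[OF lab, of 2] white_exit_point_eq[OF lab, of 3]
    by (simp add: white_arc_def colour_system_def)
qed

theorem proposition7p4:
  fixes m :: nat and S :: patterns_system
  assumes "labyrinth_patterns_system m S"
  shows "(\<exists>C \<in> white_fractal S. {C} = white_arc m S 1 2 \<inter> white_arc m S 2 3 \<inter> white_arc m S 1 3) \<and>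
         (\<exists>C \<in> yellow_fractal S. {C} = yellow_arc m S 1 2 \<inter> yellow_arc m S 2 3 \<inter> yellow_arc m S 1 3)"
proof
  have "yellow_arc m S i j = white_arc m (swap_colours S) i j" if "i \<in> idx" "j \<in> idx" for i j
    using yellow_exit_point_eq[OF assms that(1)] yellow_exit_point_eq[OF assms that(2)]
    by (simp add: yellow_arc_def white_arc_def yellow_fractal_swap)
  then show "\<exists>C \<in> yellow_fractal S. {C} = yellow_arc m S 1 2 \<inter> yellow_arc m S 2 3 \<inter>
      yellow_arc m S 1 3"
    using white_triple_point[OF labyrinth_swap[OF assms]] by (simp add: yellow_fractal_swap)
qed (rule white_triple_point[OF assms])

end
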